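(* Let $U\in L^2_{\mathcal F}([0,T],\mathbb R^m)$, extended by $U(s)=0$ for $s\in[-h,0)$, let $X$ be the solution of $$dX(t)=\big(A(t)X(t)+B(t)U(t-h)+\overline r(t)\big)\,dt+\sigma(t)\,dW_t,\qquad X(0)=0,$$ and let $$Y(t)=X(t)+\int_{t-h}^t\Phi_A(t,s+h)B(s+h)U(s)\,ds$$ be its Artstein transform. Then for all $t\in[h,T]$, $$\Sigma_X(t)=\Phi_A(t,t-h)\,\Sigma_Y(t-h)\,\Phi_A(t,t-h)^T+\Sigma_{\min}(t),$$ where $$\Sigma_{\min}(t)=\int_{t-h}^t\Phi_A(t,s)\sigma(s)\sigma(s)^T\Phi_A(t,s)^T\,ds .$$
   Context: Let $n,m$ be positive integers, $T>0$ and $0<h<T$. Let $(\Omega,(\mathcal F_t)_{t\ge0},\mathbb P)$ be a filtered probability space carrying a one-dimensional Wiener process $W$ with respect to $(\mathcal F_t)$ (adapted, with increments $W_t-W_s$ independent of $\mathcal F_s$ for $s<t$). $L^2_{\mathcal F}([0,T],\mathbb R^m)$ is the set of square-integrable $\mathcal F$-adapted processes on $[0,T]$ with values in $\mathbb R^m$. For an $L^\infty$ matrix function $M$, $\Phi_M(t,s)$ is the fundamental matrix: $\frac{d}{dt}\Phi_M(t,s)=M(t)\Phi_M(t,s)$, $\Phi_M(s,s)=I$. For a process $Z$, $\Sigma_Z(t)=\mathbb E[(Z(t)-\mathbb E[Z(t)])(Z(t)-\mathbb E[Z(t)])^T]$ is its covariance matrix. Standing assumptions: $A\in L^\infty([0,T+h],\mathbb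 R^{n\times n})$, $B\in L^\infty([0,T+h],\mathbb R^{n\times m})$, $\sigma,\overline r\in L^\infty([0,T],\mathbb R^n)$ are deterministic, and the Gramian $G_\tau^{T+h}=\int_\tau^{T+h}\Phi_A(T+h,s)B(s)B(s)^T\Phi_A(T+h,s)^T\,ds$ is invertible for all $0<\tau<T+h$. *)

theory Defs
  imports "HOL-Probability.Probability"
begin

definition Linfty_on :: "real set \<Rightarrow> (real \<Rightarrow> 'b::euclidean_space) \<Rightarrow> bool" where
  "Linfty_on S f \<longleftrightarrow> f \<in> borel_measurable (lebesgue_on S) \<and>
     (\<exists>C. AE x in lebesgue_on S. norm (f x) \<le> C)"

text \<open>The function f is absolutely continuous on the interval with almost-everywhere
  derivative g; with merely measurable, bounded coefficients this (Caratheodory) reading of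
  f' = g is the one under which linear differential equations are uniquely solvable.\<close>

definition abs_cont_deriv_on ::
    "real \<Rightarrow> real \<Rightarrow> (real \<Rightarrow> 'b::euclidean_space) \<Rightarrow> (real \<Rightarrow> 'b) \<Rightarrow> bool" where
  "abs_cont_deriv_on a b f g \<longleftrightarrow>
     set_integrable lebesgue {a..b} g \<and>
     (\<forall>u v. a \<le> u \<longrightarrow> u \<le> v \<longrightarrow> v \<le> b \<longrightarrow> f v - f u = (LINT x:{u..v}|lebesgue. g x))"

text \<open>Both time orders are covered: the first argument may be smaller than the second.\<close>

definition fundamental_matrix_on ::
    "real \<Rightarrow> real \<Rightarrow> (real \<Rightarrow> real^'n^'n) \<Rightarrow> (real \<Rightarrow> real \<Rightarrow> real^'n^'n) \<Rightarrow> bool" where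
  "fundamental_matrix_on a b M \<Phi> \<longleftrightarrow>
     (\<forall>s\<in>{a..b}. \<Phi> s s = mat 1 \<and>
        abs_cont_deriv_on a b (\<lambda>t. \<Phi> t s) (\<lambda>t. M t ** \<Phi> t s))"

definition gramian ::
    "(real \<Rightarrow> real \<Rightarrow> real^'n^'n) \<Rightarrow> (real \<Rightarrow> real^'m^'n) \<Rightarrow> real \<Rightarrow> real \<Rightarrow> real^'n^'n" where
  "gramian \<Phi> B \<tau> R =
     (LINT s:{\<tau>..R}|lebesgue. \<Phi> R s ** B s ** transpose (B s) ** transpose (\<Phi> R s))"

definition outer_square :: "real^'n \<Rightarrow> real^'n^'n" where
  "outer_square v = (columnvector v :: real^1^'n) ** (rowvector v :: real^'n^1)"

lemma outer_square_nth: "outer_square v $ i $ j = v $ i * v $ j"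
  by (simp add: outer_square_def matrix_matrix_mult_def columnvector_def rowvector_def)

definition covariance_matrix :: "'a measure \<Rightarrow> ('a \<Rightarrow> real^'n) \<Rightarrow> real^'n^'n" where
  "covariance_matrix M Z =
     integral\<^sup>L M (\<lambda>\<omega>. outer_square (Z \<omega> - integral\<^sup>L M Z))"

text \<open>Filtrations and processes live on nonnegative times; values of F, W and X at
  negative times are irrelevant.\<close>

definition filtered_prob_space :: "'a measure \<Rightarrow> (real \<Rightarrow> 'a measure) \<Rightarrow> bool" where
  "filtered_prob_space M F \<longleftrightarrow> prob_space M \<and> (\<forall>t\<ge>0. subalgebra M (F t)) \<and>
     (\<forall>s t. 0 \<le> s \<longrightarrow> s \<le> t \<longrightarrow> sets (F s) \<subseteq> sets (F t))"

definition wiener_process ::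
    "'a measure \<Rightarrow> (real \<Rightarrow> 'a measure) \<Rightarrow> (real \<Rightarrow> 'a \<Rightarrow> real) \<Rightarrow> bool" where
  "wiener_process M F W \<longleftrightarrow>
     (\<forall>t\<ge>0. W t \<in> borel_measurable (F t)) \<and>
     (AE \<omega> in M. W 0 \<omega> = 0) \<and>
     (AE \<omega> in M. continuous_on {0..} (\<lambda>t. W t \<omega>)) \<and>
     (\<forall>s t. 0 \<le> s \<longrightarrow> s < t \<longrightarrow>
        distributed M lborel (\<lambda>\<omega>. W t \<omega> - W s \<omega>) (normal_density 0 (sqrt (t - s))) \<and>
        prob_space.indep_set M
          (sets (vimage_algebra (space M) (\<lambda>\<omega>. W t \<omega> - W s \<omega>) borel)) (sets (F s)))"

definition L2_adapted ::
    "'a measure \<Rightarrow> (real \<Rightarrow> 'a measure) \<Rightarrow> real \<Rightarrow> (real \<Rightarrow> 'a \<Rightarrow> 'b::euclidean_space) \<Rightarrow> bool" where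
  "L2_adapted M F T U \<longleftrightarrow>
     (\<forall>t\<in>{0..T}. U t \<in> borel_measurable (F t)) \<and>
     (\<lambda>(t, \<omega>). U t \<omega>) \<in> borel_measurable (restrict_space lborel {0..T} \<Otimes>\<^sub>M M) \<and>
     integrable (restrict_space lborel {0..T} \<Otimes>\<^sub>M M) (\<lambda>(t, \<omega>). (norm (U t \<omega>))\<^sup>2)"

text \<open>A step function is given by a number N of steps, grid points p 0, ..., p N and
  values c 0, ..., c (N - 1).\<close>

definition step_fun ::
    "nat \<Rightarrow> (nat \<Rightarrow> real) \<Rightarrow> (nat \<Rightarrow> 'b::euclidean_space) \<Rightarrow> real \<Rightarrow> 'b" where
  "step_fun N p c x = (\<Sum>i<N. indicator {p i<..p (Suc i)} x *\<^sub>R c i)"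

definition step_wiener_integral ::
    "(real \<Rightarrow> 'a \<Rightarrow> real) \<Rightarrow> nat \<Rightarrow> (nat \<Rightarrow> real) \<Rightarrow> (nat \<Rightarrow> 'b::euclidean_space) \<Rightarrow> 'a \<Rightarrow> 'b" where
  "step_wiener_integral W N p c \<omega> = (\<Sum>i<N. (W (p (Suc i)) \<omega> - W (p i) \<omega>) *\<^sub>R c i)"

text \<open>The stochastic integral of a deterministic square-integrable f with respect to W is
  determined up to almost-sure equality, hence a relation: I is an L2 limit of integrals of
  step functions that approximate f in L2.\<close>

definition has_wiener_integral ::
    "'a measure \<Rightarrow> (real \<Rightarrow> 'a \<Rightarrow> real) \<Rightarrow> real \<Rightarrow> real \<Rightarrow> (real \<Rightarrow> 'b::euclidean_space) \<Rightarrow>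
     ('a \<Rightarrow> 'b) \<Rightarrow> bool" where
  "has_wiener_integral M W a b f I \<longleftrightarrow> I \<in> borel_measurable M \<and>
     (\<exists>N p c.
        (\<forall>k. \<forall>i<N k. p k i \<le> p k (Suc i)) \<and> (\<forall>k. \<forall>i\<le>N k. p k i \<in> {a..b}) \<and>
        (\<lambda>k. \<integral>\<^sup>+x\<in>{a..b}. ennreal ((norm (step_fun (N k) (p k) (c k) x - f x))\<^sup>2) \<partial>lebesgue)
          \<longlonglongrightarrow> 0 \<and>
        (\<lambda>k. \<integral>\<^sup>+\<omega>. ennreal ((norm (step_wiener_integral W (N k) (p k) (c k) \<omega> - I \<omega>))\<^sup>2) \<partial>M)
          \<longlonglongrightarrow> 0)"

text \<open>X is an adapted process with continuous paths satisfying
  dX(t) = b(t, X(t)) dt + S(t) dW, X(0) = x, in integrated form on [0, T], where the drift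
  may depend on the sample point and the diffusion coefficient is deterministic.\<close>

definition sde_solution ::
    "'a measure \<Rightarrow> (real \<Rightarrow> 'a measure) \<Rightarrow> (real \<Rightarrow> 'a \<Rightarrow> real) \<Rightarrow> real \<Rightarrow>
     (real \<Rightarrow> 'a \<Rightarrow> 'b \<Rightarrow> 'b) \<Rightarrow> (real \<Rightarrow> 'b::euclidean_space) \<Rightarrow> 'b \<Rightarrow>
     (real \<Rightarrow> 'a \<Rightarrow> 'b) \<Rightarrow> bool" where
  "sde_solution M F W T b S x X \<longleftrightarrow>
     (\<forall>t\<in>{0..T}. X t \<in> borel_measurable (F t)) \<and>
     (AE \<omega> in M. continuous_on {0..T} (\<lambda>t. X t \<omega>)) \<and>
     (AE \<omega> in M. X 0 \<omega> = x) \<and>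
     (AE \<omega> in M. set_integrable lebesgue {0..T} (\<lambda>s. b s \<omega> (X s \<omega>))) \<and>
     (\<forall>t\<in>{0..T}. \<exists>I. has_wiener_integral M W 0 t S I \<and>
        (AE \<omega> in M. X t \<omega> = x + (LINT s:{0..t}|lebesgue. b s \<omega> (X s \<omega>)) + I \<omega>))"

definition artstein_transform ::
    "(real \<Rightarrow> real \<Rightarrow> real^'n^'n) \<Rightarrow> (real \<Rightarrow> real^'m^'n) \<Rightarrow> real \<Rightarrow>
     (real \<Rightarrow> 'a \<Rightarrow> real^'m) \<Rightarrow> (real \<Rightarrow> 'a \<Rightarrow> real^'n) \<Rightarrow> real \<Rightarrow> 'a \<Rightarrow> real^'n" where
  "artstein_transform \<Phi> B h U X t \<omega> =
     X t \<omega> + (LINT s:{t - h..t}|lebesgue. (\<Phi> t (s + h) ** B (s + h)) *v U s \<omega>)"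

definition Sigma_min ::
    "(real \<Rightarrow> real \<Rightarrow> real^'n^'n) \<Rightarrow> (real \<Rightarrow> real^'n) \<Rightarrow> real \<Rightarrow> real \<Rightarrow> real^'n^'n" where
  "Sigma_min \<Phi> \<sigma> h t =
     (LINT s:{t - h..t}|lebesgue. \<Phi> t s ** outer_square (\<sigma> s) ** transpose (\<Phi> t s))"

end

(* Let N_s be the noise X_s - X_a - (integral of the drift over [a,s]) with a = t - h. Pathwise
   variation of constants gives X_t = Phi(t,a) Y_a + (deterministic) + J: the controls that still
   act during [a,t] are those already chosen up to time a, which is what Y_a records. Here
   J = N_t + int_a^t Phi(t,s) A(s) N_s ds, so no stochastic calculus beyond the Wiener isometry is
   needed. Increments after time a are orthogonal to L2(F_a), and hence so is J, and the cross terms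
   of the covariance vanish. The values N_s have the same inner products as the functions
   d_s(v) = 1[v <= s] sigma(v) in L2(a,t). By Fubini, J has the second moments of
   d_t + int_a^t Phi(t,s) A(s) d_s ds, which is v |-> Phi(t,v) sigma(v); this gives Sigma_min. *)
theory Submission
  imports Defs
begin

section \<open>Square-integrable functions\<close>

text \<open>The Wiener integral is available only as an L2 limit at each fixed time, determined up
  to a null set that may depend on the time. Integrating the noise against ds therefore calls for a
  jointly measurable version of it, hence the care about null sets. The coefficients are merely
  bounded and measurable, and \<Phi> is described by an equation in its first argument alone;
  continuity in the second argument, which the kernels need, has to be won from invertibility. The
  controls are adapted at each time but jointly measurable only with respect to the full
  sigma-algebra, so that the integral in Y_a is not visibly F_a-measurable; orthogonality to it is
  proved under the time integral, one control value at a time. Nor is X_a known to be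
  square-integrable in advance: the same decomposition, applied on [0,a], supplies this. Vectors and
  matrices are handled entry by entry, so that every second moment is an inner product of real
  functions.\<close>

definition square_integrable :: "'a measure \<Rightarrow> ('a \<Rightarrow> real) \<Rightarrow> bool" where
  "square_integrable M f \<longleftrightarrow> f \<in> borel_measurable M \<and> integrable M (\<lambda>x. (f x)\<^sup>2)"

lemma square_integrableI:
  "f \<in> borel_measurable M \<Longrightarrow> integrable M (\<lambda>x. (f x)\<^sup>2) \<Longrightarrow> square_integrable M f"
  by (simp add: square_integrable_def)

lemma square_integrable_measurable:
  "square_integrable M f \<Longrightarrow> f \<in> borel_measurable M"
  by (simp add: square_integrable_def)

lemma square_integrable_square:
  "square_integrable M f \<Longrightarrow> integrable M (\<lambda>x. (f x)\<^sup>2)"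
  by (simp add: square_integrable_def)

lemma square_integrable_bound:
  assumes "g \<in> borel_measurable M" "integrable M b" "AE x in M. (g x)\<^sup>2 \<le> b x"
  shows "square_integrable M g"
proof (rule square_integrableI)
  show "integrable M (\<lambda>x. (g x)\<^sup>2)"
    by (rule Bochner_Integration.integrable_bound[OF assms(2)])
       (use assms in auto)
qed fact

lemma square_integrable_mult:
  assumes "square_integrable M f" "square_integrable M g"
  shows "integrable M (\<lambda>x. f x * g x)"
proof (rule Bochner_Integration.integrable_bound)
  show "integrable M (\<lambda>x. (f x)\<^sup>2 + (g x)\<^sup>2)"
    using assms by (auto simp: square_integrable_def)
  show "(\<lambda>x. f x * g x) \<in> borel_measurable M"
    using assms by (auto simp: square_integrable_def)
  have "\<bar>a * b\<bar> \<le> a\<^sup>2 + b\<^sup>2" for a b :: real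
    using sum_squares_bound[of "\<bar>a\<bar>" "\<bar>b\<bar>"] abs_ge_zero[of "a*b"] unfolding abs_mult power2_abs by linarith
  then show "AE x in M. norm (f x * g x) \<le> norm ((f x)\<^sup>2 + (g x)\<^sup>2)"
    by auto
qed

lemma square_integrable_cmult:
  assumes "square_integrable M f"
  shows "square_integrable M (\<lambda>x. c * f x)"
  using assms by (auto simp: square_integrable_def power_mult_distrib)

lemma square_integrable_add:
  assumes "square_integrable M f" "square_integrable M g"
  shows "square_integrable M (\<lambda>x. f x + g x)"
  using assms square_integrable_mult[OF assms]
  by (auto simp: square_integrable_def power2_sum mult.assoc)

lemma square_integrable_diff:
  assumes "square_integrable M f" "square_integrable M g"
  shows "square_integrable M (\<lambda>x. f x - g x)"
  using square_integrable_add[OF assms(1) square_integrable_cmult[OF assms(2), of "-1"]] by simp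

lemma square_integrable_zero: "square_integrable M (\<lambda>x. 0)"
  by (simp add: square_integrable_def)

lemma square_integrable_sum:
  assumes "\<And>i. i \<in> S \<Longrightarrow> square_integrable M (f i)"
  shows "square_integrable M (\<lambda>x. \<Sum>i\<in>S. f i x)"
  using assms
  by (induction S rule: infinite_finite_induct)
     (auto intro: square_integrable_zero square_integrable_add)

lemma square_integrable_cong_AE:
  assumes "square_integrable M f" "g \<in> borel_measurable M" "AE x in M. f x = g x"
  shows "square_integrable M g"
  by (rule square_integrable_bound[OF assms(2) square_integrable_square[OF assms(1)]])
     (use assms(3) in auto)

lemma (in finite_measure) square_integrable_const: "square_integrable M (\<lambda>x. c)"
  by (simp add: square_integrable_def)

lemma (in finite_measure) square_integrable_integrable:
  assumes "square_integrable M f"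
  shows "integrable M f"
  using square_integrable_mult[OF assms square_integrable_const[of 1]] by simp

text \<open>The quadratic form \<integral> (s f + t g)^2 in s and t is nonnegative, which bounds its
  discriminant.\<close>

lemma square_integrable_Cauchy_Schwarz:
  assumes f: "square_integrable M f" and g: "square_integrable M g"
  shows "(\<integral>x. f x * g x \<partial>M)\<^sup>2 \<le> (\<integral>x. (f x)\<^sup>2 \<partial>M) * (\<integral>x. (g x)\<^sup>2 \<partial>M)"
proof -
  define a b c where "a = (\<integral>x. (f x)\<^sup>2 \<partial>M)" and "b = (\<integral>x. f x * g x \<partial>M)"
    and "c = (\<integral>x. (g x)\<^sup>2 \<partial>M)"
  have q: "a * s\<^sup>2 + 2 * b * s * t + c * t\<^sup>2 \<ge> 0" for s t
  proof -
    have "0 \<le> (\<integral>x. (s * f x + t * g x)\<^sup>2 \<partial>M)"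
      by (rule integral_nonneg_AE) auto
    also have "\<dots> = (\<integral>x. s\<^sup>2 * (f x)\<^sup>2 + (2 * s * t) * (f x * g x) + t\<^sup>2 * (g x)\<^sup>2 \<partial>M)"
      by (intro Bochner_Integration.integral_cong refl) (simp add: power2_eq_square algebra_simps)
    also have "\<dots> = s\<^sup>2 * a + (2 * s * t) * b + t\<^sup>2 * c"
      using square_integrable_square[OF f] square_integrable_square[OF g] square_integrable_mult[OF f g]
      by (simp add: a_def b_def c_def)
    finally show ?thesis by (simp add: algebra_simps)
  qed
  have a0: "a \<ge> 0" and c0: "c \<ge> 0" using q[of 1 0] q[of 0 1] by auto
  have "b\<^sup>2 \<le> a * c"
  proof (cases "c = 0")
    case True
    have "b = 0"
    proof (rule ccontr)
      assume "b \<noteq> 0"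
      \<comment> \<open>With \<open>s = 1\<close>, \<open>c = 0\<close> and this value of
        \<open>t\<close> the form equals -1.\<close>
      then show False using q[of 1 "- (a + 1) / (2 * b)"] True by (simp add: field_simps)
    qed
    then show ?thesis using True by simp
  next
    case False
    have "0 \<le> a * c\<^sup>2 - 2 * b * c * b + c * b\<^sup>2" using q[of c "-b"] by simp
    also have "\<dots> = c * (a * c - b\<^sup>2)" by (simp add: power2_eq_square algebra_simps)
    finally show ?thesis using False c0 by (simp add: zero_le_mult_iff)
  qed
  then show ?thesis by (simp add: a_def b_def c_def)
qed

text \<open>The norms of \<open>f k\<close> converge and are therefore bounded; Cauchy-Schwarz then
  squeezes the squared inner products to 0.\<close>

lemma L2_product_tendsto_zero:
  assumes "\<And>k. square_integrable M (f k)" "\<And>k. square_integrable M (g k)"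
    and "(\<lambda>k. \<integral>x. (f k x)\<^sup>2 \<partial>M) \<longlonglongrightarrow> a" "(\<lambda>k. \<integral>x. (g k x)\<^sup>2 \<partial>M) \<longlonglongrightarrow> 0"
  shows "(\<lambda>k. \<integral>x. f k x * g k x \<partial>M) \<longlonglongrightarrow> 0"
proof -
  have "(\<lambda>k. (\<integral>x. (f k x)\<^sup>2 \<partial>M) * (\<integral>x. (g k x)\<^sup>2 \<partial>M)) \<longlonglongrightarrow> a * 0"
    by (intro tendsto_mult assms)
  then have u: "(\<lambda>k. (\<integral>x. (f k x)\<^sup>2 \<partial>M) * (\<integral>x. (g k x)\<^sup>2 \<partial>M)) \<longlonglongrightarrow> 0"
    by simp
  have "(\<integral>x. f k x * g k x \<partial>M)\<^sup>2 \<le> (\<integral>x. (f k x)\<^sup>2 \<partial>M) * (\<integral>x. (g k x)\<^sup>2 \<partial>M)" for k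
    by (rule square_integrable_Cauchy_Schwarz[OF assms(1,2)])
  then have "(\<lambda>k. (\<integral>x. f k x * g k x \<partial>M)\<^sup>2) \<longlonglongrightarrow> 0"
    by (intro tendsto_sandwich[OF _ _ tendsto_const u] always_eventually allI) simp_all
  then show ?thesis by simp
qed

text \<open>Writing \<open>f k\<close> as \<open>F + (f k - F)\<close> and \<open>g k\<close> as
  \<open>G + (g k - G)\<close> leaves three error products, each with a factor that tends to 0 in
  L2.\<close>

lemma L2_inner_tendsto:
  assumes f: "\<And>k. square_integrable M (f k)" "square_integrable M F"
    and g: "\<And>k. square_integrable M (g k)" "square_integrable M G"
    and fl: "(\<lambda>k. \<integral>x. (f k x - F x)\<^sup>2 \<partial>M) \<longlonglongrightarrow> 0"
    and gl: "(\<lambda>k. \<integral>x. (g k x - G x)\<^sup>2 \<partial>M) \<longlonglongrightarrow> 0"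
  shows "(\<lambda>k. \<integral>x. f k x * g k x \<partial>M) \<longlonglongrightarrow> (\<integral>x. F x * G x \<partial>M)"
proof -
  have fd: "square_integrable M (\<lambda>x. f k x - F x)" and gd: "square_integrable M (\<lambda>x. g k x - G x)" for k
    using f g by (auto intro: square_integrable_diff)
  have 1: "(\<lambda>k. \<integral>x. (f k x - F x) * (g k x - G x) \<partial>M) \<longlonglongrightarrow> 0"
    by (rule L2_product_tendsto_zero[OF fd gd fl gl])
  have 2: "(\<lambda>k. \<integral>x. F x * (g k x - G x) \<partial>M) \<longlonglongrightarrow> 0"
    by (rule L2_product_tendsto_zero[OF f(2) gd _ gl, of "\<integral>x. (F x)\<^sup>2 \<partial>M"]) auto
  have 3: "(\<lambda>k. \<integral>x. G x * (f k x - F x) \<partial>M) \<longlonglongrightarrow> 0"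
    by (rule L2_product_tendsto_zero[OF g(2) fd _ fl, of "\<integral>x. (G x)\<^sup>2 \<partial>M"]) auto
  have eq: "(\<integral>x. f k x * g k x \<partial>M) = (\<integral>x. (f k x - F x) * (g k x - G x) \<partial>M)
      + (\<integral>x. F x * (g k x - G x) \<partial>M) + (\<integral>x. G x * (f k x - F x) \<partial>M) + (\<integral>x. F x * G x \<partial>M)" for k
  proof -
    have "(\<integral>x. f k x * g k x \<partial>M) = (\<integral>x. (f k x - F x) * (g k x - G x) + F x * (g k x - G x)
        + G x * (f k x - F x) + F x * G x \<partial>M)"
      by (intro Bochner_Integration.integral_cong refl) (simp add: algebra_simps)
    then show ?thesis
      using square_integrable_mult[OF fd gd] square_integrable_mult[OF f(2) gd]
        square_integrable_mult[OF g(2) fd] square_integrable_mult[OF f(2) g(2)] by simp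
  qed
  show ?thesis
    unfolding eq using tendsto_add[OF tendsto_add[OF tendsto_add[OF 1 2] 3] tendsto_const] by simp
qed

text \<open>Square-integrability on the product makes the integral over \<open>S\<close> an L2
  function on \<open>M\<close> and justifies Fubini against any other L2 function. The second factor
  is a general finite measure because it is the probability space for the noise and the control, but
  the interval [a,b] for the deterministic functions d_s.\<close>

locale L2_process = S: finite_measure S + M: finite_measure M
  for S :: "'s measure" and M :: "'a measure" +
  fixes Z :: "'s \<Rightarrow> 'a \<Rightarrow> real"
  assumes square_integrable_pair: "square_integrable (S \<Otimes>\<^sub>M M) (\<lambda>(s, \<omega>). Z s \<omega>)"
begin

sublocale pair_sigma_finite S M ..

lemma pair_measurable[measurable]: "(\<lambda>(s, \<omega>). Z s \<omega>) \<in> borel_measurable (S \<Otimes>\<^sub>M M)"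
  using square_integrable_pair by (rule square_integrable_measurable)

lemma integral_measurable: "(\<lambda>\<omega>. \<integral>s. Z s \<omega> \<partial>S) \<in> borel_measurable M"
  by measurable

lemma section_measurable[measurable]:
  "s \<in> space S \<Longrightarrow> Z s \<in> borel_measurable M"
  "\<omega> \<in> space M \<Longrightarrow> (\<lambda>s. Z s \<omega>) \<in> borel_measurable S"
  using measurable_Pair2[OF pair_measurable] measurable_Pair1[OF pair_measurable] by auto

lemma AE_square_integrable: "AE \<omega> in M. square_integrable S (\<lambda>s. Z s \<omega>)"
proof -
  have "integrable (S \<Otimes>\<^sub>M M) (\<lambda>(s, \<omega>). (Z s \<omega>)\<^sup>2)"
    using square_integrable_pair by (simp add: square_integrable_def split_def)
  from AE_integrable_snd[OF this] AE_space
  show ?thesis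
    by eventually_elim (simp add: square_integrable_def)
qed

lemma AE_section_square_integrable: "AE s in S. square_integrable M (Z s)"
proof -
  have "integrable (S \<Otimes>\<^sub>M M) (\<lambda>(s, \<omega>). (Z s \<omega>)\<^sup>2)"
    using square_integrable_pair by (simp add: square_integrable_def split_def)
  from AE_integrable_fst[OF this] AE_space
  show ?thesis
    by eventually_elim (simp add: square_integrable_def)
qed

text \<open>Cauchy-Schwarz against the constant 1 on the finite measure \<open>S\<close> bounds the
  square of the integral by \<open>measure S (space S)\<close> times the integral of the
  square.\<close>

lemma square_integrable_integral: "square_integrable M (\<lambda>\<omega>. \<integral>s. Z s \<omega> \<partial>S)"
proof (rule square_integrable_bound[where b="\<lambda>\<omega>. measure S (space S) * (\<integral>s. (Z s \<omega>)\<^sup>2 \<partial>S)"])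
  show "(\<lambda>\<omega>. \<integral>s. Z s \<omega> \<partial>S) \<in> borel_measurable M"
    by (rule integral_measurable)
  have "integrable (S \<Otimes>\<^sub>M M) (\<lambda>(s, \<omega>). (Z s \<omega>)\<^sup>2)"
    using square_integrable_pair by (simp add: square_integrable_def split_def)
  then have "integrable M (\<lambda>\<omega>. \<integral>s. (Z s \<omega>)\<^sup>2 \<partial>S)"
    by (rule integrable_snd)
  then show "integrable M (\<lambda>\<omega>. measure S (space S) * (\<integral>s. (Z s \<omega>)\<^sup>2 \<partial>S))"
    by (metis integrable_mult_right)
  show "AE \<omega> in M. (\<integral>s. Z s \<omega> \<partial>S)\<^sup>2 \<le> measure S (space S) * (\<integral>s. (Z s \<omega>)\<^sup>2 \<partial>S)"
    using AE_square_integrable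
  proof eventually_elim
    case (elim \<omega>)
    have "(\<integral>s. 1 * Z s \<omega> \<partial>S)\<^sup>2 \<le> (\<integral>s. 1\<^sup>2 \<partial>S) * (\<integral>s. (Z s \<omega>)\<^sup>2 \<partial>S)"
      by (rule square_integrable_Cauchy_Schwarz[OF S.square_integrable_const elim])
    moreover have "(\<integral>s. 1\<^sup>2 \<partial>S) = measure S (space S)" by simp
    ultimately show ?case by simp
  qed
qed

text \<open>Since \<open>S\<close> is finite, \<eta> stays square-integrable as a function on the
  product, where it is then multiplied with another L2 function.\<close>

lemma integrable_mult_pair:
  assumes "square_integrable M \<eta>"
  shows "integrable (S \<Otimes>\<^sub>M M) (\<lambda>(s, \<omega>). Z s \<omega> * \<eta> \<omega>)"
proof -
  have [measurable]: "\<eta> \<in> borel_measurable M"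
    using assms by (rule square_integrable_measurable)
  have "integrable (S \<Otimes>\<^sub>M M) (\<lambda>(s, \<omega>). (\<eta> \<omega>)\<^sup>2)"
    by (rule Fubini_integrable) (use square_integrable_square[OF assms] in auto)
  then have "square_integrable (S \<Otimes>\<^sub>M M) (\<lambda>(s, \<omega>). \<eta> \<omega>)"
    by (auto simp: square_integrable_def split_def)
  from square_integrable_mult[OF square_integrable_pair this]
  show ?thesis by (simp add: split_def)
qed

text \<open>Through this exchange, inner products of the single sections \<open>Z s\<close>
  determine those of their integral; the orthogonality relations and the covariance computation both
  rest on it.\<close>

lemma expectation_integral_mult:
  assumes "square_integrable M \<eta>"
  shows "(\<integral>\<omega>. (\<integral>s. Z s \<omega> \<partial>S) * \<eta> \<omega> \<partial>M) = (\<integral>s. (\<integral>\<omega>. Z s \<omega> * \<eta> \<omega> \<partial>M) \<partial>S)"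
  using Fubini_integral[OF integrable_mult_pair[OF assms]] by simp

end

section \<open>Linear differential equations\<close>

lemma bounded_bilinear_matrix_vector_mult:
  "bounded_bilinear ((*v) :: real^'n^'m \<Rightarrow> real^'n \<Rightarrow> real^'m)"
  unfolding bilinear_conv_bounded_bilinear[symmetric] bilinear_def
  by (auto simp: linear_iff matrix_vector_mult_def vec_eq_iff sum.distrib sum_distrib_left algebra_simps)

lemma bounded_bilinear_matrix_matrix_mult:
  "bounded_bilinear ((**) :: real^'n^'m \<Rightarrow> real^'k^'n \<Rightarrow> real^'k^'m)"
  unfolding bilinear_conv_bounded_bilinear[symmetric] bilinear_def
  by (auto simp: linear_iff matrix_matrix_mult_def vec_eq_iff sum.distrib sum_distrib_left algebra_simps)

lemmas continuous_on_matrix_vector_mult =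
  bounded_bilinear.continuous_on[OF bounded_bilinear_matrix_vector_mult]

lemmas bounded_linear_matrix_vector_left =
  bounded_bilinear.bounded_linear_left[OF bounded_bilinear_matrix_vector_mult]

lemmas bounded_linear_matrix_vector_right =
  bounded_bilinear.bounded_linear_right[OF bounded_bilinear_matrix_vector_mult]

lemma borel_measurable_matrix_vector_mult[measurable]:
  fixes A :: "'a \<Rightarrow> real^'n^'m"
  assumes "A \<in> borel_measurable M" "x \<in> borel_measurable M"
  shows "(\<lambda>s. A s *v x s) \<in> borel_measurable M"
  by (rule borel_measurable_continuous_Pair[OF assms])
     (intro continuous_on_matrix_vector_mult continuous_intros)

lemma borel_measurable_matrix_matrix_mult[measurable]:
  fixes A :: "'a \<Rightarrow> real^'n^'m" and B :: "'a \<Rightarrow> real^'k^'n"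
  assumes "A \<in> borel_measurable M" "B \<in> borel_measurable M"
  shows "(\<lambda>s. A s ** B s) \<in> borel_measurable M"
  by (rule borel_measurable_continuous_Pair[OF assms])
     (intro bounded_bilinear.continuous_on[OF bounded_bilinear_matrix_matrix_mult] continuous_intros)

text \<open>The definitions speak of set integrals over \<open>lebesgue\<close>; the proofs use the
  measure \<open>lebesgue_on\<close>, which is finite on a compact interval and can be a factor of a
  product measure.\<close>

lemma set_integrable_lebesgue_on:
  fixes f :: "real \<Rightarrow> 'b::{banach, second_countable_topology}"
  shows
  "set_integrable lebesgue {a..b::real} f \<longleftrightarrow> integrable (lebesgue_on {a..b}) f"
  unfolding set_integrable_def using integrable_restrict_space[of "{a..b}" lebesgue f] by simp

lemma LINT_lebesgue_on:
  fixes f :: "real \<Rightarrow> 'b::{banach, second_countable_topology}"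
  shows "(LINT x:{a..b}|lebesgue. f x) = integral\<^sup>L (lebesgue_on {a..b}) f"
  unfolding set_lebesgue_integral_def by (subst integral_restrict_space) auto

lemma finite_measure_lebesgue_on_Icc: "finite_measure (lebesgue_on {a..b::real})"
  by (rule finite_measure_lebesgue_on) simp

lemma integrable_lebesgue_on_subinterval:
  fixes f :: "real \<Rightarrow> 'b::euclidean_space"
  assumes "integrable (lebesgue_on {a..b}) f" "a \<le> c" "d \<le> b"
  shows "integrable (lebesgue_on {c..d}) f"
proof -
  have "set_integrable lebesgue {c..d} f"
    by (rule set_integrable_subset[where A="{a..b}"]) (use assms in \<open>auto simp: set_integrable_lebesgue_on\<close>)
  then show ?thesis by (simp add: set_integrable_lebesgue_on)
qed

lemma AE_lebesgue_on_subset: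
  assumes "AE x in lebesgue_on S. P x" "T \<subseteq> S" "S \<in> sets lebesgue" "T \<in> sets lebesgue"
  shows "AE x in lebesgue_on T. P x"
  using assms by (auto simp: AE_restrict_space_iff elim: eventually_mono)

lemma AE_lebesgue_on_subinterval:
  fixes a b :: real
  assumes "AE x in lebesgue_on {a..b}. P x" "a \<le> c" "d \<le> b"
  shows "AE x in lebesgue_on {c..d}. P x"
  by (rule AE_lebesgue_on_subset[OF assms(1)]) (use assms in auto)

lemma measurable_lebesgue_on_subinterval:
  fixes a b :: real
  assumes "f \<in> borel_measurable (lebesgue_on {a..b})" "a \<le> c" "d \<le> b"
  shows "f \<in> borel_measurable (lebesgue_on {c..d})"
  by (rule measurable_restrict_mono[OF assms(1)]) (use assms in auto)

text \<open>Moves a variable endpoint into an indicator, so that iterated integrals over a triangle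
  become integrals over the square of one fixed measure.\<close>

lemma integral_lebesgue_on_initial:
  fixes f :: "real \<Rightarrow> 'b::{banach, second_countable_topology}"
  assumes "s \<in> {a..b}"
  shows "integral\<^sup>L (lebesgue_on {a..s}) f = (\<integral>u. indicator {..s} u *\<^sub>R f u \<partial>lebesgue_on {a..b})"
proof -
  have eq: "indicator {a..b} u * indicator {..s} u = (indicator {a..s} u :: real)" for u
    using assms by (auto simp: indicator_def)
  have "(\<integral>u. indicator {..s} u *\<^sub>R f u \<partial>lebesgue_on {a..b}) = (\<integral>u. indicator {a..s} u *\<^sub>R f u \<partial>lebesgue)"
    by (subst integral_restrict_space) (auto simp: eq)
  also have "\<dots> = integral\<^sup>L (lebesgue_on {a..s}) f"
    by (subst integral_restrict_space) auto
  finally show ?thesis by simp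
qed

lemma integral_lebesgue_on_tail:
  fixes f :: "real \<Rightarrow> 'b::{banach, second_countable_topology}"
  assumes "s \<in> {a..b}"
  shows "integral\<^sup>L (lebesgue_on {s..b}) f = (\<integral>u. indicator {s..} u *\<^sub>R f u \<partial>lebesgue_on {a..b})"
proof -
  have eq: "indicator {a..b} u * indicator {s..} u = (indicator {s..b} u :: real)" for u
    using assms by (auto simp: indicator_def)
  have "(\<integral>u. indicator {s..} u *\<^sub>R f u \<partial>lebesgue_on {a..b}) = (\<integral>u. indicator {s..b} u *\<^sub>R f u \<partial>lebesgue)"
    by (subst integral_restrict_space) (auto simp: eq)
  also have "\<dots> = integral\<^sup>L (lebesgue_on {s..b}) f"
    by (subst integral_restrict_space) auto
  finally show ?thesis by simp
qed

lemma integral_lebesgue_on_split: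
  fixes f :: "real \<Rightarrow> 'b::euclidean_space"
  assumes "integrable (lebesgue_on {a..b}) f" "a \<le> c" "c \<le> b"
  shows "integral\<^sup>L (lebesgue_on {a..b}) f
       = integral\<^sup>L (lebesgue_on {a..c}) f + integral\<^sup>L (lebesgue_on {c..b}) f"
  using Henstock_Kurzweil_Integration.integral_combine[of a c b f] assms
    integrable_on_lebesgue_on[OF assms(1)]
    integrable_lebesgue_on_subinterval[OF assms(1), of a c]
    integrable_lebesgue_on_subinterval[OF assms(1), of c b]
  by (simp add: lebesgue_integral_eq_integral)

text \<open>The exponentially weighted maximum of y is at most half of itself.\<close>

lemma linear_integral_equation_zero:
  fixes y :: "real \<Rightarrow> 'b::euclidean_space" and L :: "real \<Rightarrow> 'b \<Rightarrow> 'b"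
  assumes y: "continuous_on {a..b} y"
    and eq: "\<And>s. s \<in> {a..b} \<Longrightarrow> y s = (\<integral>u. L u (y u) \<partial>lebesgue_on {a..s})"
    and L: "AE u in lebesgue_on {a..b}. \<forall>x. norm (L u x) \<le> C * norm x"
    and s: "s \<in> {a..b}"
  shows "y s = 0"
proof -
  \<comment> \<open>\<open>C\<close> may be 0 or negative, whereas the antiderivative below needs a
    positive rate.\<close>
  define K where "K = max C 1"
  have K: "K \<ge> 1" by (simp add: K_def)
  \<comment> \<open>The rate \<open>2 * K\<close> is twice a growth bound for \<open>L\<close>:
    integrating \<open>K * m * exp (2 * K * (u - a))\<close> then produces the factor 1/2 that
    forces the maximum \<open>m\<close> to be nonpositive.\<close>
  define w where "w u = exp (- 2 * K * (u - a)) * norm (y u)" for u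
  have "continuous_on {a..b} w" unfolding w_def by (intro continuous_intros y)
  moreover have "{a..b} \<noteq> {}" using s by auto
  ultimately obtain v where v: "v \<in> {a..b}" and max: "\<And>u. u \<in> {a..b} \<Longrightarrow> w u \<le> w v"
    using continuous_attains_sup[of "{a..b}" w] by auto
  define m where "m = w v"
  have m0: "m \<ge> 0" by (simp add: m_def w_def)
  have yb: "norm (y u) \<le> m * exp (2 * K * (u - a))" if "u \<in> {a..b}" for u
  proof -
    have "exp (- 2 * K * (u - a)) * norm (y u) * exp (2 * K * (u - a)) \<le> m * exp (2 * K * (u - a))"
      using max[OF that] by (intro mult_right_mono) (simp_all add: w_def m_def)
    moreover have "exp (- E) * n * exp E = n" for E n :: real
      by (simp add: exp_minus)
    then have "exp (- 2 * K * (u - a)) * norm (y u) * exp (2 * K * (u - a)) = norm (y u)"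
      by (metis minus_mult_left)
    ultimately show ?thesis by metis
  qed
  have "((\<lambda>u. K * m * exp (2 * K * (u - a))) has_integral
      (m / 2 * exp (2 * K * (v - a)) - m / 2 * exp (2 * K * (a - a)))) {a..v}"
    using v K by (intro fundamental_theorem_of_calculus)
      (auto intro!: derivative_eq_intros simp: has_real_derivative_iff_has_vector_derivative[symmetric])
  then have I: "integral {a..v} (\<lambda>u. K * m * exp (2 * K * (u - a)))
      = m / 2 * exp (2 * K * (v - a)) - m / 2 * exp (2 * K * (a - a))"
    by (rule integral_unique)
  have int: "integrable (lebesgue_on {a..v}) (\<lambda>u. K * m * exp (2 * K * (u - a)))"
    by (intro continuous_imp_integrable_real continuous_intros)
  have "norm (y v) \<le> (\<integral>u. norm (L u (y u)) \<partial>lebesgue_on {a..v})"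
    using eq[OF v] integral_norm_bound[of "lebesgue_on {a..v}" "\<lambda>u. L u (y u)"] by metis
  also have "\<dots> \<le> (\<integral>u. K * m * exp (2 * K * (u - a)) \<partial>lebesgue_on {a..v})"
  proof (rule integral_mono_AE'[OF int])
    have "AE u in lebesgue_on {a..v}. \<forall>x. norm (L u x) \<le> C * norm x"
      by (rule AE_lebesgue_on_subinterval[OF L]) (use v in auto)
    then show "AE u in lebesgue_on {a..v}. norm (L u (y u)) \<le> K * m * exp (2 * K * (u - a))"
      using AE_space
    proof eventually_elim
      case (elim u)
      then have u: "u \<in> {a..b}" using v by auto
      have "norm (L u (y u)) \<le> C * norm (y u)" using elim by blast
      also have "\<dots> \<le> K * norm (y u)" by (intro mult_right_mono) (auto simp: K_def)
      also have "\<dots> \<le> K * (m * exp (2 * K * (u - a)))" using K yb[OF u] by (intro mult_left_mono) auto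
      finally show ?case by simp
    qed
  qed (use K m0 in auto)
  also have "\<dots> = integral {a..v} (\<lambda>u. K * m * exp (2 * K * (u - a)))"
    by (rule lebesgue_integral_eq_integral[OF int]) simp
  also note I
  finally have "norm (y v) \<le> m / 2 * exp (2 * K * (v - a)) - m / 2" by simp
  moreover have "norm (y v) = m * exp (2 * K * (v - a))"
    by (simp add: m_def w_def exp_minus)
  ultimately have "m * exp (2 * K * (v - a)) \<le> m / 2 * exp (2 * K * (v - a)) - m / 2"
    by simp
  moreover have "m / 2 * exp (2 * K * (v - a)) \<ge> 0" using m0 by simp
  ultimately have "m \<le> 0" by simp
  then have "norm (y s) \<le> 0"
    using yb[OF s] m0 by simp
  then show ?thesis by simp
qed

lemma integrable_product:
  fixes f g :: "_ \<Rightarrow> real"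
  assumes "sigma_finite_measure M1" "sigma_finite_measure M2"
    and f: "integrable M1 f" and g: "integrable M2 g"
  shows "integrable (M1 \<Otimes>\<^sub>M M2) (\<lambda>(x, y). f x * g y)"
proof -
  interpret S1: sigma_finite_measure M1 by fact
  interpret S2: sigma_finite_measure M2 by fact
  interpret pair_sigma_finite M1 M2 ..
  have [measurable]: "f \<in> borel_measurable M1" "g \<in> borel_measurable M2" using f g by auto
  show ?thesis
    by (rule Fubini_integrable) (use f g in \<open>auto simp: abs_mult\<close>)
qed

text \<open>Fubini on the triangle u \<le> w of the square, with the product of the two integrable
  norms as a majorant. It takes the place of the product rule when the candidate in
  \<open>variation_of_constants\<close> is checked.\<close>

lemma matrix_vector_iterated_integral:
  fixes K :: "real \<Rightarrow> real^'n^'m" and k :: "real \<Rightarrow> real^'n"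
  assumes K: "integrable (lebesgue_on {a..s}) K" and k: "integrable (lebesgue_on {a..s}) k"
  shows "(\<integral>w. K w *v (\<integral>u. k u \<partial>lebesgue_on {a..w}) \<partial>lebesgue_on {a..s})
       = (\<integral>u. (\<integral>w. K w \<partial>lebesgue_on {u..s}) *v k u \<partial>lebesgue_on {a..s})"
proof -
  let ?S = "lebesgue_on {a..s}"
  interpret S: finite_measure ?S by (rule finite_measure_lebesgue_on_Icc)
  interpret pair_sigma_finite ?S ?S ..
  have [measurable]: "K \<in> borel_measurable ?S" "k \<in> borel_measurable ?S" using K k by auto
  \<comment> \<open>The completed sigma-algebra has to be compared with the Borel one before the
    order relation u \<le> w is measurable on the product.\<close>
  have idm[measurable]: "(\<lambda>x. x) \<in> borel_measurable ?S"
    by (rule measurable_restrict_space1) (simp add: measurable_completion)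
  obtain c where c: "\<And>X x. norm (X *v x :: real^'m) \<le> norm (X :: real^'n^'m) * norm x * c"
    using bounded_bilinear.bounded[OF bounded_bilinear_matrix_vector_mult] by blast
  define G where "G w u = indicator {..w} u *\<^sub>R (K w *v k u)" for w u
  have Gi: "integrable (?S \<Otimes>\<^sub>M ?S) (\<lambda>(w, u). G w u)"
  proof (rule Bochner_Integration.integrable_bound)
    have "integrable (?S \<Otimes>\<^sub>M ?S) (\<lambda>(w, u). norm (K w) * norm (k u))"
      by (rule integrable_product) (use K k in \<open>auto intro: S.sigma_finite_measure_axioms\<close>)
    then show "integrable (?S \<Otimes>\<^sub>M ?S) (\<lambda>p. c * (norm (K (fst p)) * norm (k (snd p))))"
      by (auto simp: split_def)
    have "(\<lambda>p. if snd p \<le> fst p then 1 else 0 :: real) \<in> borel_measurable (?S \<Otimes>\<^sub>M ?S)"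
      by measurable
    then have [measurable]: "(\<lambda>p. indicator {..fst p} (snd p) :: real) \<in> borel_measurable (?S \<Otimes>\<^sub>M ?S)"
      by (simp add: indicator_def of_bool_def)
    then show "(\<lambda>(w, u). G w u) \<in> borel_measurable (?S \<Otimes>\<^sub>M ?S)"
      unfolding G_def split_def by measurable
    have "norm (G w u) \<le> norm (c * (norm (K w) * norm (k u)))" for w u
      using c[of "K w" "k u"] by (auto simp: G_def indicator_def mult.commute)
    then show "AE p in ?S \<Otimes>\<^sub>M ?S. norm (case p of (w, u) \<Rightarrow> G w u)
        \<le> norm (c * (norm (K (fst p)) * norm (k (snd p))))"
      by (auto simp: split_def)
  qed
  have 1: "K w *v (\<integral>u. k u \<partial>lebesgue_on {a..w}) = (\<integral>u. G w u \<partial>?S)" if "w \<in> {a..s}" for w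
  proof -
    have "integrable (lebesgue_on {a..w}) k"
      by (rule integrable_lebesgue_on_subinterval[OF k]) (use that in auto)
    then have "K w *v (\<integral>u. k u \<partial>lebesgue_on {a..w}) = (\<integral>u. K w *v k u \<partial>lebesgue_on {a..w})"
      by (rule integral_bounded_linear[OF bounded_linear_matrix_vector_right, symmetric])
    then show ?thesis
      by (simp add: integral_lebesgue_on_initial[OF that] G_def)
  qed
  have 2: "(\<integral>w. K w \<partial>lebesgue_on {u..s}) *v k u = (\<integral>w. G w u \<partial>?S)" if "u \<in> {a..s}" for u
  proof -
    have "integrable (lebesgue_on {u..s}) K"
      by (rule integrable_lebesgue_on_subinterval[OF K]) (use that in auto)
    then have "(\<integral>w. K w \<partial>lebesgue_on {u..s}) *v k u = (\<integral>w. K w *v k u \<partial>lebesgue_on {u..s})"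
      by (rule integral_bounded_linear[OF bounded_linear_matrix_vector_left, symmetric])
    also have "\<dots> = (\<integral>w. indicator {u..} w *\<^sub>R (K w *v k u) \<partial>?S)"
      by (rule integral_lebesgue_on_tail[OF that])
    finally show ?thesis by (simp add: G_def indicator_def)
  qed
  have "(\<integral>w. K w *v (\<integral>u. k u \<partial>lebesgue_on {a..w}) \<partial>?S) = (\<integral>w. (\<integral>u. G w u \<partial>?S) \<partial>?S)"
    by (rule Bochner_Integration.integral_cong) (auto simp: 1)
  also have "\<dots> = (\<integral>u. (\<integral>w. G w u \<partial>?S) \<partial>?S)"
    using Fubini_integral[OF Gi] by simp
  also have "\<dots> = (\<integral>u. (\<integral>w. K w \<partial>lebesgue_on {u..s}) *v k u \<partial>?S)"
    by (rule Bochner_Integration.integral_cong) (auto simp: 2)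
  finally show ?thesis .
qed

section \<open>Continuity of determinants and inverse matrices\<close>

lemma continuous_on_det:
  fixes A :: "'a::topological_space \<Rightarrow> real^'n^'n"
  assumes "\<And>i j. continuous_on S (\<lambda>x. A x $ i $ j)"
  shows "continuous_on S (\<lambda>x. det (A x))"
  unfolding det_def by (intro continuous_intros assms)

text \<open>Cramer's rule exhibits the inverse as a continuous function.\<close>

lemma continuous_on_matrix_right_inverse:
  fixes P Q :: "'a::topological_space \<Rightarrow> real^'n^'n"
  assumes P: "continuous_on S P" and PQ: "\<And>x. x \<in> S \<Longrightarrow> P x ** Q x = mat 1"
  shows "continuous_on S Q"
proof -
  have Pc: "continuous_on S (\<lambda>x. P x $ i $ j)" for i j
    by (intro continuous_intros P)
  have d: "det (P x) \<noteq> 0" if "x \<in> S" for x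
  proof -
    have "det (P x) * det (Q x) = 1" by (simp add: PQ[OF that] flip: det_mul)
    then show ?thesis by auto
  qed
  \<comment> \<open>Cramer's quotient for entry \<open>k\<close> of the solution z of
    \<open>P x *v z = column c (mat 1)\<close>, which is column \<open>c\<close> of
    \<open>Q x\<close>.\<close>
  define R where "R x k c = det (\<chi> i j. if j = k then column c (mat 1) $ i else P x $ i $ j) / det (P x)"
    for x k c
  have "Q x $ k $ c = R x k c" if "x \<in> S" for x k c
  proof -
    have "P x *v column c (Q x) = column c (P x ** Q x)"
      by (simp add: vec_eq_iff matrix_vector_mult_def matrix_matrix_mult_def column_def)
    then have "P x *v column c (Q x) = column c (mat 1)"
      using PQ[OF that] by simp
    then have "column c (Q x) = (\<chi> k. det (\<chi> i j. if j = k then column c (mat 1) $ i else P x $ i $ j) / det (P x))"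
      by (rule iffD1[OF cramer[OF d[OF that]]])
    then show ?thesis
      unfolding R_def vec_eq_iff by (simp add: column_def)
  qed
  then have eq: "Q x = (\<chi> k c. R x k c)" if "x \<in> S" for x
    using that by (simp add: vec_eq_iff)
  have "continuous_on S (\<lambda>x. R x k c)" for k c
    unfolding R_def
  proof (intro continuous_on_divide continuous_on_det)
    fix i j
    show "continuous_on S (\<lambda>x. (\<chi> i j. if j = k then column c (mat 1) $ i else P x $ i $ j) $ i $ j)"
      by (cases "j = k") (simp_all add: Pc)
  qed (simp_all add: Pc d)
  then have "continuous_on S (\<lambda>x. \<chi> k c. R x k c)"
    by (intro continuous_on_vec_lambda)
  then show ?thesis
    by (rule continuous_on_eq) (simp add: eq)
qed

text \<open>One null set serves all vectors at once. This operator form of the essential bound is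
  the one that the uniqueness and integrability lemmas take as input.\<close>

lemma Linfty_on_matrix_bound:
  fixes A :: "real \<Rightarrow> real^'n^'m"
  assumes "Linfty_on S A"
  shows "\<exists>C. AE u in lebesgue_on S. \<forall>x. norm (A u *v x) \<le> C * norm x"
proof -
  obtain c where c: "c > 0" "\<And>X x. norm (X *v x :: real^'m) \<le> norm (X :: real^'n^'m) * norm x * c"
    using bounded_bilinear.pos_bounded[OF bounded_bilinear_matrix_vector_mult] by blast
  obtain D where D: "AE u in lebesgue_on S. norm (A u) \<le> D"
    using assms by (auto simp: Linfty_on_def)
  have "AE u in lebesgue_on S. \<forall>x. norm (A u *v x) \<le> (c * max D 1) * norm x"
    using D
  proof eventually_elim
    case (elim u)
    show ?case
    proof
      fix x :: "real^'n"
      have "norm (A u) * norm x * c \<le> max D 1 * norm x * c"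
        using elim c(1) by (intro mult_right_mono) auto
      with c(2)[of "A u" x] show "norm (A u *v x) \<le> (c * max D 1) * norm x"
        by (simp add: mult.commute mult.left_commute)
    qed
  qed
  then show ?thesis by blast
qed

lemma integrable_bounded_matrix_vector:
  fixes P :: "real \<Rightarrow> real^'m^'k" and g :: "real \<Rightarrow> real^'m"
  assumes P: "P \<in> borel_measurable (lebesgue_on S)" "AE u in lebesgue_on S. \<forall>x. norm (P u *v x) \<le> C * norm x"
    and g: "integrable (lebesgue_on S) g"
  shows "integrable (lebesgue_on S) (\<lambda>u. P u *v g u)"
proof (rule Bochner_Integration.integrable_bound)
  show "integrable (lebesgue_on S) (\<lambda>u. C * norm (g u))" using g by simp
  show "(\<lambda>u. P u *v g u) \<in> borel_measurable (lebesgue_on S)"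
    using P(1) g by measurable
  show "AE u in lebesgue_on S. norm (P u *v g u) \<le> norm (C * norm (g u))"
    using P(2)
  proof eventually_elim
    case (elim u)
    then have "norm (P u *v g u) \<le> C * norm (g u)" by blast
    also have "\<dots> \<le> norm (C * norm (g u))" by simp
    finally show ?case .
  qed
qed

lemma continuous_matrix_Linfty:
  fixes P :: "real \<Rightarrow> real^'m^'k"
  assumes "continuous_on {a..b} P"
  shows "Linfty_on {a..b} P"
proof -
  have "bounded (P ` {a..b})" by (intro compact_imp_bounded compact_continuous_image assms compact_Icc)
  then obtain c where "\<forall>x\<in>{a..b}. norm (P x) \<le> c" by (auto simp: bounded_iff)
  then show ?thesis
    unfolding Linfty_on_def
    by (auto intro!: continuous_imp_measurable_on_sets_lebesgue assms exI[of _ c])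
qed

lemma integrable_continuous_matrix_vector:
  fixes P :: "real \<Rightarrow> real^'m^'k" and g :: "real \<Rightarrow> real^'m"
  assumes P: "continuous_on {a..b} P" and g: "integrable (lebesgue_on {a..b}) g"
  shows "integrable (lebesgue_on {a..b}) (\<lambda>u. P u *v g u)"
proof -
  obtain C where "AE u in lebesgue_on {a..b}. \<forall>x. norm (P u *v x) \<le> C * norm x"
    using Linfty_on_matrix_bound[OF continuous_matrix_Linfty[OF P]] by blast
  moreover have "P \<in> borel_measurable (lebesgue_on {a..b})"
    using continuous_matrix_Linfty[OF P] by (simp add: Linfty_on_def)
  ultimately show ?thesis by (intro integrable_bounded_matrix_vector g)
qed

text \<open>Only the equation in the first argument of \<Phi> is given; the cocycle identity,
  invertibility and continuity in the second argument are derived from it.\<close>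

locale linear_system =
  fixes R :: real and A :: "real \<Rightarrow> real^'n^'n" and \<Phi> :: "real \<Rightarrow> real \<Rightarrow> real^'n^'n"
  assumes R_nonneg: "0 \<le> R"
    and Linfty: "Linfty_on {0..R} A"
    and fundamental: "fundamental_matrix_on 0 R A \<Phi>"
begin

lemma fundamental_self: "s \<in> {0..R} \<Longrightarrow> \<Phi> s s = mat 1"
  using fundamental by (simp add: fundamental_matrix_on_def)

lemma integrable_deriv: "v \<in> {0..R} \<Longrightarrow> integrable (lebesgue_on {0..R}) (\<lambda>t. A t ** \<Phi> t v)"
  using fundamental
  by (simp add: fundamental_matrix_on_def abs_cont_deriv_on_def set_integrable_lebesgue_on)

lemma fundamental_increment:
  assumes "v \<in> {0..R}" "0 \<le> s" "s \<le> t" "t \<le> R"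
  shows "\<Phi> t v - \<Phi> s v = (\<integral>w. A w ** \<Phi> w v \<partial>lebesgue_on {s..t})"
  using fundamental assms
  unfolding fundamental_matrix_on_def abs_cont_deriv_on_def LINT_lebesgue_on by blast

lemma continuous_on_fundamental_left:
  assumes "v \<in> {0..R}"
  shows "continuous_on {0..R} (\<lambda>t. \<Phi> t v)"
proof -
  have "continuous_on {0..R} (\<lambda>t. \<Phi> 0 v + (\<integral>w. A w ** \<Phi> w v \<partial>lebesgue_on {0..t}))"
    by (intro continuous_intros indefinite_integral_continuous_real integrable_deriv assms)
  then show ?thesis
  proof (rule continuous_on_eq)
    fix t assume "t \<in> {0..R}"
    then show "\<Phi> 0 v + (\<integral>w. A w ** \<Phi> w v \<partial>lebesgue_on {0..t}) = \<Phi> t v"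
      using fundamental_increment[OF assms, of 0 t] by (simp add: algebra_simps)
  qed
qed

text \<open>Applied to a vector, both sides solve z' = A z and agree at time 0, so their difference
  vanishes by uniqueness. The intermediate time is 0 because the uniqueness lemma runs forward from
  the left endpoint; both orders of \<open>t\<close> and \<open>v\<close> are thereby
  covered.\<close>

lemma fundamental_from_0:
  assumes t: "t \<in> {0..R}" and v: "v \<in> {0..R}"
  shows "\<Phi> t 0 ** \<Phi> 0 v = \<Phi> t v"
proof -
  obtain C where C: "AE u in lebesgue_on {0..R}. \<forall>x. norm (A u *v x) \<le> C * norm x"
    using Linfty_on_matrix_bound[OF Linfty] by blast
  have 0: "0 \<in> {0..R}" using R_nonneg by simp
  have "\<Phi> t 0 *v (\<Phi> 0 v *v x) - \<Phi> t v *v x = 0" for x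
  proof (rule linear_integral_equation_zero[where y="\<lambda>t. \<Phi> t 0 *v (\<Phi> 0 v *v x) - \<Phi> t v *v x", OF _ _ C t])
    show "continuous_on {0..R} (\<lambda>t. \<Phi> t 0 *v (\<Phi> 0 v *v x) - \<Phi> t v *v x)"
      by (intro continuous_on_diff continuous_on_const continuous_on_matrix_vector_mult
          continuous_on_fundamental_left[OF 0] continuous_on_fundamental_left[OF v])
    fix s assume s: "s \<in> {0..R}"
    have eq: "\<Phi> s w *v z = \<Phi> 0 w *v z + (\<integral>u. A u *v (\<Phi> u w *v z) \<partial>lebesgue_on {0..s})"
      and int: "integrable (lebesgue_on {0..s}) (\<lambda>u. A u *v (\<Phi> u w *v z))" if w: "w \<in> {0..R}" for w z
    proof -
      have i: "integrable (lebesgue_on {0..s}) (\<lambda>u. A u ** \<Phi> u w)"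
        by (rule integrable_lebesgue_on_subinterval[OF integrable_deriv[OF w]]) (use s in auto)
      have "\<Phi> s w *v z - \<Phi> 0 w *v z = (\<Phi> s w - \<Phi> 0 w) *v z"
        by (simp add: matrix_vector_mult_diff_rdistrib)
      also have "\<Phi> s w - \<Phi> 0 w = (\<integral>u. A u ** \<Phi> u w \<partial>lebesgue_on {0..s})"
        by (rule fundamental_increment[OF w]) (use s in auto)
      also have "(\<integral>u. A u ** \<Phi> u w \<partial>lebesgue_on {0..s}) *v z = (\<integral>u. (A u ** \<Phi> u w) *v z \<partial>lebesgue_on {0..s})"
        by (rule integral_bounded_linear[OF bounded_linear_matrix_vector_left i, symmetric])
      finally show "\<Phi> s w *v z = \<Phi> 0 w *v z + (\<integral>u. A u *v (\<Phi> u w *v z) \<partial>lebesgue_on {0..s})"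
        by (simp add: matrix_vector_mul_assoc algebra_simps)
      show "integrable (lebesgue_on {0..s}) (\<lambda>u. A u *v (\<Phi> u w *v z))"
        using integrable_bounded_linear[OF bounded_linear_matrix_vector_left i, of z]
        by (simp add: matrix_vector_mul_assoc)
    qed
    show "\<Phi> s 0 *v (\<Phi> 0 v *v x) - \<Phi> s v *v x
        = (\<integral>u. A u *v (\<Phi> u 0 *v (\<Phi> 0 v *v x) - \<Phi> u v *v x) \<partial>lebesgue_on {0..s})"
      using eq[OF 0, of "\<Phi> 0 v *v x"] eq[OF v, of x] int[OF 0, of "\<Phi> 0 v *v x"] int[OF v, of x]
      by (simp add: fundamental_self[OF 0] matrix_vector_mult_diff_distrib)
  qed
  then show ?thesis
    by (auto simp: matrix_eq simp flip: matrix_vector_mul_assoc)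
qed

lemma fundamental_inverse:
  assumes "v \<in> {0..R}"
  shows "\<Phi> v 0 ** \<Phi> 0 v = mat 1" "\<Phi> 0 v ** \<Phi> v 0 = mat 1"
proof -
  show "\<Phi> v 0 ** \<Phi> 0 v = mat 1" using fundamental_from_0[OF assms assms] fundamental_self[OF assms] by simp
  then show "\<Phi> 0 v ** \<Phi> v 0 = mat 1" by (rule matrix_left_right_inverse1)
qed

text \<open>Both factors are routed through time 0, where the inverse pair \<open>\<Phi> 0 s\<close>
  and \<open>\<Phi> s 0\<close> cancels.\<close>

lemma fundamental_cocycle:
  assumes "t \<in> {0..R}" "s \<in> {0..R}" "v \<in> {0..R}"
  shows "\<Phi> t s ** \<Phi> s v = \<Phi> t v"
proof -
  have "\<Phi> t s ** \<Phi> s v = (\<Phi> t 0 ** \<Phi> 0 s) ** (\<Phi> s 0 ** \<Phi> 0 v)"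
    using assms by (simp add: fundamental_from_0)
  also have "\<dots> = \<Phi> t 0 ** (\<Phi> 0 s ** \<Phi> s 0) ** \<Phi> 0 v"
    by (simp add: matrix_mul_assoc)
  finally have "\<Phi> t s ** \<Phi> s v = \<Phi> t 0 ** (\<Phi> 0 s ** \<Phi> s 0) ** \<Phi> 0 v" .
  then show ?thesis using assms by (simp add: fundamental_inverse fundamental_from_0)
qed

text \<open>\<open>\<Phi> 0 v\<close> is the inverse of \<open>\<Phi> v 0\<close>, whose continuity
  in \<open>v\<close> is known; multiplication by the fixed matrix \<open>\<Phi> t 0\<close> gives
  the general case.\<close>

lemma continuous_on_fundamental_right:
  assumes "t \<in> {0..R}"
  shows "continuous_on {0..R} (\<lambda>v. \<Phi> t v)"
proof -
  have 0: "0 \<in> {0..R}" using R_nonneg by simp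
  have "continuous_on {0..R} (\<lambda>v. \<Phi> 0 v)"
    by (rule continuous_on_matrix_right_inverse[OF continuous_on_fundamental_left[OF 0]])
       (rule fundamental_inverse)
  then have "continuous_on {0..R} (\<lambda>v. \<Phi> t 0 ** \<Phi> 0 v)"
    by (intro bounded_bilinear.continuous_on[OF bounded_bilinear_matrix_matrix_mult] continuous_on_const)
  then show ?thesis
    by (rule continuous_on_eq) (use assms fundamental_from_0 in auto)
qed

text \<open>The candidate V(s) = \<Phi>(s,0) \<integral> \<Phi>(0,u) g(u) du solves the same
  integral equation, so \<open>y - V\<close> solves the homogeneous one and is 0 by uniqueness. No
  derivative of \<open>V\<close> is taken.\<close>

lemma variation_of_constants:
  assumes ab: "0 \<le> a" "a \<le> b" "b \<le> R"
    and y: "continuous_on {a..b} y" and g: "integrable (lebesgue_on {a..b}) g"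
    and eq: "\<And>s. s \<in> {a..b} \<Longrightarrow> y s = (\<integral>u. A u *v y u + g u \<partial>lebesgue_on {a..s})"
    and s: "s \<in> {a..b}"
  shows "y s = (\<integral>u. \<Phi> s u *v g u \<partial>lebesgue_on {a..s})"
proof -
  have 0: "0 \<in> {0..R}" using R_nonneg by simp
  obtain C where "AE u in lebesgue_on {0..R}. \<forall>x. norm (A u *v x) \<le> C * norm x"
    using Linfty_on_matrix_bound[OF Linfty] by blast
  then have C: "AE u in lebesgue_on {a..b}. \<forall>x. norm (A u *v x) \<le> C * norm x"
    by (rule AE_lebesgue_on_subinterval) (use ab in auto)
  have Am: "A \<in> borel_measurable (lebesgue_on {a..b})"
    by (rule measurable_lebesgue_on_subinterval[of A 0 R]) (use Linfty ab in \<open>auto simp: Linfty_on_def\<close>)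
  have Ai: "integrable (lebesgue_on {a..s}) (\<lambda>u. A u *v z u)"
    if "continuous_on {a..b} z" "s \<in> {a..b}" for z :: "real \<Rightarrow> real^'n" and s
  proof -
    have "integrable (lebesgue_on {a..b}) (\<lambda>u. A u *v z u)"
      by (rule integrable_bounded_matrix_vector[OF Am C continuous_imp_integrable_real[OF that(1)]])
    then show ?thesis by (rule integrable_lebesgue_on_subinterval) (use that in auto)
  qed
  have gi: "integrable (lebesgue_on {a..s}) g" if "s \<in> {a..b}" for s
    by (rule integrable_lebesgue_on_subinterval[OF g]) (use that in auto)
  have sub: "{a..b} \<subseteq> {0..R}" using ab by auto
  \<comment> \<open>The forcing is pulled back to time 0: the dependence on \<open>s\<close> then
    sits in a single factor outside the integral, which gives continuity of \<open>V\<close> and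
    makes Fubini applicable.\<close>
  define k where "k u = \<Phi> 0 u *v g u" for u
  have k: "integrable (lebesgue_on {a..b}) k"
    unfolding k_def
    by (intro integrable_continuous_matrix_vector continuous_on_subset[OF continuous_on_fundamental_right[OF 0] sub] g)
  have ki: "integrable (lebesgue_on {a..s}) k" if "s \<in> {a..b}" for s
    by (rule integrable_lebesgue_on_subinterval[OF k]) (use that in auto)
  define V where "V s = \<Phi> s 0 *v (\<integral>u. k u \<partial>lebesgue_on {a..s})" for s
  have Vc: "continuous_on {a..b} V"
    unfolding V_def
    by (intro continuous_on_matrix_vector_mult indefinite_integral_continuous_real k
        continuous_on_subset[OF continuous_on_fundamental_left[OF 0] sub])
  have Veq: "V s = (\<integral>u. A u *v V u + g u \<partial>lebesgue_on {a..s})" if s: "s \<in> {a..b}" for s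
  proof -
    have Ki: "integrable (lebesgue_on {a..s}) (\<lambda>w. A w ** \<Phi> w 0)"
      by (rule integrable_lebesgue_on_subinterval[OF integrable_deriv[OF 0]]) (use s ab in auto)
    have Pk: "integrable (lebesgue_on {a..s}) (\<lambda>u. \<Phi> s 0 *v k u)"
      by (rule integrable_bounded_linear[OF bounded_linear_matrix_vector_right ki[OF s]])
    have "(\<integral>w. A w *v V w \<partial>lebesgue_on {a..s})
        = (\<integral>w. (A w ** \<Phi> w 0) *v (\<integral>u. k u \<partial>lebesgue_on {a..w}) \<partial>lebesgue_on {a..s})"
      by (simp add: V_def matrix_vector_mul_assoc)
    also have "\<dots> = (\<integral>u. (\<integral>w. A w ** \<Phi> w 0 \<partial>lebesgue_on {u..s}) *v k u \<partial>lebesgue_on {a..s})"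
      by (rule matrix_vector_iterated_integral[OF Ki ki[OF s]])
    \<comment> \<open>The inner integral is the increment of \<open>\<Phi> w 0\<close> over [u,s];
      at its lower end \<open>\<Phi> u 0 ** \<Phi> 0 u = mat 1\<close> turns the pulled-back forcing
      into \<open>g u\<close> again.\<close>
    also have "\<dots> = (\<integral>u. \<Phi> s 0 *v k u - g u \<partial>lebesgue_on {a..s})"
    proof (intro Bochner_Integration.integral_cong refl)
      fix u assume "u \<in> space (lebesgue_on {a..s})"
      then have u: "u \<in> {0..R}" "0 \<le> u" "u \<le> s" "s \<le> R" using s ab by auto
      have "(\<integral>w. A w ** \<Phi> w 0 \<partial>lebesgue_on {u..s}) = \<Phi> s 0 - \<Phi> u 0"
        by (rule fundamental_increment[OF 0 u(2-4), symmetric])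
      then have "(\<integral>w. A w ** \<Phi> w 0 \<partial>lebesgue_on {u..s}) *v k u = (\<Phi> s 0 - \<Phi> u 0) *v k u"
        by (rule arg_cong)
      also have "\<dots> = \<Phi> s 0 *v k u - (\<Phi> u 0 ** \<Phi> 0 u) *v g u"
        by (simp add: matrix_vector_mult_diff_rdistrib k_def flip: matrix_vector_mul_assoc)
      finally have "(\<integral>w. A w ** \<Phi> w 0 \<partial>lebesgue_on {u..s}) *v k u
          = \<Phi> s 0 *v k u - (\<Phi> u 0 ** \<Phi> 0 u) *v g u" .
      then show "(\<integral>w. A w ** \<Phi> w 0 \<partial>lebesgue_on {u..s}) *v k u = \<Phi> s 0 *v k u - g u"
        using fundamental_inverse[OF u(1)] by simp
    qed
    also have "\<dots> = (\<integral>u. \<Phi> s 0 *v k u \<partial>lebesgue_on {a..s}) - (\<integral>u. g u \<partial>lebesgue_on {a..s})"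
      using Pk gi[OF s] by simp
    also have "(\<integral>u. \<Phi> s 0 *v k u \<partial>lebesgue_on {a..s}) = V s"
      unfolding V_def by (rule integral_bounded_linear[OF bounded_linear_matrix_vector_right ki[OF s]])
    finally show ?thesis using Ai[OF Vc s] gi[OF s] by simp
  qed
  have "y s - V s = 0"
  proof (rule linear_integral_equation_zero[where y="\<lambda>s. y s - V s", OF _ _ C s])
    show "continuous_on {a..b} (\<lambda>s. y s - V s)" by (intro continuous_intros y Vc)
    fix s assume s: "s \<in> {a..b}"
    show "y s - V s = (\<integral>u. A u *v (y u - V u) \<partial>lebesgue_on {a..s})"
      using eq[OF s] Veq[OF s] Ai[OF Vc s] Ai[OF y s] gi[OF s]
      by (simp add: matrix_vector_mult_diff_distrib)
  qed
  moreover have "V s = (\<integral>u. \<Phi> s u *v g u \<partial>lebesgue_on {a..s})"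
  proof -
    have "V s = (\<integral>u. \<Phi> s 0 *v k u \<partial>lebesgue_on {a..s})"
      unfolding V_def by (rule integral_bounded_linear[OF bounded_linear_matrix_vector_right ki[OF s], symmetric])
    also have "\<dots> = (\<integral>u. \<Phi> s u *v g u \<partial>lebesgue_on {a..s})"
    proof (intro Bochner_Integration.integral_cong refl)
      fix u assume "u \<in> space (lebesgue_on {a..s})"
      then have "u \<in> {0..R}" "s \<in> {0..R}" using s ab by auto
      then show "\<Phi> s 0 *v k u = \<Phi> s u *v g u"
        by (simp add: k_def matrix_vector_mul_assoc fundamental_from_0)
    qed
    finally show ?thesis .
  qed
  ultimately show ?thesis by simp
qed

text \<open>Both sides solve z' = A z + A x with z(v) = 0.\<close>

lemma integral_fundamental_A:
  assumes "0 \<le> v" "v \<le> b" "b \<le> R"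
  shows "(\<integral>u. \<Phi> b u *v (A u *v x) \<partial>lebesgue_on {v..b}) = \<Phi> b v *v x - x"
    and "integrable (lebesgue_on {v..b}) (\<lambda>u. \<Phi> b u *v (A u *v x))"
proof -
  have v: "v \<in> {0..R}" and b: "b \<in> {0..R}" and vb: "b \<in> {v..b}" and sub: "{v..b} \<subseteq> {0..R}"
    using assms by auto
  obtain C where "AE u in lebesgue_on {0..R}. \<forall>x. norm (A u *v x) \<le> C * norm x"
    using Linfty_on_matrix_bound[OF Linfty] by blast
  then have C: "AE u in lebesgue_on {v..b}. \<forall>x. norm (A u *v x) \<le> C * norm x"
    by (rule AE_lebesgue_on_subinterval) (use assms in auto)
  have Am: "A \<in> borel_measurable (lebesgue_on {v..b})"
    by (rule measurable_lebesgue_on_subinterval[of A 0 R]) (use Linfty assms in \<open>auto simp: Linfty_on_def\<close>)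
  have Ax: "integrable (lebesgue_on {v..b}) (\<lambda>u. A u *v x)"
    by (rule integrable_bounded_matrix_vector[OF Am C]) (simp add: finite_measure.emeasure_finite[OF finite_measure_lebesgue_on_Icc])
  show "integrable (lebesgue_on {v..b}) (\<lambda>u. \<Phi> b u *v (A u *v x))"
    by (intro integrable_continuous_matrix_vector continuous_on_subset[OF continuous_on_fundamental_right[OF b] sub] Ax)
  have "\<Phi> b v *v x - x = (\<integral>u. \<Phi> b u *v (A u *v x) \<partial>lebesgue_on {v..b})"
  proof (rule variation_of_constants[where y="\<lambda>s. \<Phi> s v *v x - x", OF assms _ Ax _ vb])
    show "continuous_on {v..b} (\<lambda>s. \<Phi> s v *v x - x)"
      by (intro continuous_on_diff continuous_on_const continuous_on_matrix_vector_mult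
          continuous_on_subset[OF continuous_on_fundamental_left[OF v] sub])
    fix s assume s: "s \<in> {v..b}"
    have i: "integrable (lebesgue_on {v..s}) (\<lambda>u. A u ** \<Phi> u v)"
      by (rule integrable_lebesgue_on_subinterval[OF integrable_deriv[OF v]]) (use s assms in auto)
    have "\<Phi> s v - mat 1 = (\<integral>w. A w ** \<Phi> w v \<partial>lebesgue_on {v..s})"
      using fundamental_increment[OF v, of v s] fundamental_self[OF v] s assms by simp
    then have "(\<Phi> s v - mat 1) *v x = (\<integral>w. A w ** \<Phi> w v \<partial>lebesgue_on {v..s}) *v x"
      by (rule arg_cong)
    then have "\<Phi> s v *v x - x = (\<integral>w. A w ** \<Phi> w v \<partial>lebesgue_on {v..s}) *v x"
      by (simp only: matrix_vector_mult_diff_rdistrib matrix_vector_mul_lid)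
    also have "\<dots> = (\<integral>u. (A u ** \<Phi> u v) *v x \<partial>lebesgue_on {v..s})"
      by (rule integral_bounded_linear[OF bounded_linear_matrix_vector_left i, symmetric])
    finally show "\<Phi> s v *v x - x = (\<integral>u. A u *v (\<Phi> u v *v x - x) + A u *v x \<partial>lebesgue_on {v..s})"
      by (simp add: matrix_vector_mult_diff_distrib matrix_vector_mul_assoc)
  qed
  then show "(\<integral>u. \<Phi> b u *v (A u *v x) \<partial>lebesgue_on {v..b}) = \<Phi> b v *v x - x" by simp
qed

end

section \<open>Wiener integrals of deterministic functions\<close>

lemma square_integrable_indicator:
  assumes "S \<in> sets M" "emeasure M S < \<infinity>"
  shows "square_integrable M (indicator S)"
proof (rule square_integrableI)
  show "integrable M (\<lambda>x. (indicator S x :: real)\<^sup>2)"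
    using integrable_real_indicator[OF assms] by (simp add: power2_eq_square indicator_inter_arith[symmetric])
qed (use assms in simp)

lemma square_integrable_indicator_Ioc: "square_integrable lebesgue (indicator {a<..b::real})"
proof (rule square_integrable_indicator)
  show "{a<..b} \<in> sets lebesgue" by (rule sets_completionI_sets) simp
  have "{a<..b} \<in> lmeasurable" by (rule bounded_set_imp_lmeasurable) (auto intro: sets_completionI_sets)
  then show "emeasure lebesgue {a<..b} < \<infinity>" by (simp add: fmeasurable_def)
qed

section \<open>Moments of Wiener increments\<close>

locale wiener = prob_space M for M :: "'a measure" +
  fixes F :: "real \<Rightarrow> 'a measure" and W :: "real \<Rightarrow> 'a \<Rightarrow> real"
  assumes filtration: "filtered_prob_space M F" and wiener: "wiener_process M F W"
begin

lemma subalgebra_F: "0 \<le> t \<Longrightarrow> subalgebra M (F t)"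
  using filtration by (simp add: filtered_prob_space_def)

lemma measurable_F_M: "0 \<le> t \<Longrightarrow> f \<in> borel_measurable (F t) \<Longrightarrow> f \<in> borel_measurable M"
  by (rule measurable_from_subalg[OF subalgebra_F])

lemma measurable_F_mono:
  assumes "0 \<le> s" "s \<le> t" "f \<in> borel_measurable (F s)"
  shows "f \<in> borel_measurable (F t)"
proof -
  have "subalgebra (F t) (F s)"
    using assms(1,2) subalgebra_F[of s] subalgebra_F[of t] filtration
    by (auto simp: subalgebra_def filtered_prob_space_def)
  then show ?thesis by (rule measurable_from_subalg) fact
qed

lemma wiener_measurable[measurable]: "0 \<le> t \<Longrightarrow> W t \<in> borel_measurable M"
  using wiener by (auto simp: wiener_process_def intro: measurable_F_M)

lemma increment_distributed:
  assumes "0 \<le> s" "s < t"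
  shows "distributed M lborel (\<lambda>\<omega>. W t \<omega> - W s \<omega>) (normal_density 0 (sqrt (t - s)))"
  using wiener assms by (simp add: wiener_process_def)

text \<open>Grid points of a step function may coincide, so s = t is included; the normal law is
  available only for s < t.\<close>

lemma increment_moments:
  assumes "0 \<le> s" "s \<le> t"
  shows "expectation (\<lambda>\<omega>. W t \<omega> - W s \<omega>) = 0"
    and "square_integrable M (\<lambda>\<omega>. W t \<omega> - W s \<omega>)"
    and "expectation (\<lambda>\<omega>. (W t \<omega> - W s \<omega>)\<^sup>2) = t - s"
proof -
  have "expectation (\<lambda>\<omega>. W t \<omega> - W s \<omega>) = 0 \<and> square_integrable M (\<lambda>\<omega>. W t \<omega> - W s \<omega>)
      \<and> expectation (\<lambda>\<omega>. (W t \<omega> - W s \<omega>)\<^sup>2) = t - s"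
  proof (cases "s = t")
    case True
    then show ?thesis by (simp add: square_integrable_zero)
  next
    case False
    then have st: "s < t" and sd: "0 < sqrt (t - s)" using assms by auto
    note D = increment_distributed[OF assms(1) st]
    have e: "expectation (\<lambda>\<omega>. W t \<omega> - W s \<omega>) = 0"
      by (rule normal_distributed_expectation[OF sd D])
    have "integrable M (\<lambda>\<omega>. (W t \<omega> - W s \<omega>)\<^sup>2)"
      using integrable_normal_moment[OF sd, of 0 2] distributed_integrable[OF D, of "\<lambda>x. x\<^sup>2"] by simp
    then have "square_integrable M (\<lambda>\<omega>. W t \<omega> - W s \<omega>)"
      using assms by (intro square_integrableI) measurable
    moreover have "expectation (\<lambda>\<omega>. (W t \<omega> - W s \<omega>)\<^sup>2) = t - s"
      using normal_distributed_variance[OF sd D] st by (simp add: e)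
    ultimately show ?thesis using e by simp
  qed
  then show "expectation (\<lambda>\<omega>. W t \<omega> - W s \<omega>) = 0"
    and "square_integrable M (\<lambda>\<omega>. W t \<omega> - W s \<omega>)"
    and "expectation (\<lambda>\<omega>. (W t \<omega> - W s \<omega>)\<^sup>2) = t - s" by auto
qed

text \<open>Independence factors the expectation, and the increment has mean 0.\<close>

lemma increment_orthogonal:
  assumes st: "0 \<le> s" "s \<le> t" and \<xi>: "\<xi> \<in> borel_measurable (F s)" "square_integrable M \<xi>"
  shows "expectation (\<lambda>\<omega>. (W t \<omega> - W s \<omega>) * \<xi> \<omega>) = 0"
proof (cases "s = t")
  case False
  then have lt: "s < t" using st by simp
  let ?D = "\<lambda>\<omega>. W t \<omega> - W s \<omega>"
  have ind: "indep_set (sets (vimage_algebra (space M) ?D borel)) (sets (F s))"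
    using wiener st lt by (simp add: wiener_process_def)
  have sp: "space (F s) = space M" using subalgebra_F[OF st(1)] by (simp add: subalgebra_def)
  \<comment> \<open>The sigma-algebra generated by \<xi> lies in \<open>F s\<close>, so independence
    from \<open>F s\<close> restricts to independence from \<xi>.\<close>
  have sub: "sigma_sets (space M) {\<xi> -` A \<inter> space M |A. A \<in> sets borel} \<subseteq> sets (F s)"
    using measurable_sets[OF \<xi>(1)] sp by (auto intro!: sets.sigma_sets_subset[of _ "F s", unfolded sp])
  have "indep_set (sigma_sets (space M) {?D -` A \<inter> space M |A. A \<in> sets borel})
      (sigma_sets (space M) {\<xi> -` A \<inter> space M |A. A \<in> sets borel})"
  proof (rule indep_setI)
    show "sigma_sets (space M) {?D -` A \<inter> space M |A. A \<in> sets borel} \<subseteq> events"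
      using indep_setD_ev1[OF ind] by (simp add: sets_vimage_algebra)
    show "sigma_sets (space M) {\<xi> -` A \<inter> space M |A. A \<in> sets borel} \<subseteq> events"
      using sub indep_setD_ev2[OF ind] by blast
    fix a b assume "a \<in> sigma_sets (space M) {?D -` A \<inter> space M |A. A \<in> sets borel}"
      "b \<in> sigma_sets (space M) {\<xi> -` A \<inter> space M |A. A \<in> sets borel}"
    then show "prob (a \<inter> b) = prob a * prob b"
      using sub by (intro indep_setD[OF ind]) (auto simp: sets_vimage_algebra)
  qed
  moreover have "?D \<in> borel_measurable M"
    using increment_moments(2)[OF st] by (rule square_integrable_measurable)
  moreover have "\<xi> \<in> borel_measurable M" using \<xi>(2) by (rule square_integrable_measurable)
  ultimately have "indep_var borel ?D borel \<xi>"
    by (simp add: indep_var_eq)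
  from indep_var_lebesgue_integral[OF this] show ?thesis
    using increment_moments[OF st] square_integrable_integrable[OF increment_moments(2)[OF st]]
      square_integrable_integrable[OF \<xi>(2)] by simp
qed simp

text \<open>For s \<le> t the increment W_t - W_s is orthogonal to W_s, which leaves E[W_s^2]; this
  is s because W_0 = 0 almost surely.\<close>

lemma wiener_square_integrable: "0 \<le> t \<Longrightarrow> square_integrable M (W t)"
  and wiener_covariance: "0 \<le> s \<Longrightarrow> 0 \<le> t \<Longrightarrow> expectation (\<lambda>\<omega>. W s \<omega> * W t \<omega>) = min s t"
proof -
  have W0: "AE \<omega> in M. W 0 \<omega> = 0" using wiener by (simp add: wiener_process_def)
  show sq: "square_integrable M (W t)" if "0 \<le> t" for t
    by (rule square_integrable_cong_AE[OF increment_moments(2)[OF order_refl that]]) (use W0 that in auto)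
  have sec: "expectation (\<lambda>\<omega>. (W s \<omega>)\<^sup>2) = s" if "0 \<le> s" for s
  proof -
    have "expectation (\<lambda>\<omega>. (W s \<omega>)\<^sup>2) = expectation (\<lambda>\<omega>. (W s \<omega> - W 0 \<omega>)\<^sup>2)"
      by (rule integral_cong_AE) (use W0 that in auto)
    then show ?thesis using increment_moments(3)[of 0 s] that by simp
  qed
  have *: "expectation (\<lambda>\<omega>. W s \<omega> * W t \<omega>) = s" if st: "0 \<le> s" "s \<le> t" for s t
  proof -
    have Ws: "W s \<in> borel_measurable (F s)" using wiener st by (simp add: wiener_process_def)
    have "expectation (\<lambda>\<omega>. W s \<omega> * W t \<omega>) = expectation (\<lambda>\<omega>. (W t \<omega> - W s \<omega>) * W s \<omega> + (W s \<omega>)\<^sup>2)"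
      by (intro Bochner_Integration.integral_cong refl) (simp add: power2_eq_square algebra_simps)
    also have "\<dots> = expectation (\<lambda>\<omega>. (W t \<omega> - W s \<omega>) * W s \<omega>) + expectation (\<lambda>\<omega>. (W s \<omega>)\<^sup>2)"
      by (rule Bochner_Integration.integral_add)
         (use st sq in \<open>auto intro: square_integrable_mult increment_moments square_integrable_square\<close>)
    finally show ?thesis using increment_orthogonal[OF st Ws sq[OF st(1)]] sec[OF st(1)] by simp
  qed
  show "expectation (\<lambda>\<omega>. W s \<omega> * W t \<omega>) = min s t" if "0 \<le> s" "0 \<le> t" for s t
    using *[of s t] *[of t s] that by (cases "s \<le> t") (auto simp: mult.commute)
qed

text \<open>Both sides are the length \<open>max 0 (min b d - max a c)\<close> of the overlap.
  Allowing arbitrary overlaps spares a common refinement of two grids.\<close>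

lemma increment_covariance:
  assumes "0 \<le> a" "a \<le> b" "0 \<le> c" "c \<le> d"
  shows "expectation (\<lambda>\<omega>. (W b \<omega> - W a \<omega>) * (W d \<omega> - W c \<omega>))
       = (\<integral>x. indicator {a<..b} x * indicator {c<..d} x \<partial>lebesgue)"
proof -
  have i: "integrable M (\<lambda>\<omega>. W s \<omega> * W t \<omega>)" if "0 \<le> s" "0 \<le> t" for s t
    by (rule square_integrable_mult) (use that wiener_square_integrable in auto)
  have "expectation (\<lambda>\<omega>. (W b \<omega> - W a \<omega>) * (W d \<omega> - W c \<omega>))
      = expectation (\<lambda>\<omega>. W b \<omega> * W d \<omega> - W b \<omega> * W c \<omega> - W a \<omega> * W d \<omega> + W a \<omega> * W c \<omega>)"
    by (intro Bochner_Integration.integral_cong refl) (simp add: algebra_simps)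
  also have "\<dots> = min b d - min b c - min a d + min a c"
    using i assms by (simp add: wiener_covariance)
  also have "\<dots> = max 0 (min b d - max a c)"
    using assms by (auto simp: min_def max_def)
  also have "\<dots> = (\<integral>x. indicator {max a c<..min b d} x \<partial>lebesgue)"
    by (auto simp: max_def min_def)
  also have "\<dots> = (\<integral>x. indicator {a<..b} x * indicator {c<..d} x \<partial>lebesgue)"
    by (intro Bochner_Integration.integral_cong refl) (auto simp: indicator_def)
  finally show ?thesis .
qed

text \<open>Repeated points are allowed, so that a grid stopped at a fixed nonnegative time is again
  a grid.\<close>

definition step_grid :: "nat \<Rightarrow> (nat \<Rightarrow> real) \<Rightarrow> bool" where
  "step_grid N p \<longleftrightarrow> (\<forall>i<N. p i \<le> p (Suc i)) \<and> (\<forall>i\<le>N. 0 \<le> p i)"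

lemma step_square_integrable:
  assumes "step_grid N p"
  shows "square_integrable lebesgue (step_fun N p c :: real \<Rightarrow> real)"
    and "square_integrable M (step_wiener_integral W N p c :: 'a \<Rightarrow> real)"
proof -
  have "square_integrable lebesgue (\<lambda>x. c i * indicator {p i<..p (Suc i)} x)" for i
    by (intro square_integrable_cmult square_integrable_indicator_Ioc)
  then show "square_integrable lebesgue (step_fun N p c :: real \<Rightarrow> real)"
    unfolding step_fun_def real_scaleR_def mult.commute[of "indicator _ _"] by (rule square_integrable_sum)
  have "square_integrable M (\<lambda>\<omega>. c i * (W (p (Suc i)) \<omega> - W (p i) \<omega>))" if "i < N" for i
    using assms that by (intro square_integrable_cmult increment_moments) (auto simp: step_grid_def)
  then show "square_integrable M (step_wiener_integral W N p c :: 'a \<Rightarrow> real)"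
    unfolding step_wiener_integral_def real_scaleR_def mult.commute[of "W _ _ - W _ _"]
    by (rule square_integrable_sum) simp
qed

text \<open>Bilinear expansion over pairs of cells, one from each grid, reduces this to
  \<open>increment_covariance\<close>.\<close>

lemma step_isometry:
  fixes c d :: "nat \<Rightarrow> real"
  assumes p: "step_grid N p" and q: "step_grid L q"
  shows "expectation (\<lambda>\<omega>. step_wiener_integral W N p c \<omega> * step_wiener_integral W L q d \<omega>)
       = (\<integral>x. step_fun N p c x * step_fun L q d x \<partial>lebesgue)"
proof -
  let ?D = "\<lambda>p i \<omega>. W (p (Suc i)) \<omega> - W (p i) \<omega>"
  have P: "0 \<le> p i" "p i \<le> p (Suc i)" if "i < N" for i using p that by (auto simp: step_grid_def)
  have Q: "0 \<le> q i" "q i \<le> q (Suc i)" if "i < L" for i using q that by (auto simp: step_grid_def)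
  have i1: "integrable M (\<lambda>\<omega>. ?D p i \<omega> * ?D q j \<omega>)" if "i < N" "j < L" for i j
    by (intro square_integrable_mult increment_moments P Q that)
  have i2: "integrable lebesgue (\<lambda>x. indicator {p i<..p (Suc i)} x * indicator {q j<..q (Suc j)} x :: real)" for i j
    by (rule square_integrable_mult[OF square_integrable_indicator_Ioc square_integrable_indicator_Ioc])
  have "expectation (\<lambda>\<omega>. step_wiener_integral W N p c \<omega> * step_wiener_integral W L q d \<omega>)
      = expectation (\<lambda>\<omega>. \<Sum>i<N. \<Sum>j<L. (c i * d j) * (?D p i \<omega> * ?D q j \<omega>))"
    by (simp add: step_wiener_integral_def sum_product ac_simps)
  also have "\<dots> = (\<Sum>i<N. \<Sum>j<L. (c i * d j) * expectation (\<lambda>\<omega>. ?D p i \<omega> * ?D q j \<omega>))"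
  proof -
    have i: "integrable M (\<lambda>\<omega>. (c i * d j) * (?D p i \<omega> * ?D q j \<omega>))" if "i < N" "j < L" for i j
      by (rule integrable_mult_right[OF i1[OF that]])
    have "expectation (\<lambda>\<omega>. \<Sum>i<N. \<Sum>j<L. (c i * d j) * (?D p i \<omega> * ?D q j \<omega>))
        = (\<Sum>i<N. expectation (\<lambda>\<omega>. \<Sum>j<L. (c i * d j) * (?D p i \<omega> * ?D q j \<omega>)))"
      by (rule Bochner_Integration.integral_sum) (intro Bochner_Integration.integrable_sum i, auto)
    also have "\<dots> = (\<Sum>i<N. \<Sum>j<L. expectation (\<lambda>\<omega>. (c i * d j) * (?D p i \<omega> * ?D q j \<omega>)))"
      by (intro sum.cong refl Bochner_Integration.integral_sum i) auto
    finally have "expectation (\<lambda>\<omega>. \<Sum>i<N. \<Sum>j<L. (c i * d j) * (?D p i \<omega> * ?D q j \<omega>))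
        = (\<Sum>i<N. \<Sum>j<L. expectation (\<lambda>\<omega>. (c i * d j) * (?D p i \<omega> * ?D q j \<omega>)))" .
    then show ?thesis by simp
  qed
  also have "\<dots> = (\<Sum>i<N. \<Sum>j<L. (c i * d j) *
      (\<integral>x. indicator {p i<..p (Suc i)} x * indicator {q j<..q (Suc j)} x \<partial>lebesgue))"
    using P Q by (simp add: increment_covariance)
  also have "\<dots> = (\<integral>x. (\<Sum>i<N. \<Sum>j<L. (c i * d j) *
      (indicator {p i<..p (Suc i)} x * indicator {q j<..q (Suc j)} x)) \<partial>lebesgue)"
    using i2 by (simp add: Bochner_Integration.integral_sum)
  also have "\<dots> = (\<integral>x. step_fun N p c x * step_fun L q d x \<partial>lebesgue)"
    by (simp only: step_fun_def sum_product real_scaleR_def mult.assoc mult.commute mult.left_commute)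
  finally show ?thesis .
qed

text \<open>A scalar form of the Wiener integral whose integrand lives on the whole line: integrals
  up to different times, once extended by 0, can be compared in one L2 space.\<close>

definition wiener_limit :: "(real \<Rightarrow> real) \<Rightarrow> ('a \<Rightarrow> real) \<Rightarrow> bool" where
  "wiener_limit f I \<longleftrightarrow> square_integrable lebesgue f \<and> square_integrable M I \<and>
     (\<exists>N p c. (\<forall>k. step_grid (N k) (p k)) \<and>
        (\<lambda>k. \<integral>x. (step_fun (N k) (p k) (c k) x - f x)\<^sup>2 \<partial>lebesgue) \<longlonglongrightarrow> 0 \<and>
        (\<lambda>k. \<integral>\<omega>. (step_wiener_integral W (N k) (p k) (c k) \<omega> - I \<omega>)\<^sup>2 \<partial>M) \<longlonglongrightarrow> 0)"

lemma wiener_limit_step: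
  assumes "step_grid N p"
  shows "wiener_limit (step_fun N p c) (step_wiener_integral W N p c)"
  unfolding wiener_limit_def using step_square_integrable[OF assms] assms
  by (intro conjI exI[of _ "\<lambda>k. N"] exI[of _ "\<lambda>k. p"] exI[of _ "\<lambda>k. c"]) auto

text \<open>Along the two approximating sequences the inner products agree at every index, and inner
  products are continuous in L2.\<close>

lemma wiener_limit_isometry:
  assumes f: "wiener_limit f I" and g: "wiener_limit g J"
  shows "expectation (\<lambda>\<omega>. I \<omega> * J \<omega>) = (\<integral>x. f x * g x \<partial>lebesgue)"
proof -
  obtain N p c where P: "\<And>k. step_grid (N k) (p k)"
    "(\<lambda>k. \<integral>x. (step_fun (N k) (p k) (c k) x - f x)\<^sup>2 \<partial>lebesgue) \<longlonglongrightarrow> 0"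
    "(\<lambda>k. \<integral>\<omega>. (step_wiener_integral W (N k) (p k) (c k) \<omega> - I \<omega>)\<^sup>2 \<partial>M) \<longlonglongrightarrow> 0"
    using f by (auto simp: wiener_limit_def)
  obtain L q d where Q: "\<And>k. step_grid (L k) (q k)"
    "(\<lambda>k. \<integral>x. (step_fun (L k) (q k) (d k) x - g x)\<^sup>2 \<partial>lebesgue) \<longlonglongrightarrow> 0"
    "(\<lambda>k. \<integral>\<omega>. (step_wiener_integral W (L k) (q k) (d k) \<omega> - J \<omega>)\<^sup>2 \<partial>M) \<longlonglongrightarrow> 0"
    using g by (auto simp: wiener_limit_def)
  have sq: "square_integrable lebesgue f" "square_integrable lebesgue g"
    "square_integrable M I" "square_integrable M J"
    using f g by (auto simp: wiener_limit_def)
  have 1: "(\<lambda>k. \<integral>x. step_fun (N k) (p k) (c k) x * step_fun (L k) (q k) (d k) x \<partial>lebesgue)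
      \<longlonglongrightarrow> (\<integral>x. f x * g x \<partial>lebesgue)"
    by (rule L2_inner_tendsto[OF step_square_integrable(1)[OF P(1)] sq(1) step_square_integrable(1)[OF Q(1)] sq(2) P(2) Q(2)])
  have 2: "(\<lambda>k. \<integral>\<omega>. step_wiener_integral W (N k) (p k) (c k) \<omega> * step_wiener_integral W (L k) (q k) (d k) \<omega> \<partial>M)
      \<longlonglongrightarrow> (\<integral>\<omega>. I \<omega> * J \<omega> \<partial>M)"
    by (rule L2_inner_tendsto[OF step_square_integrable(2)[OF P(1)] sq(3) step_square_integrable(2)[OF Q(1)] sq(4) P(3) Q(3)])
  show ?thesis
    using LIMSEQ_unique[OF 2[unfolded step_isometry[OF P(1) Q(1)]] 1] .
qed

lemma wiener_limit_distance:
  assumes f: "wiener_limit f I" and g: "wiener_limit g J"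
  shows "expectation (\<lambda>\<omega>. (I \<omega> - J \<omega>)\<^sup>2) = (\<integral>x. (f x - g x)\<^sup>2 \<partial>lebesgue)"
proof -
  have sq: "square_integrable lebesgue f" "square_integrable lebesgue g"
    "square_integrable M I" "square_integrable M J"
    using f g by (auto simp: wiener_limit_def)
  have gen: "(\<integral>x. (u x - v x)\<^sup>2 \<partial>N) = (\<integral>x. u x * u x \<partial>N) - 2 * (\<integral>x. u x * v x \<partial>N) + (\<integral>x. v x * v x \<partial>N)"
    if "square_integrable N u" "square_integrable N v" for u v :: "'z \<Rightarrow> real" and N
  proof -
    have "(\<integral>x. (u x - v x)\<^sup>2 \<partial>N) = (\<integral>x. u x * u x - 2 * (u x * v x) + v x * v x \<partial>N)"
      by (intro Bochner_Integration.integral_cong refl) (simp add: power2_eq_square algebra_simps)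
    then show ?thesis
      using square_integrable_mult[OF that(1) that(1)] square_integrable_mult[OF that]
        square_integrable_mult[OF that(2) that(2)] by simp
  qed
  show ?thesis
    unfolding gen[OF sq(1,2)] gen[OF sq(3,4)]
    by (simp add: wiener_limit_isometry[OF f g] wiener_limit_isometry[OF f f] wiener_limit_isometry[OF g g])
qed

text \<open>Beyond \<open>a\<close> the process adds only increments orthogonal to \<xi>, so each
  W_u may be replaced by its value at \<open>min u a\<close>; this also covers intervals that
  contain \<open>a\<close> in their interior.\<close>

lemma expectation_increment_stopped:
  assumes a: "0 \<le> a" and st: "0 \<le> s" "s \<le> t"
    and \<xi>: "\<xi> \<in> borel_measurable (F a)" "square_integrable M \<xi>"
  shows "expectation (\<lambda>\<omega>. (W t \<omega> - W s \<omega>) * \<xi> \<omega>)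
       = expectation (\<lambda>\<omega>. (W (min t a) \<omega> - W (min s a) \<omega>) * \<xi> \<omega>)"
proof -
  have i: "integrable M (\<lambda>\<omega>. W u \<omega> * \<xi> \<omega>)" if "0 \<le> u" for u
    by (rule square_integrable_mult[OF wiener_square_integrable[OF that] \<xi>(2)])
  have w: "expectation (\<lambda>\<omega>. W u \<omega> * \<xi> \<omega>) = expectation (\<lambda>\<omega>. W (min u a) \<omega> * \<xi> \<omega>)" if "0 \<le> u" for u
  proof (cases "u \<le> a")
    case False
    then have "expectation (\<lambda>\<omega>. (W u \<omega> - W a \<omega>) * \<xi> \<omega>) = 0"
      using increment_orthogonal[OF a _ \<xi>] by simp
    then show ?thesis using i[OF that] i[OF a] False by (simp add: left_diff_distrib)
  qed (simp add: min_absorb1)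
  show ?thesis
    using i[of s] i[of t] i[of "min s a"] i[of "min t a"] w[of s] w[of t] a st
    by (simp add: left_diff_distrib)
qed

text \<open>The martingale property of the Wiener integral, tested against \<xi> instead of being
  stated with conditional expectations. It holds for step functions by stopping their grids at
  \<open>a\<close> and passes to the L2 limit.\<close>

lemma wiener_limit_stopped:
  assumes a: "0 \<le> a" and f: "wiener_limit f I"
    and fa: "wiener_limit (\<lambda>x. indicator {..a} x * f x) J"
    and \<xi>: "\<xi> \<in> borel_measurable (F a)" "square_integrable M \<xi>"
  shows "expectation (\<lambda>\<omega>. I \<omega> * \<xi> \<omega>) = expectation (\<lambda>\<omega>. J \<omega> * \<xi> \<omega>)"
proof -
  obtain N p c where P: "\<And>k. step_grid (N k) (p k)"
    "(\<lambda>k. \<integral>x. (step_fun (N k) (p k) (c k) x - f x)\<^sup>2 \<partial>lebesgue) \<longlonglongrightarrow> 0"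
    "(\<lambda>k. \<integral>\<omega>. (step_wiener_integral W (N k) (p k) (c k) \<omega> - I \<omega>)\<^sup>2 \<partial>M) \<longlonglongrightarrow> 0"
    using f by (auto simp: wiener_limit_def)
  have sq: "square_integrable lebesgue f" "square_integrable lebesgue (\<lambda>x. indicator {..a} x * f x)"
    "square_integrable M I" "square_integrable M J"
    using f fa by (auto simp: wiener_limit_def)
  \<comment> \<open>Stopping collapses the cells beyond \<open>a\<close> to empty ones, so the step
    function is multiplied by the indicator of {..a}.\<close>
  define q where "q k i = min (p k i) a" for k i
  have q: "step_grid (N k) (q k)" for k
    using P(1)[of k] a by (auto simp: step_grid_def q_def min_def intro: order_trans)
  have stopped: "step_fun (N k) (q k) (c k) x = indicator {..a} x * step_fun (N k) (p k) (c k) x" for k x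
    unfolding step_fun_def sum_distrib_left
    by (intro sum.cong refl) (auto simp: q_def indicator_def)
  have eq: "expectation (\<lambda>\<omega>. step_wiener_integral W (N k) (p k) (c k) \<omega> * \<xi> \<omega>)
      = expectation (\<lambda>\<omega>. step_wiener_integral W (N k) (q k) (c k) \<omega> * \<xi> \<omega>)" for k
  proof -
    have sum: "expectation (\<lambda>\<omega>. step_wiener_integral W (N k) r (c k) \<omega> * \<xi> \<omega>)
        = (\<Sum>i<N k. c k i * expectation (\<lambda>\<omega>. (W (r (Suc i)) \<omega> - W (r i) \<omega>) * \<xi> \<omega>))"
      if r: "step_grid (N k) r" for r
    proof -
      have i: "integrable M (\<lambda>\<omega>. (W (r (Suc i)) \<omega> - W (r i) \<omega>) * \<xi> \<omega>)" if "i < N k" for i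
        by (intro square_integrable_mult increment_moments \<xi>(2)) (use r that in \<open>auto simp: step_grid_def\<close>)
      have "expectation (\<lambda>\<omega>. step_wiener_integral W (N k) r (c k) \<omega> * \<xi> \<omega>)
          = expectation (\<lambda>\<omega>. \<Sum>i<N k. c k i * ((W (r (Suc i)) \<omega> - W (r i) \<omega>) * \<xi> \<omega>))"
        by (simp add: step_wiener_integral_def sum_distrib_left ac_simps)
      then show ?thesis using i by (simp add: Bochner_Integration.integral_sum)
    qed
    show ?thesis
      unfolding sum[OF P(1)] sum[OF q]
    proof (intro sum.cong refl)
      fix i assume "i \<in> {..<N k}"
      then have "0 \<le> p k i" "p k i \<le> p k (Suc i)" using P(1)[of k] by (auto simp: step_grid_def)
      from expectation_increment_stopped[OF a this \<xi>]
      show "c k i * expectation (\<lambda>\<omega>. (W (p k (Suc i)) \<omega> - W (p k i) \<omega>) * \<xi> \<omega>)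
          = c k i * expectation (\<lambda>\<omega>. (W (q k (Suc i)) \<omega> - W (q k i) \<omega>) * \<xi> \<omega>)"
        by (simp add: q_def)
    qed
  qed
  \<comment> \<open>The isometry turns the distance to \<open>J\<close> into a distance of
    integrands, and cutting off at \<open>a\<close> can only decrease the latter.\<close>
  have dist: "(\<integral>\<omega>. (step_wiener_integral W (N k) (q k) (c k) \<omega> - J \<omega>)\<^sup>2 \<partial>M)
      \<le> (\<integral>x. (step_fun (N k) (p k) (c k) x - f x)\<^sup>2 \<partial>lebesgue)" for k
  proof -
    have "(\<integral>\<omega>. (step_wiener_integral W (N k) (q k) (c k) \<omega> - J \<omega>)\<^sup>2 \<partial>M)
        = (\<integral>x. (step_fun (N k) (q k) (c k) x - indicator {..a} x * f x)\<^sup>2 \<partial>lebesgue)"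
      by (rule wiener_limit_distance[OF wiener_limit_step[OF q] fa])
    also have "\<dots> \<le> (\<integral>x. (step_fun (N k) (p k) (c k) x - f x)\<^sup>2 \<partial>lebesgue)"
    proof (rule integral_mono')
      show "integrable lebesgue (\<lambda>x. (step_fun (N k) (p k) (c k) x - f x)\<^sup>2)"
        by (intro square_integrable_square square_integrable_diff step_square_integrable P sq)
    qed (auto simp: stopped indicator_def)
    finally show ?thesis .
  qed
  have lim: "(\<lambda>k. \<integral>\<omega>. (step_wiener_integral W (N k) (q k) (c k) \<omega> - J \<omega>)\<^sup>2 \<partial>M) \<longlonglongrightarrow> 0"
    by (rule tendsto_sandwich[OF _ _ tendsto_const P(2)]) (auto intro!: always_eventually dist)
  have 1: "(\<lambda>k. \<integral>\<omega>. step_wiener_integral W (N k) (p k) (c k) \<omega> * \<xi> \<omega> \<partial>M) \<longlonglongrightarrow> (\<integral>\<omega>. I \<omega> * \<xi> \<omega> \<partial>M)"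
    by (rule L2_inner_tendsto[OF step_square_integrable(2)[OF P(1)] sq(3) \<xi>(2) \<xi>(2) P(3)]) simp
  have 2: "(\<lambda>k. \<integral>\<omega>. step_wiener_integral W (N k) (q k) (c k) \<omega> * \<xi> \<omega> \<partial>M) \<longlonglongrightarrow> (\<integral>\<omega>. J \<omega> * \<xi> \<omega> \<partial>M)"
    by (rule L2_inner_tendsto[OF step_square_integrable(2)[OF q] sq(4) \<xi>(2) \<xi>(2) lim]) simp
  show ?thesis using LIMSEQ_unique[OF 1[unfolded eq] 2] .
qed

end

section \<open>From the vector-valued Wiener integral to scalar L2 limits\<close>

lemma borel_measurable_vec_component[measurable]:
  fixes f :: "'a \<Rightarrow> real^'n"
  assumes "f \<in> borel_measurable M"
  shows "(\<lambda>x. f x $ i) \<in> borel_measurable M"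
proof -
  have "(\<lambda>v :: real^'n. v $ i) \<in> borel_measurable borel"
    by (intro borel_measurable_continuous_onI linear_continuous_on bounded_linear_vec_nth)
  from measurable_compose[OF assms this] show ?thesis .
qed

text \<open>The limit is not known to lie in L2 beforehand. Finite distance to a single
  \<open>f k\<close> puts it there, after which the extended-valued integrals become real
  ones.\<close>

lemma L2_limit:
  assumes f: "\<And>k. square_integrable M (f k)" and F: "F \<in> borel_measurable M"
    and lim: "(\<lambda>k. \<integral>\<^sup>+x. ennreal ((f k x - F x)\<^sup>2) \<partial>M) \<longlonglongrightarrow> 0"
  shows "square_integrable M F" and "(\<lambda>k. \<integral>x. (f k x - F x)\<^sup>2 \<partial>M) \<longlonglongrightarrow> 0"
proof -
  have fm: "f k \<in> borel_measurable M" for k using f by (rule square_integrable_measurable)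
  have "eventually (\<lambda>k. (\<integral>\<^sup>+x. ennreal ((f k x - F x)\<^sup>2) \<partial>M) < 1) sequentially"
    using lim by (rule order_tendstoD) simp
  then obtain k where k: "(\<integral>\<^sup>+x. ennreal ((f k x - F x)\<^sup>2) \<partial>M) < 1"
    by (auto simp: eventually_sequentially)
  have "integrable M (\<lambda>x. (f k x - F x)\<^sup>2)"
  proof (rule integrableI_bounded)
    show "(\<lambda>x. (f k x - F x)\<^sup>2) \<in> borel_measurable M" using fm F by measurable
    show "(\<integral>\<^sup>+x. ennreal (norm ((f k x - F x)\<^sup>2)) \<partial>M) < \<infinity>"
      using k by (simp add: less_trans[of _ 1])
  qed
  moreover have "(\<lambda>x. f k x - F x) \<in> borel_measurable M" using fm F by measurable
  ultimately have "square_integrable M (\<lambda>x. f k x - F x)" by (intro square_integrableI)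
  from square_integrable_diff[OF f[of k] this] show sq: "square_integrable M F" by simp
  have eq: "(\<integral>\<^sup>+x. ennreal ((f k x - F x)\<^sup>2) \<partial>M) = ennreal (\<integral>x. (f k x - F x)\<^sup>2 \<partial>M)" for k
    by (intro nn_integral_eq_integral square_integrable_square square_integrable_diff f sq) simp
  show "(\<lambda>k. \<integral>x. (f k x - F x)\<^sup>2 \<partial>M) \<longlonglongrightarrow> 0"
    using lim unfolding eq ennreal_0[symmetric] by (subst (asm) tendsto_ennreal_iff) auto
qed

lemma integral_diff_mult_diff:
  assumes "square_integrable N u" "square_integrable N u'" "square_integrable N w" "square_integrable N w'"
  shows "(\<integral>x. (u x - u' x) * (w x - w' x) \<partial>N)
       = (\<integral>x. u x * w x \<partial>N) - (\<integral>x. u x * w' x \<partial>N) - (\<integral>x. u' x * w x \<partial>N) + (\<integral>x. u' x * w' x \<partial>N)"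
proof -
  have "(\<integral>x. (u x - u' x) * (w x - w' x) \<partial>N)
      = (\<integral>x. u x * w x - u x * w' x - u' x * w x + u' x * w' x \<partial>N)"
    by (intro Bochner_Integration.integral_cong refl) (simp add: algebra_simps)
  then show ?thesis using assms by (simp add: square_integrable_mult)
qed

context wiener
begin

text \<open>A component is bounded by the norm, so the approximating step functions and step
  integrals can be used component by component.\<close>

lemma has_wiener_integral_component:
  fixes \<sigma> :: "real \<Rightarrow> real^'n"
  assumes I: "has_wiener_integral M W 0 s \<sigma> I"
    and \<sigma>: "\<sigma> \<in> borel_measurable (lebesgue_on {0..T})" and s: "s \<in> {0..T}"
  shows "wiener_limit (\<lambda>x. indicator {0..s} x * \<sigma> x $ j) (\<lambda>\<omega>. I \<omega> $ j)"
proof -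
  obtain N p c where grid: "\<forall>k. \<forall>i<N k. p k i \<le> p k (Suc i)" "\<forall>k. \<forall>i\<le>N k. p k i \<in> {0..s}"
    and lim1: "(\<lambda>k. \<integral>\<^sup>+x\<in>{0..s}. ennreal ((norm (step_fun (N k) (p k) (c k) x - \<sigma> x))\<^sup>2) \<partial>lebesgue) \<longlonglongrightarrow> 0"
    and lim2: "(\<lambda>k. \<integral>\<^sup>+\<omega>. ennreal ((norm (step_wiener_integral W (N k) (p k) (c k) \<omega> - I \<omega>))\<^sup>2) \<partial>M) \<longlonglongrightarrow> 0"
    and Im[measurable]: "I \<in> borel_measurable M"
    using I unfolding has_wiener_integral_def by blast
  define c' where "c' k i = c k i $ j" for k i
  define f where "f x = indicator {0..s} x * \<sigma> x $ j" for x
  have g: "step_grid (N k) (p k)" for k using grid by (auto simp: step_grid_def)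
  have comp1: "step_fun (N k) (p k) (c' k) x = step_fun (N k) (p k) (c k) x $ j" for k x
    by (simp add: step_fun_def c'_def sum_component)
  have comp2: "step_wiener_integral W (N k) (p k) (c' k) \<omega> = step_wiener_integral W (N k) (p k) (c k) \<omega> $ j" for k \<omega>
    by (simp add: step_wiener_integral_def c'_def sum_component)
  have fm: "f \<in> borel_measurable lebesgue"
  proof -
    have "\<sigma> \<in> borel_measurable (lebesgue_on {0..s})"
      by (rule measurable_restrict_mono[OF \<sigma>]) (use s in auto)
    then have "(\<lambda>x. \<sigma> x $ j) \<in> borel_measurable (lebesgue_on {0..s})" by measurable
    then have "(\<lambda>x. indicator {0..s} x *\<^sub>R \<sigma> x $ j) \<in> borel_measurable lebesgue"
      by (subst (asm) borel_measurable_restrict_space_iff) auto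
    then show ?thesis by (simp add: f_def[abs_def])
  qed
  have le: "ennreal ((x $ j)\<^sup>2) \<le> ennreal ((norm x)\<^sup>2)" for x :: "real^'n"
    using component_le_norm_cart[of x j] by (intro ennreal_leI) (metis abs_ge_zero power2_abs power_mono)
  \<comment> \<open>The grids lie in [0,s], so no error arises where the integrand has been extended
    by 0.\<close>
  have outside: "step_fun (N k) (p k) (c k) x = 0" if x: "x \<notin> {0..s}" for k x
  proof -
    have "x \<notin> {p k i<..p k (Suc i)}" if "i < N k" for i
    proof -
      have "p k i \<in> {0..s}" "p k (Suc i) \<in> {0..s}" using grid that by auto
      then show ?thesis using x by auto
    qed
    then show ?thesis by (simp add: step_fun_def)
  qed
  have "(\<lambda>k. \<integral>\<^sup>+x. ennreal ((step_fun (N k) (p k) (c' k) x - f x)\<^sup>2) \<partial>lebesgue) \<longlonglongrightarrow> 0"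
  proof (rule tendsto_sandwich[OF _ _ tendsto_const lim1]; intro always_eventually allI)
    fix k
    show "(\<integral>\<^sup>+x. ennreal ((step_fun (N k) (p k) (c' k) x - f x)\<^sup>2) \<partial>lebesgue)
        \<le> (\<integral>\<^sup>+x\<in>{0..s}. ennreal ((norm (step_fun (N k) (p k) (c k) x - \<sigma> x))\<^sup>2) \<partial>lebesgue)"
    proof (rule nn_integral_mono)
      fix x
      show "ennreal ((step_fun (N k) (p k) (c' k) x - f x)\<^sup>2)
          \<le> ennreal ((norm (step_fun (N k) (p k) (c k) x - \<sigma> x))\<^sup>2) * indicator {0..s} x"
        using le[of "step_fun (N k) (p k) (c k) x - \<sigma> x"] outside[of x k]
        by (cases "x \<in> {0..s}") (auto simp: comp1 f_def)
    qed
  qed simp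
  note 1 = L2_limit[OF step_square_integrable(1)[OF g] fm this]
  have "(\<lambda>k. \<integral>\<^sup>+\<omega>. ennreal ((step_wiener_integral W (N k) (p k) (c' k) \<omega> - I \<omega> $ j)\<^sup>2) \<partial>M) \<longlonglongrightarrow> 0"
  proof (rule tendsto_sandwich[OF _ _ tendsto_const lim2]; intro always_eventually allI)
    fix k
    show "(\<integral>\<^sup>+\<omega>. ennreal ((step_wiener_integral W (N k) (p k) (c' k) \<omega> - I \<omega> $ j)\<^sup>2) \<partial>M)
        \<le> (\<integral>\<^sup>+\<omega>. ennreal ((norm (step_wiener_integral W (N k) (p k) (c k) \<omega> - I \<omega>))\<^sup>2) \<partial>M)"
      unfolding comp2 vector_minus_component[symmetric] by (intro nn_integral_mono le)
  qed simp
  note 2 = L2_limit[OF step_square_integrable(2)[OF g] _ this]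
  have "(\<lambda>\<omega>. I \<omega> $ j) \<in> borel_measurable M" by measurable
  then show ?thesis
    unfolding wiener_limit_def f_def[symmetric] using 1 2 g by blast
qed

end

text \<open>\<open>Z\<close> is the pointwise limit of its values at times rounded down to multiples
  of 1/(k+1). Each approximation selects among countably many measurable functions, so measurability
  is needed only at rational times.\<close>

lemma jointly_measurable_continuous_paths:
  fixes Z :: "real \<Rightarrow> 'a \<Rightarrow> 'b::metric_space"
  assumes meas: "\<And>(i::int) k. Z (of_int i / real (Suc k)) \<in> borel_measurable M"
    and cont: "\<And>\<omega>. \<omega> \<in> space M \<Longrightarrow> continuous_on UNIV (\<lambda>s. Z s \<omega>)"
  shows "(\<lambda>(s, \<omega>). Z s \<omega>) \<in> borel_measurable (borel \<Otimes>\<^sub>M M)"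
proof (rule borel_measurable_LIMSEQ_metric)
  define a where "a k s = of_int \<lfloor>s * real (Suc k)\<rfloor> / real (Suc k)" for k and s :: real
  show "(\<lambda>(s, \<omega>). Z (a k s) \<omega>) \<in> borel_measurable (borel \<Otimes>\<^sub>M M)" for k
  proof -
    have "(\<lambda>x. (\<lambda>i x. Z (of_int i / real (Suc k)) (snd x)) \<lfloor>fst x * real (Suc k)\<rfloor> x)
        \<in> borel_measurable (borel \<Otimes>\<^sub>M M)"
    proof (rule measurable_compose_countable[where f="\<lambda>i x. Z (of_int i / real (Suc k)) (snd x)" and g="\<lambda>x. \<lfloor>fst x * real (Suc k)\<rfloor>"])
      show "(\<lambda>x. Z (of_int i / real (Suc k)) (snd x)) \<in> borel_measurable (borel \<Otimes>\<^sub>M M)" for i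
        by (rule measurable_compose[OF measurable_snd meas])
      show "(\<lambda>x. \<lfloor>fst x * real (Suc k)\<rfloor>) \<in> borel \<Otimes>\<^sub>M M \<rightarrow>\<^sub>M count_space UNIV" by measurable
    qed
    then show ?thesis by (simp add: a_def split_def)
  qed
  fix x :: "real \<times> 'a" assume "x \<in> space (borel \<Otimes>\<^sub>M M)"
  then obtain s \<omega> where x: "x = (s, \<omega>)" and \<omega>: "\<omega> \<in> space M" by (auto simp: space_pair_measure)
  have "(\<lambda>k. a k s) \<longlonglongrightarrow> s"
  proof (rule tendsto_sandwich)
    have "s - 1 / real (Suc k) \<le> a k s \<and> a k s \<le> s" for k
    proof -
      define n where "n = real (Suc k)"
      have n: "n > 0" by (simp add: n_def)
      have "(s * n - 1) / n \<le> of_int \<lfloor>s * n\<rfloor> / n" "of_int \<lfloor>s * n\<rfloor> / n \<le> s * n / n"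
        using n by (intro divide_right_mono; linarith)+
      then show ?thesis using n unfolding a_def n_def[symmetric] by (simp add: diff_divide_distrib)
    qed
    then show "eventually (\<lambda>k. s - 1 / real (Suc k) \<le> a k s) sequentially"
      "eventually (\<lambda>k. a k s \<le> s) sequentially" by auto
    show "(\<lambda>k. s - 1 / real (Suc k)) \<longlonglongrightarrow> s"
      using tendsto_diff[OF tendsto_const LIMSEQ_inverse_real_of_nat, of s] by (simp add: inverse_eq_divide)
  qed simp
  moreover have "isCont (\<lambda>s. Z s \<omega>) s"
    using cont[OF \<omega>] by (simp add: continuous_on_eq_continuous_at)
  ultimately have "(\<lambda>k. Z (a k s) \<omega>) \<longlonglongrightarrow> Z s \<omega>"
    by (rule isCont_tendsto_compose[rotated])
  then show "(\<lambda>k. case x of (s, \<omega>) \<Rightarrow> Z (a k s) \<omega>) \<longlonglongrightarrow> (case x of (s, \<omega>) \<Rightarrow> Z s \<omega>)"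
    by (simp add: x)
qed

text \<open>Fubini on both sides reduces the claim to one time \<open>s\<close>. In this way an
  integral of random variables is compared with an integral of functions on another measure
  space.\<close>

lemma L2_transfer:
  assumes Z: "L2_process S M Z" and z: "L2_process S N z"
    and \<eta>: "square_integrable M \<eta>" and y: "square_integrable N y"
    and eq: "\<And>s. s \<in> space S \<Longrightarrow> (\<integral>\<omega>. Z s \<omega> * \<eta> \<omega> \<partial>M) = (\<integral>v. z s v * y v \<partial>N)"
  shows "(\<integral>\<omega>. (\<integral>s. Z s \<omega> \<partial>S) * \<eta> \<omega> \<partial>M) = (\<integral>v. (\<integral>s. z s v \<partial>S) * y v \<partial>N)"
  unfolding L2_process.expectation_integral_mult[OF Z \<eta>] L2_process.expectation_integral_mult[OF z y]
  by (intro Bochner_Integration.integral_cong refl eq)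

section \<open>Linear stochastic equations\<close>

text \<open>The forcing \<open>f\<close> is constrained only through its paths. The delayed control
  and the deterministic term enter together, and their integral stays explicit in the
  decomposition.\<close>

locale linear_sde = wiener M F W + linear_system R A \<Phi>
  for M :: "'a measure" and F W and R :: real and A :: "real \<Rightarrow> real^'n^'n" and \<Phi> +
  fixes T :: real and \<sigma> :: "real \<Rightarrow> real^'n" and f X :: "real \<Rightarrow> 'a \<Rightarrow> real^'n"
  assumes T_pos: "0 < T" and T_le: "T \<le> R" and Linfty_\<sigma>: "Linfty_on {0..T} \<sigma>"
    and sde: "sde_solution M F W T (\<lambda>t \<omega> x. A t *v x + f t \<omega>) \<sigma> 0 X"
    and forcing: "AE \<omega> in M. integrable (lebesgue_on {0..T}) (\<lambda>t. f t \<omega>)"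
begin

definition drift :: "real \<Rightarrow> 'a \<Rightarrow> real^'n" where
  "drift t \<omega> = A t *v X t \<omega> + f t \<omega>"

definition noise :: "real \<Rightarrow> real \<Rightarrow> 'a \<Rightarrow> real^'n" where
  "noise a s \<omega> = X s \<omega> - X a \<omega> - (\<integral>u. drift u \<omega> \<partial>lebesgue_on {a..s})"

lemma \<sigma>_measurable: "\<sigma> \<in> borel_measurable (lebesgue_on {0..T})"
  using Linfty_\<sigma> by (simp add: Linfty_on_def)

lemma AE_paths:
  "AE \<omega> in M. continuous_on {0..T} (\<lambda>t. X t \<omega>) \<and> integrable (lebesgue_on {0..T}) (\<lambda>t. drift t \<omega>)"
  using sde by (auto simp: sde_solution_def drift_def set_integrable_lebesgue_on elim: AE_mp)

lemma wiener_integral_exists: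
  assumes "t \<in> {0..T}"
  shows "\<exists>I. has_wiener_integral M W 0 t \<sigma> I \<and>
    (AE \<omega> in M. X t \<omega> = (\<integral>u. drift u \<omega> \<partial>lebesgue_on {0..t}) + I \<omega>)"
  using sde assms by (simp add: sde_solution_def drift_def LINT_lebesgue_on)

lemma continuous_noise:
  assumes "0 \<le> a" "a \<le> b" "b \<le> T" "continuous_on {0..T} (\<lambda>t. X t \<omega>)"
    "integrable (lebesgue_on {0..T}) (\<lambda>t. drift t \<omega>)"
  shows "continuous_on {a..b} (\<lambda>s. noise a s \<omega>)"
  unfolding noise_def
proof (intro continuous_on_diff continuous_on_const indefinite_integral_continuous_real)
  show "continuous_on {a..b} (\<lambda>s. X s \<omega>)" by (rule continuous_on_subset[OF assms(4)]) (use assms in auto)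
  show "integrable (lebesgue_on {a..b}) (\<lambda>t. drift t \<omega>)"
    by (rule integrable_lebesgue_on_subinterval[OF assms(5)]) (use assms in auto)
qed

text \<open>The noise is almost surely equal to a difference of Wiener integrals at each fixed time, and it
  has continuous paths. Setting it to 0 off an event of full measure, on which the equality holds at
  countably many times, makes it jointly measurable.\<close>

lemma exists_noise:
  assumes ab: "0 \<le> a" "a \<le> b" "b \<le> T"
  obtains N :: "real \<Rightarrow> 'a \<Rightarrow> real^'n" where
    "(\<lambda>(s, \<omega>). N s \<omega>) \<in> borel_measurable (borel \<Otimes>\<^sub>M M)"
    "\<And>\<omega>. \<omega> \<in> space M \<Longrightarrow> continuous_on UNIV (\<lambda>s. N s \<omega>)"
    "\<And>s j. s \<in> {a..b} \<Longrightarrow> square_integrable M (\<lambda>\<omega>. N s \<omega> $ j)"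
    "\<And>s j \<xi>. s \<in> {a..b} \<Longrightarrow> \<xi> \<in> borel_measurable (F a) \<Longrightarrow> square_integrable M \<xi> \<Longrightarrow>
       expectation (\<lambda>\<omega>. N s \<omega> $ j * \<xi> \<omega>) = 0"
    "\<And>s u i j. s \<in> {a..b} \<Longrightarrow> u \<in> {a..b} \<Longrightarrow> expectation (\<lambda>\<omega>. N s \<omega> $ i * N u \<omega> $ j)
       = (\<integral>v. (indicator {..s} v *\<^sub>R \<sigma> v) $ i * (indicator {..u} v *\<^sub>R \<sigma> v) $ j \<partial>lebesgue_on {a..b})"
    "AE \<omega> in M. \<forall>s\<in>{a..b}. N s \<omega> = noise a s \<omega>"
proof -
  \<comment> \<open>The equation provides some Wiener integral for each \<open>t\<close> separately;
    the choice made here says nothing about dependence on \<open>t\<close>.\<close>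
  define I where "I t = (SOME I. has_wiener_integral M W 0 t \<sigma> I \<and>
    (AE \<omega> in M. X t \<omega> = (\<integral>u. drift u \<omega> \<partial>lebesgue_on {0..t}) + I \<omega>))" for t
  have I: "has_wiener_integral M W 0 t \<sigma> (I t)"
    "AE \<omega> in M. X t \<omega> = (\<integral>u. drift u \<omega> \<partial>lebesgue_on {0..t}) + I t \<omega>" if "t \<in> {0..T}" for t
    using someI_ex[OF wiener_integral_exists[OF that]] by (auto simp: I_def)
  have Im: "I t \<in> borel_measurable M" if "t \<in> {0..T}" for t
    using I(1)[OF that] by (simp add: has_wiener_integral_def)
  have a: "a \<in> {0..T}" using ab by auto
  have noise_I: "AE \<omega> in M. noise a s \<omega> = I s \<omega> - I a \<omega>" if s: "s \<in> {a..b}" for s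
  proof -
    have s': "s \<in> {0..T}" using s ab by auto
    show ?thesis
      using I(2)[OF s'] I(2)[OF a] AE_paths
    proof eventually_elim
      case (elim \<omega>)
      have "integrable (lebesgue_on {0..s}) (\<lambda>t. drift t \<omega>)"
        by (rule integrable_lebesgue_on_subinterval[of 0 T]) (use elim s' in auto)
      from integral_lebesgue_on_split[OF this, of a] show ?case
        using elim s ab by (simp add: noise_def)
    qed
  qed
  \<comment> \<open>Continues the noise constantly outside [a,b], so that paths are continuous on
    the whole line and the rational grid times need not lie in [a,b].\<close>
  define clamp where "clamp s = max a (min b s)" for s
  have clamp: "clamp s \<in> {a..b}" for s using ab by (auto simp: clamp_def)
  have clamp_id: "clamp s = s" if "s \<in> {a..b}" for s using that by (auto simp: clamp_def)
  have "AE \<omega> in M. (continuous_on {0..T} (\<lambda>t. X t \<omega>) \<and> integrable (lebesgue_on {0..T}) (\<lambda>t. drift t \<omega>))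
     \<and> (\<forall>i k. noise a (clamp (of_int i / real (Suc k))) \<omega>
          = I (clamp (of_int i / real (Suc k))) \<omega> - I a \<omega>)"
    using AE_paths noise_I[OF clamp] by (simp add: AE_all_countable)
  then obtain G where G: "G \<in> sets M" "AE \<omega> in M. \<omega> \<in> G"
    and GP: "\<And>\<omega>. \<omega> \<in> G \<Longrightarrow> continuous_on {0..T} (\<lambda>t. X t \<omega>) \<and> integrable (lebesgue_on {0..T}) (\<lambda>t. drift t \<omega>)"
    "\<And>\<omega> (i::int) k. \<omega> \<in> G \<Longrightarrow> noise a (clamp (of_int i / real (Suc k))) \<omega>
          = I (clamp (of_int i / real (Suc k))) \<omega> - I a \<omega>"
  proof (rule AE_E)
    fix N assume N: "{\<omega> \<in> space M. \<not> ((continuous_on {0..T} (\<lambda>t. X t \<omega>) \<and> integrable (lebesgue_on {0..T}) (\<lambda>t. drift t \<omega>))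
     \<and> (\<forall>i k. noise a (clamp (of_int i / real (Suc k))) \<omega>
          = I (clamp (of_int i / real (Suc k))) \<omega> - I a \<omega>))} \<subseteq> N" "emeasure M N = 0" "N \<in> sets M"
    have "AE \<omega> in M. \<omega> \<in> space M - N"
      using AE_not_in[of N M] N by (auto simp: null_sets_def)
    then show thesis
      using N(1,3) by (intro that[of "space M - N"]) auto
  qed
  define N where "N s \<omega> = (if \<omega> \<in> G then noise a (clamp s) \<omega> else 0)" for s \<omega>
  have N_AE: "AE \<omega> in M. N s \<omega> = I s \<omega> - I a \<omega>" if "s \<in> {a..b}" for s
    using noise_I[OF that] G(2) by eventually_elim (simp add: N_def clamp_id[OF that])
  have cont: "continuous_on UNIV (\<lambda>s. N s \<omega>)" for \<omega>
  proof (cases "\<omega> \<in> G")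
    case True
    have "continuous_on UNIV (\<lambda>s. noise a (clamp s) \<omega>)"
    proof (rule continuous_on_compose2[OF continuous_noise[OF ab]])
      show "continuous_on UNIV clamp" unfolding clamp_def by (intro continuous_intros)
    qed (use GP(1)[OF True] clamp in auto)
    then show ?thesis using True by (simp add: N_def)
  qed (simp add: N_def)
  have meas: "(\<lambda>(s, \<omega>). N s \<omega>) \<in> borel_measurable (borel \<Otimes>\<^sub>M M)"
  proof (rule jointly_measurable_continuous_paths[OF _ cont])
    fix i :: int and k
    define q where "q = clamp (of_int i / real (Suc k))"
    have q: "q \<in> {0..T}" using clamp[of "of_int i / real (Suc k)"] ab by (auto simp: q_def)
    have "(\<lambda>\<omega>. if \<omega> \<in> G then I q \<omega> - I a \<omega> else 0) \<in> borel_measurable M"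
      using Im[OF q] Im[OF a] G(1) by measurable
    moreover have "N (of_int i / real (Suc k)) = (\<lambda>\<omega>. if \<omega> \<in> G then I q \<omega> - I a \<omega> else 0)"
      using GP(2)[of _ i k] by (auto simp: N_def fun_eq_iff q_def)
    ultimately show "N (of_int i / real (Suc k)) \<in> borel_measurable M" by simp
  qed
  have Nm: "N s \<in> borel_measurable M" for s
    using measurable_Pair2[OF meas, of s] by simp
  define g where "g s j x = indicator {0..s} x * \<sigma> x $ j" for s j x
  have wl: "wiener_limit (g s j) (\<lambda>\<omega>. I s \<omega> $ j)" if "s \<in> {0..T}" for s j
    unfolding g_def[abs_def] by (rule has_wiener_integral_component[OF I(1)[OF that] \<sigma>_measurable that])
  have sqI: "square_integrable M (\<lambda>\<omega>. I s \<omega> $ j)" and sqg: "square_integrable lebesgue (g s j)"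
    if "s \<in> {0..T}" for s j
    using wl[OF that] by (auto simp: wiener_limit_def)
  have sqN: "square_integrable M (\<lambda>\<omega>. N s \<omega> $ j)" if s: "s \<in> {a..b}" for s j
  proof (rule square_integrable_cong_AE)
    show "square_integrable M (\<lambda>\<omega>. I s \<omega> $ j - I a \<omega> $ j)"
      using s ab by (intro square_integrable_diff sqI) auto
    show "(\<lambda>\<omega>. N s \<omega> $ j) \<in> borel_measurable M" using Nm by measurable
    show "AE \<omega> in M. I s \<omega> $ j - I a \<omega> $ j = N s \<omega> $ j"
      using N_AE[OF s] by eventually_elim simp
  qed
  have orth: "expectation (\<lambda>\<omega>. N s \<omega> $ j * \<xi> \<omega>) = 0"
    if s: "s \<in> {a..b}" and \<xi>: "\<xi> \<in> borel_measurable (F a)" "square_integrable M \<xi>" for s j \<xi>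
  proof -
    have s': "s \<in> {0..T}" using s ab by auto
    have \<xi>m: "\<xi> \<in> borel_measurable M" using \<xi>(2) by (rule square_integrable_measurable)
    \<comment> \<open>Cutting the integrand of I_s off at \<open>a\<close> gives that of I_a, so I_s
      and I_a have the same inner product with \<xi>.\<close>
    have "(\<lambda>x. indicator {..a} x * g s j x) = g a j"
      using s ab by (auto simp: g_def fun_eq_iff indicator_def)
    then have "expectation (\<lambda>\<omega>. I s \<omega> $ j * \<xi> \<omega>) = expectation (\<lambda>\<omega>. I a \<omega> $ j * \<xi> \<omega>)"
      using wiener_limit_stopped[OF ab(1) wl[OF s', of j] _ \<xi>, of "\<lambda>\<omega>. I a \<omega> $ j"] wl[OF a, of j] by simp
    moreover have "expectation (\<lambda>\<omega>. N s \<omega> $ j * \<xi> \<omega>) = expectation (\<lambda>\<omega>. (I s \<omega> $ j - I a \<omega> $ j) * \<xi> \<omega>)"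
    proof (rule integral_cong_AE)
      show "(\<lambda>\<omega>. N s \<omega> $ j * \<xi> \<omega>) \<in> borel_measurable M" using Nm[of s] \<xi>m by measurable
      show "(\<lambda>\<omega>. (I s \<omega> $ j - I a \<omega> $ j) * \<xi> \<omega>) \<in> borel_measurable M"
        using Im[OF s'] Im[OF a] \<xi>m by measurable
      show "AE \<omega> in M. N s \<omega> $ j * \<xi> \<omega> = (I s \<omega> $ j - I a \<omega> $ j) * \<xi> \<omega>"
        using N_AE[OF s] by eventually_elim simp
    qed
    ultimately show ?thesis
      using square_integrable_mult[OF sqI[OF s'] \<xi>(2)] square_integrable_mult[OF sqI[OF a] \<xi>(2)]
      by (simp add: left_diff_distrib)
  qed
  have cov: "expectation (\<lambda>\<omega>. N s \<omega> $ i * N u \<omega> $ j)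
       = (\<integral>v. (indicator {..s} v *\<^sub>R \<sigma> v) $ i * (indicator {..u} v *\<^sub>R \<sigma> v) $ j \<partial>lebesgue_on {a..b})"
    if s: "s \<in> {a..b}" and u: "u \<in> {a..b}" for s u i j
  proof -
    have s': "s \<in> {0..T}" and u': "u \<in> {0..T}" using s u ab by auto
    have "expectation (\<lambda>\<omega>. N s \<omega> $ i * N u \<omega> $ j)
        = expectation (\<lambda>\<omega>. (I s \<omega> $ i - I a \<omega> $ i) * (I u \<omega> $ j - I a \<omega> $ j))"
    proof (rule integral_cong_AE)
      show "(\<lambda>\<omega>. N s \<omega> $ i * N u \<omega> $ j) \<in> borel_measurable M" using Nm[of s] Nm[of u] by measurable
      show "(\<lambda>\<omega>. (I s \<omega> $ i - I a \<omega> $ i) * (I u \<omega> $ j - I a \<omega> $ j)) \<in> borel_measurable M"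
        using Im[OF s'] Im[OF a] Im[OF u'] by measurable
      show "AE \<omega> in M. N s \<omega> $ i * N u \<omega> $ j = (I s \<omega> $ i - I a \<omega> $ i) * (I u \<omega> $ j - I a \<omega> $ j)"
        using N_AE[OF s] N_AE[OF u] by eventually_elim simp
    qed
    also have "\<dots> = (\<integral>x. (g s i x - g a i x) * (g u j x - g a j x) \<partial>lebesgue)"
      unfolding integral_diff_mult_diff[OF sqI[OF s'] sqI[OF a] sqI[OF u'] sqI[OF a]]
        integral_diff_mult_diff[OF sqg[OF s'] sqg[OF a] sqg[OF u'] sqg[OF a]]
      by (simp only: wiener_limit_isometry[OF wl[OF s'] wl[OF u']] wiener_limit_isometry[OF wl[OF s'] wl[OF a]]
          wiener_limit_isometry[OF wl[OF a] wl[OF u']] wiener_limit_isometry[OF wl[OF a] wl[OF a]])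
    also have "\<dots> = (\<integral>v. indicator {a..b} v *\<^sub>R
        ((indicator {..s} v *\<^sub>R \<sigma> v) $ i * (indicator {..u} v *\<^sub>R \<sigma> v) $ j) \<partial>lebesgue)"
    proof (rule integral_cong_AE)
      show m1: "(\<lambda>x. (g s i x - g a i x) * (g u j x - g a j x)) \<in> borel_measurable lebesgue"
        using square_integrable_measurable[OF sqg[OF s', of i]] square_integrable_measurable[OF sqg[OF u', of j]]
          square_integrable_measurable[OF sqg[OF a, of i]] square_integrable_measurable[OF sqg[OF a, of j]]
        by measurable
      show ae: "AE x in lebesgue. (g s i x - g a i x) * (g u j x - g a j x) = indicator {a..b} x *\<^sub>R
        ((indicator {..s} x *\<^sub>R \<sigma> x) $ i * (indicator {..u} x *\<^sub>R \<sigma> x) $ j)"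
      \<comment> \<open>The difference of the indicators of [0,s] and [0,a] is supported on (a,s],
        while the right-hand side also contains the point a.\<close>
      proof (rule AE_mp[OF _ AE_I2])
        show "AE x in lebesgue. x \<noteq> a"
          by (rule AE_completion) (rule AE_lborel_singleton)
        show "x \<noteq> a \<longrightarrow> (g s i x - g a i x) * (g u j x - g a j x) = indicator {a..b} x *\<^sub>R
            ((indicator {..s} x *\<^sub>R \<sigma> x) $ i * (indicator {..u} x *\<^sub>R \<sigma> x) $ j)" for x
          using s u ab by (auto simp: g_def indicator_def)
      qed
      show "(\<lambda>x. indicator {a..b} x *\<^sub>R
        ((indicator {..s} x *\<^sub>R \<sigma> x) $ i * (indicator {..u} x *\<^sub>R \<sigma> x) $ j)) \<in> borel_measurable lebesgue"
        by (rule borel_measurable_AE[OF m1 ae])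
    qed
    also have "\<dots> = (\<integral>v. (indicator {..s} v *\<^sub>R \<sigma> v) $ i * (indicator {..u} v *\<^sub>R \<sigma> v) $ j \<partial>lebesgue_on {a..b})"
      by (subst integral_restrict_space) auto
    finally show ?thesis .
  qed
  have "AE \<omega> in M. \<forall>s\<in>{a..b}. N s \<omega> = noise a s \<omega>"
    using G(2) by eventually_elim (simp add: N_def clamp_id)
  from that[OF meas cont sqN orth cov this] show thesis by blast
qed

end

text \<open>Tonelli's criterion: the essential bound on \<open>K\<close> multiplies second moments
  by at most \<open>C\<^sup>2\<close>. Second moments are required only for almost every
  \<open>s\<close>, since this is all that is known of the controls.\<close>

lemma L2_process_matrix_mult:
  fixes Z :: "'s \<Rightarrow> 'a \<Rightarrow> real^'n" and K :: "'s \<Rightarrow> real^'n^'m"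
  assumes S: "finite_measure S" and M: "finite_measure M"
    and Z: "(\<lambda>(s, \<omega>). Z s \<omega>) \<in> borel_measurable (S \<Otimes>\<^sub>M M)"
    and K: "K \<in> borel_measurable S" "AE s in S. \<forall>x. norm (K s *v x) \<le> C * norm x"
    and sections: "AE s in S. integrable M (\<lambda>\<omega>. (norm (Z s \<omega>))\<^sup>2)"
    and int: "integrable S (\<lambda>s. \<integral>\<omega>. (norm (Z s \<omega>))\<^sup>2 \<partial>M)"
  shows "L2_process S M (\<lambda>s \<omega>. (K s *v Z s \<omega>) $ i)"
proof -
  interpret S: finite_measure S by fact
  interpret M: finite_measure M by fact
  interpret pair_sigma_finite S M ..
  have [measurable]: "(\<lambda>p. Z (fst p) (snd p)) \<in> borel_measurable (S \<Otimes>\<^sub>M M)" "K \<in> borel_measurable S"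
    using Z K(1) by (simp_all add: split_def)
  have meas: "(\<lambda>p. (K (fst p) *v Z (fst p) (snd p)) $ i) \<in> borel_measurable (S \<Otimes>\<^sub>M M)"
    by measurable
  have comp: "((K s *v Z s \<omega>) $ i)\<^sup>2 \<le> C\<^sup>2 * (norm (Z s \<omega>))\<^sup>2"
    if "\<forall>x. norm (K s *v x) \<le> C * norm x" for s \<omega>
  proof -
    have "\<bar>(K s *v Z s \<omega>) $ i\<bar> \<le> C * norm (Z s \<omega>)"
      using component_le_norm_cart[of "K s *v Z s \<omega>" i] that by (blast intro: order_trans)
    then have "\<bar>(K s *v Z s \<omega>) $ i\<bar>\<^sup>2 \<le> (C * norm (Z s \<omega>))\<^sup>2"
      by (intro power_mono) auto
    then show ?thesis by (simp add: power_mult_distrib)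
  qed
  have sec: "(\<lambda>\<omega>. (K s *v Z s \<omega>) $ i) \<in> borel_measurable M" if "s \<in> space S" for s
    using measurable_Pair2[OF meas that] by simp
  have AE_int: "AE s in S. integrable M (\<lambda>\<omega>. ((K s *v Z s \<omega>) $ i)\<^sup>2)"
    using K(2) sections AE_space
  proof eventually_elim
    case (elim s)
    show ?case
    proof (rule Bochner_Integration.integrable_bound)
      show "integrable M (\<lambda>\<omega>. C\<^sup>2 * (norm (Z s \<omega>))\<^sup>2)" using elim(2) by simp
      show "(\<lambda>\<omega>. ((K s *v Z s \<omega>) $ i)\<^sup>2) \<in> borel_measurable M" using sec[OF elim(3)] by measurable
      show "AE \<omega> in M. norm (((K s *v Z s \<omega>) $ i)\<^sup>2) \<le> norm (C\<^sup>2 * (norm (Z s \<omega>))\<^sup>2)"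
        using comp[OF elim(1)] by (intro AE_I2) simp
    qed
  qed
  have "integrable (S \<Otimes>\<^sub>M M) (\<lambda>p. ((K (fst p) *v Z (fst p) (snd p)) $ i)\<^sup>2)"
  proof (rule Fubini_integrable)
    show "(\<lambda>p. ((K (fst p) *v Z (fst p) (snd p)) $ i)\<^sup>2) \<in> borel_measurable (S \<Otimes>\<^sub>M M)"
      using meas by measurable
    show "AE s in S. integrable M (\<lambda>\<omega>. ((K (fst (s, \<omega>)) *v Z (fst (s, \<omega>)) (snd (s, \<omega>))) $ i)\<^sup>2)"
      using AE_int by simp
    show "integrable S (\<lambda>s. \<integral>\<omega>. norm (((K (fst (s, \<omega>)) *v Z (fst (s, \<omega>)) (snd (s, \<omega>))) $ i)\<^sup>2) \<partial>M)"
    proof (rule Bochner_Integration.integrable_bound)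
      show "integrable S (\<lambda>s. C\<^sup>2 * (\<integral>\<omega>. (norm (Z s \<omega>))\<^sup>2 \<partial>M))" using int by simp
      show "(\<lambda>s. \<integral>\<omega>. norm (((K (fst (s, \<omega>)) *v Z (fst (s, \<omega>)) (snd (s, \<omega>))) $ i)\<^sup>2) \<partial>M) \<in> borel_measurable S"
        by measurable
      show "AE s in S. norm (\<integral>\<omega>. norm (((K (fst (s, \<omega>)) *v Z (fst (s, \<omega>)) (snd (s, \<omega>))) $ i)\<^sup>2) \<partial>M)
          \<le> norm (C\<^sup>2 * (\<integral>\<omega>. (norm (Z s \<omega>))\<^sup>2 \<partial>M))"
        using K(2) AE_int sections
      proof eventually_elim
        case (elim s)
        have "(\<integral>\<omega>. ((K s *v Z s \<omega>) $ i)\<^sup>2 \<partial>M) \<le> (\<integral>\<omega>. C\<^sup>2 * (norm (Z s \<omega>))\<^sup>2 \<partial>M)"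
          by (rule integral_mono[OF elim(2) _ comp[OF elim(1)]]) (use elim(3) in simp)
        then show ?case by simp
      qed
    qed
  qed
  then have "square_integrable (S \<Otimes>\<^sub>M M) (\<lambda>(s, \<omega>). (K s *v Z s \<omega>) $ i)"
    using meas by (simp add: square_integrable_def split_def)
  then show ?thesis
    by (intro L2_process.intro L2_process_axioms.intro S M)
qed

lemma norm_square_cart: "(norm (x :: real^'n))\<^sup>2 = (\<Sum>j\<in>UNIV. (x $ j)\<^sup>2)"
  by (simp add: norm_vec_def L2_set_def sum_nonneg)

text \<open>On a finite measure a uniform bound on second moments makes them integrable. The noise
  and the functions d_s are of this kind.\<close>

lemma L2_process_matrix_mult_bounded:
  fixes Z :: "'s \<Rightarrow> 'a \<Rightarrow> real^'n" and K :: "'s \<Rightarrow> real^'n^'m"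
  assumes S: "finite_measure S" and M: "finite_measure M"
    and Z: "(\<lambda>(s, \<omega>). Z s \<omega>) \<in> borel_measurable (S \<Otimes>\<^sub>M M)"
    and K: "K \<in> borel_measurable S" "AE s in S. \<forall>x. norm (K s *v x) \<le> C * norm x"
    and sq: "\<And>s j. s \<in> space S \<Longrightarrow> square_integrable M (\<lambda>\<omega>. Z s \<omega> $ j)"
    and bound: "\<And>s j. s \<in> space S \<Longrightarrow> (\<integral>\<omega>. (Z s \<omega> $ j)\<^sup>2 \<partial>M) \<le> D"
  shows "L2_process S M (\<lambda>s \<omega>. (K s *v Z s \<omega>) $ i)"
proof (rule L2_process_matrix_mult[OF S M Z K])
  interpret S: finite_measure S by fact
  interpret M: finite_measure M by fact
  interpret pair_sigma_finite S M ..
  have [measurable]: "(\<lambda>(s, \<omega>). Z s \<omega>) \<in> borel_measurable (S \<Otimes>\<^sub>M M)" by fact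
  have i: "integrable M (\<lambda>\<omega>. (Z s \<omega> $ j)\<^sup>2)" if "s \<in> space S" for s j
    by (rule square_integrable_square[OF sq[OF that]])
  show "AE s in S. integrable M (\<lambda>\<omega>. (norm (Z s \<omega>))\<^sup>2)"
    unfolding norm_square_cart using i by (intro AE_I2) simp
  show "integrable S (\<lambda>s. \<integral>\<omega>. (norm (Z s \<omega>))\<^sup>2 \<partial>M)"
  proof (rule S.integrable_const_bound[where B="\<Sum>j\<in>(UNIV::'n set). D"])
    show "(\<lambda>s. \<integral>\<omega>. (norm (Z s \<omega>))\<^sup>2 \<partial>M) \<in> borel_measurable S" by measurable
    have "norm (\<integral>\<omega>. (norm (Z s \<omega>))\<^sup>2 \<partial>M) \<le> (\<Sum>j\<in>(UNIV::'n set). D)" if "s \<in> space S" for s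
    proof -
      have "(\<integral>\<omega>. (norm (Z s \<omega>))\<^sup>2 \<partial>M) = (\<Sum>j\<in>UNIV. \<integral>\<omega>. (Z s \<omega> $ j)\<^sup>2 \<partial>M)"
        unfolding norm_square_cart using i[OF that] by simp
      also have "\<dots> \<le> (\<Sum>j\<in>(UNIV::'n set). D)" by (intro sum_mono bound that)
      finally show ?thesis by simp
    qed
    then show "AE s in S. norm (\<integral>\<omega>. (norm (Z s \<omega>))\<^sup>2 \<partial>M) \<le> (\<Sum>j\<in>(UNIV::'n set). D)"
      by (intro AE_I2)
  qed
qed

context linear_sde
begin

text \<open>It makes no assumption on moments of X or f, so it can be used twice: from time 0 to
  show that X_a is square-integrable, and then on [a,b] with X_a as an admissible \<xi>.\<close>

theorem decomposition:
  assumes ab: "0 \<le> a" "a \<le> b" "b \<le> T"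
  obtains J :: "'a \<Rightarrow> real^'n" where
    "\<And>i. square_integrable M (\<lambda>\<omega>. J \<omega> $ i)"
    "AE \<omega> in M. X b \<omega> = \<Phi> b a *v X a \<omega> + (\<integral>u. \<Phi> b u *v f u \<omega> \<partial>lebesgue_on {a..b}) + J \<omega>"
    "\<And>\<xi> i. \<xi> \<in> borel_measurable (F a) \<Longrightarrow> square_integrable M \<xi> \<Longrightarrow> expectation (\<lambda>\<omega>. J \<omega> $ i * \<xi> \<omega>) = 0"
    "\<And>i j. expectation (\<lambda>\<omega>. J \<omega> $ i * J \<omega> $ j)
       = (\<integral>v. (\<Phi> b v *v \<sigma> v) $ i * (\<Phi> b v *v \<sigma> v) $ j \<partial>lebesgue_on {a..b})"
    "\<And>i j. integrable (lebesgue_on {a..b}) (\<lambda>v. (\<Phi> b v *v \<sigma> v) $ i * (\<Phi> b v *v \<sigma> v) $ j)"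
proof -
  obtain N :: "real \<Rightarrow> 'a \<Rightarrow> real^'n" where
    meas: "(\<lambda>(s, \<omega>). N s \<omega>) \<in> borel_measurable (borel \<Otimes>\<^sub>M M)" and
    cont: "\<And>\<omega>. \<omega> \<in> space M \<Longrightarrow> continuous_on UNIV (\<lambda>s. N s \<omega>)" and
    sqN: "\<And>s j. s \<in> {a..b} \<Longrightarrow> square_integrable M (\<lambda>\<omega>. N s \<omega> $ j)" and
    orth: "\<And>s j \<xi>. s \<in> {a..b} \<Longrightarrow> \<xi> \<in> borel_measurable (F a) \<Longrightarrow> square_integrable M \<xi> \<Longrightarrow>
       expectation (\<lambda>\<omega>. N s \<omega> $ j * \<xi> \<omega>) = 0" and
    cov: "\<And>s u i j. s \<in> {a..b} \<Longrightarrow> u \<in> {a..b} \<Longrightarrow> expectation (\<lambda>\<omega>. N s \<omega> $ i * N u \<omega> $ j)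
       = (\<integral>v. (indicator {..s} v *\<^sub>R \<sigma> v) $ i * (indicator {..u} v *\<^sub>R \<sigma> v) $ j \<partial>lebesgue_on {a..b})" and
    noise: "AE \<omega> in M. \<forall>s\<in>{a..b}. N s \<omega> = noise a s \<omega>"
    by (rule exists_noise[OF ab]) blast
  let ?L = "lebesgue_on {a..b}"
  interpret L: finite_measure ?L by (rule finite_measure_lebesgue_on_Icc)
  have bR: "b \<le> R" "b \<in> {0..R}" and sub: "{a..b} \<subseteq> {0..R}" using ab T_le by auto
  define d where "d s v = indicator {..s} v *\<^sub>R \<sigma> v" for s v
  define K where "K u = \<Phi> b u ** A u" for u
  define \<phi> where "\<phi> v = \<Phi> b v *v \<sigma> v" for v
  have Pc: "continuous_on {a..b} (\<Phi> b)"
    using continuous_on_subset[OF continuous_on_fundamental_right[OF bR(2)] sub] .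
  have Pm[measurable]: "\<Phi> b \<in> borel_measurable ?L"
    using continuous_matrix_Linfty[OF Pc] by (simp add: Linfty_on_def)
  obtain C1 where C1: "AE u in ?L. \<forall>x. norm (\<Phi> b u *v x) \<le> C1 * norm x"
    using Linfty_on_matrix_bound[OF continuous_matrix_Linfty[OF Pc]] by blast
  obtain C2 where "AE u in lebesgue_on {0..R}. \<forall>x. norm (A u *v x) \<le> C2 * norm x"
    using Linfty_on_matrix_bound[OF Linfty] by blast
  then have C2: "AE u in ?L. \<forall>x. norm (A u *v x) \<le> C2 * norm x"
    by (rule AE_lebesgue_on_subset[OF _ sub]) auto
  have Am[measurable]: "A \<in> borel_measurable ?L"
    by (rule measurable_restrict_mono[OF _ sub]) (use Linfty in \<open>auto simp: Linfty_on_def\<close>)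
  have Km[measurable]: "K \<in> borel_measurable ?L" unfolding K_def by measurable
  have KC: "AE u in ?L. \<forall>x. norm (K u *v x) \<le> (\<bar>C1\<bar> * C2) * norm x"
    using C1 C2
  proof eventually_elim
    case (elim u)
    show ?case
    proof
      fix x
      have "norm (K u *v x) \<le> C1 * norm (A u *v x)"
        using elim(1) by (simp add: K_def flip: matrix_vector_mul_assoc)
      also have "\<dots> \<le> \<bar>C1\<bar> * norm (A u *v x)" by (intro mult_right_mono) auto
      also have "\<dots> \<le> \<bar>C1\<bar> * (C2 * norm x)" using elim(2) by (intro mult_left_mono) auto
      finally show "norm (K u *v x) \<le> (\<bar>C1\<bar> * C2) * norm x" by simp
    qed
  qed
  have \<sigma>m[measurable]: "\<sigma> \<in> borel_measurable ?L"
    by (rule measurable_restrict_mono[OF \<sigma>_measurable]) (use ab in auto)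
  obtain c where "AE u in lebesgue_on {0..T}. norm (\<sigma> u) \<le> c"
    using Linfty_\<sigma> by (auto simp: Linfty_on_def)
  then have c: "AE u in ?L. norm (\<sigma> u) \<le> c"
    by (rule AE_lebesgue_on_subinterval) (use ab in auto)
  have bounded_sq: "square_integrable ?L g" if "g \<in> borel_measurable ?L" "AE u in ?L. \<bar>g u\<bar> \<le> B" for g B
  proof (rule square_integrable_bound[OF that(1)])
    show "integrable ?L (\<lambda>x. B\<^sup>2)" by simp
    show "AE x in ?L. (g x)\<^sup>2 \<le> B\<^sup>2"
      using that(2) by eventually_elim (metis abs_ge_zero power2_abs power_mono)
  qed
  have sq\<sigma>: "square_integrable ?L (\<lambda>u. \<sigma> u $ j)" for j
    by (rule bounded_sq[of _ c])
       (measurable, use c in eventually_elim, use component_le_norm_cart order_trans in blast)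
  have sq\<phi>: "square_integrable ?L (\<lambda>u. \<phi> u $ j)" for j
  proof (rule bounded_sq[of _ "\<bar>C1\<bar> * c"])
    show "(\<lambda>u. \<phi> u $ j) \<in> borel_measurable ?L" unfolding \<phi>_def by measurable
    show "AE u in ?L. \<bar>\<phi> u $ j\<bar> \<le> \<bar>C1\<bar> * c"
      using C1 c
    proof eventually_elim
      case (elim u)
      have "\<bar>\<phi> u $ j\<bar> \<le> norm (\<Phi> b u *v \<sigma> u)" unfolding \<phi>_def by (rule component_le_norm_cart)
      also have "\<dots> \<le> C1 * norm (\<sigma> u)" using elim by blast
      also have "\<dots> \<le> \<bar>C1\<bar> * norm (\<sigma> u)" by (intro mult_right_mono) auto
      also have "\<dots> \<le> \<bar>C1\<bar> * c" using elim(2) by (intro mult_left_mono) auto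
      finally show ?case .
    qed
  qed
  have idm[measurable]: "(\<lambda>x. x) \<in> borel_measurable ?L"
    by (rule measurable_restrict_space1) (simp add: measurable_completion)
  have dm: "d s \<in> borel_measurable ?L" for s
    unfolding d_def[abs_def] by measurable
  have sqd: "square_integrable ?L (\<lambda>v. d s v $ j)" for s j
  proof (rule square_integrable_bound[OF _ square_integrable_square[OF sq\<sigma>[of j]]])
    show "(\<lambda>v. d s v $ j) \<in> borel_measurable ?L" using dm by measurable
  qed (auto simp: d_def indicator_def)
  \<comment> \<open>\<open>D\<close> dominates the second moment of every component of every
    \<open>d s\<close>, and through \<open>cov\<close> of every \<open>N s\<close> as well.\<close>
  define D where "D = (\<Sum>j\<in>UNIV. \<integral>v. (\<sigma> v $ j)\<^sup>2 \<partial>?L)"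
  have dD: "(\<integral>v. (d s v $ j)\<^sup>2 \<partial>?L) \<le> D" for s j
  proof -
    have "(\<integral>v. (d s v $ j)\<^sup>2 \<partial>?L) \<le> (\<integral>v. (\<sigma> v $ j)\<^sup>2 \<partial>?L)"
      by (rule integral_mono[OF square_integrable_square[OF sqd] square_integrable_square[OF sq\<sigma>]])
         (auto simp: d_def indicator_def)
    also have "\<dots> \<le> D" unfolding D_def by (rule member_le_sum) auto
    finally show ?thesis .
  qed
  have ND: "(\<integral>\<omega>. (N s \<omega> $ j)\<^sup>2 \<partial>M) \<le> D" if "s \<in> {a..b}" for s j
    using dD[of s j] cov[OF that that, of j j] by (simp add: power2_eq_square d_def)
  have Nm: "(\<lambda>(s, \<omega>). N s \<omega>) \<in> borel_measurable (?L \<Otimes>\<^sub>M M)"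
  proof -
    have "(\<lambda>p. (fst p, snd p)) \<in> ?L \<Otimes>\<^sub>M M \<rightarrow>\<^sub>M borel \<Otimes>\<^sub>M M" by measurable
    from measurable_compose[OF this meas] show ?thesis by (simp add: split_def)
  qed
  have dpair: "(\<lambda>(s, v). d s v) \<in> borel_measurable (?L \<Otimes>\<^sub>M ?L)"
  proof -
    have "(\<lambda>p. if snd p \<le> fst p then 1 else 0 :: real) \<in> borel_measurable (?L \<Otimes>\<^sub>M ?L)"
      by measurable
    then have [measurable]: "(\<lambda>p. indicator {..fst p} (snd p) :: real) \<in> borel_measurable (?L \<Otimes>\<^sub>M ?L)"
      by (simp add: indicator_def of_bool_def)
    show ?thesis unfolding d_def split_def by measurable
  qed
  have PN: "L2_process ?L M (\<lambda>s \<omega>. (K s *v N s \<omega>) $ i)" for i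
    by (rule L2_process_matrix_mult_bounded[OF L.finite_measure_axioms finite_measure_axioms Nm Km KC])
       (use sqN ND in auto)
  have Pd: "L2_process ?L ?L (\<lambda>s v. (K s *v d s v) $ i)" for i
    by (rule L2_process_matrix_mult_bounded[OF L.finite_measure_axioms L.finite_measure_axioms dpair Km KC])
       (use sqd dD in auto)
  \<comment> \<open>Integrals are taken entry by entry, since \<open>L2_process\<close> is scalar;
    equality with the vector integral is established pathwise in \<open>KN\<close>.\<close>
  define J where "J \<omega> = (\<chi> i. N b \<omega> $ i + (\<integral>s. (K s *v N s \<omega>) $ i \<partial>?L))" for \<omega>
  have sqI: "square_integrable M (\<lambda>\<omega>. \<integral>s. (K s *v N s \<omega>) $ i \<partial>?L)" for i
    by (rule L2_process.square_integrable_integral[OF PN])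
  have sqId: "square_integrable ?L (\<lambda>v. \<integral>s. (K s *v d s v) $ i \<partial>?L)" for i
    by (rule L2_process.square_integrable_integral[OF Pd])
  have bab: "b \<in> {a..b}" using ab by simp
  have sqJ: "square_integrable M (\<lambda>\<omega>. J \<omega> $ i)" for i
    unfolding J_def using sqN[OF bab] sqI by (simp add: square_integrable_add)
  \<comment> \<open>As \<open>d s v\<close> vanishes for s < v, the integral runs over [v,b] and
    equals \<Phi>(b,v) \<sigma>(v) - \<sigma>(v); the term \<open>d b v\<close> restores the
    subtracted \<sigma>(v).\<close>
  have \<phi>_eq: "\<phi> v $ i = d b v $ i + (\<integral>s. (K s *v d s v) $ i \<partial>?L)" if v: "v \<in> {a..b}" for v i
  proof -
    have va: "0 \<le> v" "v \<le> b" using v ab by auto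
    have "(\<integral>s. (K s *v d s v) $ i \<partial>?L) = (\<integral>s. indicator {v..} s *\<^sub>R (\<Phi> b s *v (A s *v \<sigma> v)) $ i \<partial>?L)"
      by (intro Bochner_Integration.integral_cong refl)
         (auto simp: K_def d_def indicator_def matrix_vector_mul_assoc)
    also have "\<dots> = (\<integral>s. (\<Phi> b s *v (A s *v \<sigma> v)) $ i \<partial>lebesgue_on {v..b})"
      by (rule integral_lebesgue_on_tail[OF v, symmetric])
    also have "\<dots> = (\<integral>s. \<Phi> b s *v (A s *v \<sigma> v) \<partial>lebesgue_on {v..b}) $ i"
      by (rule integral_bounded_linear[OF bounded_linear_vec_nth integral_fundamental_A(2)[OF va bR(1)]])
    also have "\<dots> = (\<phi> v - \<sigma> v) $ i"
      by (simp only: integral_fundamental_A(1)[OF va bR(1)] \<phi>_def)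
    finally show ?thesis using v by (simp add: d_def)
  qed
  text \<open>If the inner products of the values of N with \<eta> agree with those of the functions d s with y,
    then so do the inner products of J and \<phi>. Applied with \<eta> a value of N, and then with \<eta> = J,
    this moves the covariance of J to an integral over [a, b].\<close>
  have transfer: "expectation (\<lambda>\<omega>. J \<omega> $ i * \<eta> \<omega>) = (\<integral>v. \<phi> v $ i * y v \<partial>?L)"
    if \<eta>: "square_integrable M \<eta>" and y: "square_integrable ?L y"
      and eq: "\<And>s j. s \<in> {a..b} \<Longrightarrow> expectation (\<lambda>\<omega>. N s \<omega> $ j * \<eta> \<omega>) = (\<integral>v. d s v $ j * y v \<partial>?L)"
    for \<eta> y i
  proof -
    have "expectation (\<lambda>\<omega>. (\<integral>s. (K s *v N s \<omega>) $ i \<partial>?L) * \<eta> \<omega>) = (\<integral>v. (\<integral>s. (K s *v d s v) $ i \<partial>?L) * y v \<partial>?L)"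
    proof (rule L2_transfer[OF PN Pd \<eta> y])
      fix s assume "s \<in> space ?L"
      then have s: "s \<in> {a..b}" by simp
      have "expectation (\<lambda>\<omega>. (K s *v N s \<omega>) $ i * \<eta> \<omega>)
          = expectation (\<lambda>\<omega>. \<Sum>k\<in>UNIV. K s $ i $ k * (N s \<omega> $ k * \<eta> \<omega>))"
        by (simp add: matrix_vector_mult_def sum_distrib_right mult.assoc)
      also have "\<dots> = (\<Sum>k\<in>UNIV. K s $ i $ k * expectation (\<lambda>\<omega>. N s \<omega> $ k * \<eta> \<omega>))"
        using square_integrable_mult[OF sqN[OF s] \<eta>] by simp
      also have "\<dots> = (\<Sum>k\<in>UNIV. K s $ i $ k * (\<integral>v. d s v $ k * y v \<partial>?L))"
        by (simp add: eq[OF s])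
      also have "\<dots> = (\<integral>v. (\<Sum>k\<in>UNIV. K s $ i $ k * (d s v $ k * y v)) \<partial>?L)"
        using square_integrable_mult[OF sqd y] by simp
      also have "\<dots> = (\<integral>v. (K s *v d s v) $ i * y v \<partial>?L)"
        by (simp add: matrix_vector_mult_def sum_distrib_right mult.assoc)
      finally show "expectation (\<lambda>\<omega>. (K s *v N s \<omega>) $ i * \<eta> \<omega>) = (\<integral>v. (K s *v d s v) $ i * y v \<partial>?L)" .
    qed
    moreover have "expectation (\<lambda>\<omega>. J \<omega> $ i * \<eta> \<omega>)
        = expectation (\<lambda>\<omega>. N b \<omega> $ i * \<eta> \<omega>) + expectation (\<lambda>\<omega>. (\<integral>s. (K s *v N s \<omega>) $ i \<partial>?L) * \<eta> \<omega>)"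
      using square_integrable_mult[OF sqN[OF bab] \<eta>] square_integrable_mult[OF sqI \<eta>]
      by (simp add: J_def distrib_right)
    moreover have "(\<integral>v. \<phi> v $ i * y v \<partial>?L) = (\<integral>v. d b v $ i * y v + (\<integral>s. (K s *v d s v) $ i \<partial>?L) * y v \<partial>?L)"
      by (intro Bochner_Integration.integral_cong refl) (auto simp: \<phi>_eq distrib_right)
    moreover have "\<dots> = (\<integral>v. d b v $ i * y v \<partial>?L) + (\<integral>v. (\<integral>s. (K s *v d s v) $ i \<partial>?L) * y v \<partial>?L)"
      using square_integrable_mult[OF sqd y] square_integrable_mult[OF sqId y] by simp
    ultimately show ?thesis using eq[OF bab, of i] by simp
  qed
  \<comment> \<open>This is \<open>transfer\<close> with \<open>y = 0\<close>, because all inner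
    products of the noise with \<xi> vanish.\<close>
  have orthJ: "expectation (\<lambda>\<omega>. J \<omega> $ i * \<xi> \<omega>) = 0"
    if "\<xi> \<in> borel_measurable (F a)" "square_integrable M \<xi>" for \<xi> i
    using transfer[OF that(2) square_integrable_zero] orth[OF _ that] by simp
  have JN: "expectation (\<lambda>\<omega>. J \<omega> $ i * N s \<omega> $ k) = (\<integral>v. \<phi> v $ i * d s v $ k \<partial>?L)" if "s \<in> {a..b}" for i k s
    by (rule transfer[OF sqN[OF that] sqd]) (use cov[OF _ that] in \<open>simp add: d_def\<close>)
  have JJ: "expectation (\<lambda>\<omega>. J \<omega> $ i * J \<omega> $ j) = (\<integral>v. \<phi> v $ i * \<phi> v $ j \<partial>?L)" for i j
  proof (rule transfer[OF sqJ sq\<phi>])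
    show "expectation (\<lambda>\<omega>. N s \<omega> $ k * J \<omega> $ j) = (\<integral>v. d s v $ k * \<phi> v $ j \<partial>?L)" if "s \<in> {a..b}" for s k
      using JN[OF that, of j k] by (simp add: mult.commute)
  qed
  have "AE \<omega> in M. X b \<omega> = \<Phi> b a *v X a \<omega> + (\<integral>u. \<Phi> b u *v f u \<omega> \<partial>?L) + J \<omega>"
    using noise AE_paths forcing AE_space
  proof eventually_elim
    case (elim \<omega>)
    \<comment> \<open>Removing the noise leaves a path equal to the integral of the drift, hence an
      ordinary linear equation whose forcing \<open>g\<close> collects A X_a, A N and f.\<close>
    define y where "y s = X s \<omega> - X a \<omega> - N s \<omega>" for s
    define g where "g u = A u *v X a \<omega> + A u *v N u \<omega> + f u \<omega>" for u
    have Nc: "continuous_on {a..b} (\<lambda>s. N s \<omega>)"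
      by (rule continuous_on_subset[OF cont[OF elim(4)]]) simp
    have Xc: "continuous_on {a..b} (\<lambda>s. X s \<omega>)"
      by (rule continuous_on_subset[of "{0..T}"]) (use elim ab in auto)
    have yc: "continuous_on {a..b} y"
      unfolding y_def by (intro continuous_on_diff Nc Xc continuous_on_const)
    have fi: "integrable ?L (\<lambda>u. f u \<omega>)"
      by (rule integrable_lebesgue_on_subinterval[of 0 T]) (use elim ab in auto)
    have Ai: "integrable ?L (\<lambda>u. A u *v z u)" if "continuous_on {a..b} z" for z :: "real \<Rightarrow> real^'n"
      by (rule integrable_bounded_matrix_vector[OF Am C2 continuous_imp_integrable_real[OF that]])
    have gi: "integrable ?L g"
      unfolding g_def by (intro Bochner_Integration.integrable_add Ai Nc fi continuous_on_const)
    have yb: "y b = (\<integral>u. \<Phi> b u *v g u \<partial>?L)"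
    proof (rule variation_of_constants[OF ab(1,2) bR(1) yc gi _ bab])
      fix s assume s: "s \<in> {a..b}"
      have "y s = (\<integral>u. drift u \<omega> \<partial>lebesgue_on {a..s})"
        using elim(1) s by (simp add: y_def noise_def)
      also have "\<dots> = (\<integral>u. A u *v y u + g u \<partial>lebesgue_on {a..s})"
        by (simp add: drift_def y_def g_def matrix_vector_mult_diff_distrib)
      finally show "y s = (\<integral>u. A u *v y u + g u \<partial>lebesgue_on {a..s})" .
    qed
    have Pi: "integrable ?L (\<lambda>u. \<Phi> b u *v k u)" if "integrable ?L k" for k :: "real \<Rightarrow> real^'n"
      by (rule integrable_continuous_matrix_vector[OF Pc that])
    have KN: "(\<integral>u. \<Phi> b u *v (A u *v N u \<omega>) \<partial>?L) $ i = (\<integral>u. (K u *v N u \<omega>) $ i \<partial>?L)" for i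
      using integral_bounded_linear[OF bounded_linear_vec_nth Pi[OF Ai[OF Nc]], of i]
      by (simp add: K_def matrix_vector_mul_assoc)
    have "y b = (\<integral>u. \<Phi> b u *v (A u *v X a \<omega>) \<partial>?L) + (\<integral>u. \<Phi> b u *v (A u *v N u \<omega>) \<partial>?L)
        + (\<integral>u. \<Phi> b u *v f u \<omega> \<partial>?L)"
      unfolding yb g_def
      using Pi[OF Ai[OF Nc]] Pi[OF Ai[OF continuous_on_const]] Pi[OF fi]
      by (simp add: matrix_vector_right_distrib)
    \<comment> \<open>The summand -X_a cancels the one in \<open>y b\<close>, and \<Phi>(b,a) X_a
      remains as the contribution of the initial value.\<close>
    also have "(\<integral>u. \<Phi> b u *v (A u *v X a \<omega>) \<partial>?L) = \<Phi> b a *v X a \<omega> - X a \<omega>"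
      by (rule integral_fundamental_A(1)[OF ab(1,2) bR(1)])
    finally show ?case
      by (simp add: vec_eq_iff y_def J_def KN algebra_simps)
  qed
  with sqJ orthJ JJ square_integrable_mult[OF sq\<phi> sq\<phi>] show thesis
    unfolding \<phi>_def by (intro that) auto
qed

end

section \<open>Covariance matrices\<close>

lemma integrable_vec_componentwise:
  fixes f :: "'a \<Rightarrow> 'b::euclidean_space^'n"
  assumes "\<And>i. integrable M (\<lambda>x. f x $ i)"
  shows "integrable M f"
proof -
  have "integrable M (\<lambda>x. \<Sum>i\<in>UNIV. axis i (f x $ i))"
  proof (intro Bochner_Integration.integrable_sum)
    fix i :: 'n
    have "bounded_linear (axis i :: 'b \<Rightarrow> 'b^'n)"
      by (rule linear_conv_bounded_linear[THEN iffD1]) (auto simp: linear_iff axis_def vec_eq_iff)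
    then show "integrable M (\<lambda>x. axis i (f x $ i))"
      using assms by (rule integrable_bounded_linear)
  qed
  moreover have "(\<Sum>i\<in>UNIV. axis i (f x $ i)) = f x" for x
    by (simp add: vec_eq_iff axis_def sum_component)
  ultimately show ?thesis by simp
qed

lemma integral_vec_nth:
  fixes f :: "'a \<Rightarrow> 'b::euclidean_space^'n"
  assumes "integrable M f"
  shows "integral\<^sup>L M f $ i = (\<integral>x. f x $ i \<partial>M)"
  using integral_bounded_linear[OF bounded_linear_vec_nth assms] by simp

lemma integral_matrix_nth:
  fixes f :: "'a \<Rightarrow> real^'n^'m"
  assumes "\<And>i j. integrable M (\<lambda>x. f x $ i $ j)"
  shows "integral\<^sup>L M f $ i $ j = (\<integral>x. f x $ i $ j \<partial>M)"
proof -
  have row: "integrable M (\<lambda>x. f x $ i)" for i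
    by (rule integrable_vec_componentwise) (rule assms)
  then have "integrable M f" by (rule integrable_vec_componentwise)
  then show ?thesis using row by (simp add: integral_vec_nth)
qed

lemma (in prob_space) covariance_matrix_nth:
  fixes Z :: "'a \<Rightarrow> real^'n"
  assumes Z: "\<And>i. square_integrable M (\<lambda>\<omega>. Z \<omega> $ i)"
  shows "covariance_matrix M Z $ i $ j
    = (\<integral>\<omega>. (Z \<omega> $ i - (\<integral>\<omega>. Z \<omega> $ i \<partial>M)) * (Z \<omega> $ j - (\<integral>\<omega>. Z \<omega> $ j \<partial>M)) \<partial>M)"
proof -
  have "integrable M Z"
    by (rule integrable_vec_componentwise) (rule square_integrable_integrable[OF Z])
  then have "outer_square (Z \<omega> - integral\<^sup>L M Z) $ i $ j
      = (Z \<omega> $ i - (\<integral>\<omega>. Z \<omega> $ i \<partial>M)) * (Z \<omega> $ j - (\<integral>\<omega>. Z \<omega> $ j \<partial>M))" for \<omega> i j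
    by (simp add: outer_square_nth integral_vec_nth)
  moreover have "integrable M (\<lambda>\<omega>. (Z \<omega> $ i - (\<integral>\<omega>. Z \<omega> $ i \<partial>M)) * (Z \<omega> $ j - (\<integral>\<omega>. Z \<omega> $ j \<partial>M)))" for i j
    by (intro square_integrable_mult square_integrable_diff Z square_integrable_const)
  ultimately show ?thesis
    unfolding covariance_matrix_def by (subst integral_matrix_nth) simp_all
qed

text \<open>Centering removes \<open>c\<close> and leaves P (Y - E Y) + J, whose two cross terms
  vanish. Square-integrability of X is read off from the almost sure representation.\<close>

lemma (in prob_space) covariance_matrix_affine_orthogonal:
  fixes X Y J :: "'a \<Rightarrow> real^'n" and P :: "real^'n^'n"
  assumes X: "X \<in> borel_measurable M"
    and Y: "\<And>i. square_integrable M (\<lambda>\<omega>. Y \<omega> $ i)" and J: "\<And>i. square_integrable M (\<lambda>\<omega>. J \<omega> $ i)"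
    and eq: "AE \<omega> in M. X \<omega> = P *v Y \<omega> + c + J \<omega>"
    and mean: "\<And>i. expectation (\<lambda>\<omega>. J \<omega> $ i) = 0"
    and orth: "\<And>i k. expectation (\<lambda>\<omega>. J \<omega> $ i * Y \<omega> $ k) = 0"
  shows "covariance_matrix M X $ i $ j
    = (P ** covariance_matrix M Y ** transpose P) $ i $ j + expectation (\<lambda>\<omega>. J \<omega> $ i * J \<omega> $ j)"
proof -
  have Yi: "integrable M (\<lambda>\<omega>. Y \<omega> $ k)" and Ji: "integrable M (\<lambda>\<omega>. J \<omega> $ k)" for k
    by (intro square_integrable_integrable Y J)+
  define m where "m k = expectation (\<lambda>\<omega>. Y \<omega> $ k)" for k
  define y where "y k \<omega> = Y \<omega> $ k - m k" for k \<omega>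
  define p where "p i \<omega> = (\<Sum>k\<in>UNIV. P $ i $ k * y k \<omega>)" for i \<omega>
  have sqy: "square_integrable M (y k)" for k
    unfolding y_def by (intro square_integrable_diff Y square_integrable_const)
  have sqp: "square_integrable M (p i)" for i
    unfolding p_def by (intro square_integrable_sum square_integrable_cmult sqy)
  have Xm: "(\<lambda>\<omega>. X \<omega> $ i) \<in> borel_measurable M" for i using X by measurable
  have Xi: "AE \<omega> in M. X \<omega> $ i = (\<Sum>k\<in>UNIV. P $ i $ k * Y \<omega> $ k) + c $ i + J \<omega> $ i" for i
    using eq by eventually_elim (simp add: matrix_vector_mult_def)
  have sqX: "square_integrable M (\<lambda>\<omega>. X \<omega> $ i)" for i
  proof (rule square_integrable_cong_AE[OF _ Xm])
    show "square_integrable M (\<lambda>\<omega>. (\<Sum>k\<in>UNIV. P $ i $ k * Y \<omega> $ k) + c $ i + J \<omega> $ i)"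
      by (intro square_integrable_add square_integrable_sum square_integrable_cmult Y J square_integrable_const)
    show "AE \<omega> in M. (\<Sum>k\<in>UNIV. P $ i $ k * Y \<omega> $ k) + c $ i + J \<omega> $ i = X \<omega> $ i"
      using Xi[of i] by eventually_elim simp
  qed
  have EX: "expectation (\<lambda>\<omega>. X \<omega> $ i) = (\<Sum>k\<in>UNIV. P $ i $ k * m k) + c $ i" for i
  proof -
    have "expectation (\<lambda>\<omega>. X \<omega> $ i) = expectation (\<lambda>\<omega>. (\<Sum>k\<in>UNIV. P $ i $ k * Y \<omega> $ k) + c $ i + J \<omega> $ i)"
      by (rule integral_cong_AE[OF Xm _ Xi])
         (intro borel_measurable_integrable Bochner_Integration.integrable_add
          Bochner_Integration.integrable_sum integrable_mult_right Yi Ji integrable_const)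
    then show ?thesis using Yi Ji by (simp add: mean m_def prob_space)
  qed
  have cen: "AE \<omega> in M. X \<omega> $ i - expectation (\<lambda>\<omega>. X \<omega> $ i) = p i \<omega> + J \<omega> $ i" for i
    using Xi[of i]
    by eventually_elim (simp add: EX p_def y_def right_diff_distrib sum_subtractf)
  \<comment> \<open>Orthogonality to the centered \<open>y k\<close> uses \<open>orth\<close> for Y
    itself and \<open>mean\<close> for the constant subtracted from it.\<close>
  have Jy: "expectation (\<lambda>\<omega>. J \<omega> $ i * y k \<omega>) = 0" for i k
    using square_integrable_mult[OF J Y, of i k] Ji[of i] mean[of i] orth[of i k]
    by (simp add: y_def right_diff_distrib)
  have Jp: "expectation (\<lambda>\<omega>. J \<omega> $ i * p j \<omega>) = 0" for i j
  proof -
    have "expectation (\<lambda>\<omega>. J \<omega> $ i * p j \<omega>) = expectation (\<lambda>\<omega>. \<Sum>k\<in>UNIV. P $ j $ k * (J \<omega> $ i * y k \<omega>))"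
      by (simp add: p_def sum_distrib_left mult.left_commute)
    also have "\<dots> = (\<Sum>k\<in>UNIV. P $ j $ k * expectation (\<lambda>\<omega>. J \<omega> $ i * y k \<omega>))"
      using square_integrable_mult[OF J sqy] by simp
    finally show ?thesis by (simp add: Jy)
  qed
  have pp: "expectation (\<lambda>\<omega>. p i \<omega> * p j \<omega>) = (P ** covariance_matrix M Y ** transpose P) $ i $ j"
  proof -
    have yy: "expectation (\<lambda>\<omega>. y k \<omega> * y l \<omega>) = covariance_matrix M Y $ k $ l" for k l
      by (simp add: covariance_matrix_nth[OF Y] y_def m_def)
    have i: "integrable M (\<lambda>\<omega>. P $ j $ l * (P $ i $ k * (y k \<omega> * y l \<omega>)))" for k l
      by (intro integrable_mult_right square_integrable_mult sqy)
    have "expectation (\<lambda>\<omega>. p i \<omega> * p j \<omega>)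
        = expectation (\<lambda>\<omega>. \<Sum>l\<in>UNIV. \<Sum>k\<in>UNIV. P $ j $ l * (P $ i $ k * (y k \<omega> * y l \<omega>)))"
    proof (intro Bochner_Integration.integral_cong refl)
      fix \<omega>
      have "p i \<omega> * p j \<omega> = (\<Sum>k\<in>UNIV. \<Sum>l\<in>UNIV. P $ j $ l * (P $ i $ k * (y k \<omega> * y l \<omega>)))"
        by (simp add: p_def sum_product ac_simps)
      then show "p i \<omega> * p j \<omega> = (\<Sum>l\<in>UNIV. \<Sum>k\<in>UNIV. P $ j $ l * (P $ i $ k * (y k \<omega> * y l \<omega>)))"
        by (subst sum.swap)
    qed
    also have "\<dots> = (\<Sum>l\<in>UNIV. \<Sum>k\<in>UNIV. expectation (\<lambda>\<omega>. P $ j $ l * (P $ i $ k * (y k \<omega> * y l \<omega>))))"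
      by (subst Bochner_Integration.integral_sum, intro Bochner_Integration.integrable_sum i)
         (intro sum.cong refl Bochner_Integration.integral_sum i)
    also have "\<dots> = (\<Sum>l\<in>UNIV. \<Sum>k\<in>UNIV. P $ j $ l * (P $ i $ k * covariance_matrix M Y $ k $ l))"
      by (simp add: yy)
    also have "\<dots> = (P ** covariance_matrix M Y ** transpose P) $ i $ j"
      by (simp add: matrix_matrix_mult_def transpose_def sum_distrib_left mult.commute)
    finally show ?thesis .
  qed
  have "covariance_matrix M X $ i $ j = expectation (\<lambda>\<omega>. (p i \<omega> + J \<omega> $ i) * (p j \<omega> + J \<omega> $ j))"
    unfolding covariance_matrix_nth[OF sqX]
  proof (rule integral_cong_AE)
    show "(\<lambda>\<omega>. (X \<omega> $ i - expectation (\<lambda>\<omega>. X \<omega> $ i)) * (X \<omega> $ j - expectation (\<lambda>\<omega>. X \<omega> $ j))) \<in> borel_measurable M"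
      using Xm by measurable
    show "(\<lambda>\<omega>. (p i \<omega> + J \<omega> $ i) * (p j \<omega> + J \<omega> $ j)) \<in> borel_measurable M"
      by (intro borel_measurable_integrable square_integrable_mult square_integrable_add sqp J)
    show "AE \<omega> in M. (X \<omega> $ i - expectation (\<lambda>\<omega>. X \<omega> $ i)) * (X \<omega> $ j - expectation (\<lambda>\<omega>. X \<omega> $ j))
        = (p i \<omega> + J \<omega> $ i) * (p j \<omega> + J \<omega> $ j)"
      using cen[of i] cen[of j] by eventually_elim simp
  qed
  also have "\<dots> = expectation (\<lambda>\<omega>. p i \<omega> * p j \<omega> + J \<omega> $ j * p i \<omega> + J \<omega> $ i * p j \<omega> + J \<omega> $ i * J \<omega> $ j)"
    by (intro Bochner_Integration.integral_cong refl) (simp add: algebra_simps)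
  also have "\<dots> = expectation (\<lambda>\<omega>. p i \<omega> * p j \<omega>) + expectation (\<lambda>\<omega>. J \<omega> $ i * J \<omega> $ j)"
    using square_integrable_mult[OF sqp sqp, of i j] square_integrable_mult[OF J sqp, of j i]
      square_integrable_mult[OF J sqp, of i j] square_integrable_mult[OF J J, of i j] Jp by simp
  finally show ?thesis by (simp add: pp)
qed

section \<open>Translation of Lebesgue integrals\<close>

lemma lebesgue_on_shift:
  fixes k :: "real \<Rightarrow> 'b::euclidean_space"
  shows "integral\<^sup>L (lebesgue_on {a..b}) (\<lambda>u. k (u - h)) = integral\<^sup>L (lebesgue_on {a - h..b - h}) k"
    and "integrable (lebesgue_on {a..b}) (\<lambda>u. k (u - h)) \<longleftrightarrow> integrable (lebesgue_on {a - h..b - h}) k"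
proof -
  have ind: "indicator {a - h..b - h} (- h + 1 * u) = (indicator {a..b} u :: real)" for u
    by (auto simp: indicator_def)
  have iff: "has_bochner_integral (lebesgue_on {a - h..b - h}) k x
      \<longleftrightarrow> has_bochner_integral (lebesgue_on {a..b}) (\<lambda>u. k (u - h)) x" for x
    using has_bochner_integral_lebesgue_real_affine_iff[of 1 "\<lambda>u. indicator {a - h..b - h} u *\<^sub>R k u" x "- h"]
    unfolding ind by (simp add: has_bochner_integral_restrict_space)
  then show i: "integrable (lebesgue_on {a..b}) (\<lambda>u. k (u - h)) \<longleftrightarrow> integrable (lebesgue_on {a - h..b - h}) k"
    by (simp add: integrable.simps)
  show "integral\<^sup>L (lebesgue_on {a..b}) (\<lambda>u. k (u - h)) = integral\<^sup>L (lebesgue_on {a - h..b - h}) k"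
  proof (cases "integrable (lebesgue_on {a - h..b - h}) k")
    case True
    then show ?thesis using iff by (metis has_bochner_integral_iff)
  next
    \<comment> \<open>Neither integrand is integrable, so both integrals have the default value
      0.\<close>
    case False
    then show ?thesis using i by (simp add: not_integrable_integral_eq)
  qed
qed

section \<open>Delayed controls\<close>

lemma AE_lebesgue_shift:
  fixes h :: real
  assumes "AE x in lebesgue. P x"
  shows "AE x in lebesgue. P (x - h)"
proof -
  have "negligible {x. \<not> P x}"
    using assms by (simp add: completion.AE_iff_null_sets negligible_iff_null_sets)
  then have "negligible ((+) h ` {x. \<not> P x})" by (rule negligible_translation)
  moreover have "(+) h ` {x. \<not> P x} = {x. \<not> P (x - h)}"
  proof (intro equalityI subsetI)
    fix x assume "x \<in> {x. \<not> P (x - h)}"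
    then show "x \<in> (+) h ` {x. \<not> P x}" by (intro image_eqI[of _ _ "x - h"]) auto
  qed auto
  ultimately show ?thesis
    by (simp add: completion.AE_iff_null_sets negligible_iff_null_sets)
qed

locale delayed_control = wiener M F W for M :: "'a measure" and F W +
  fixes T h :: real and U :: "real \<Rightarrow> 'a \<Rightarrow> real^'m"
  assumes T_pos: "0 < T" and U: "L2_adapted M F T U"
begin

text \<open>The delayed control, made total by the value 0: on times outside [0,T] the adaptedness
  and measurability conditions on \<open>U\<close> say nothing.\<close>

definition V :: "real \<Rightarrow> 'a \<Rightarrow> real^'m" where
  "V u \<omega> = (if u - h \<in> {0..T} then U (u - h) \<omega> else 0)"

lemma V_jointly_measurable: "(\<lambda>(u, \<omega>). V u \<omega>) \<in> borel_measurable (borel \<Otimes>\<^sub>M M)"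
proof -
  \<comment> \<open>\<open>U\<close> is known to be measurable only over [0,T]; clamping the time
    keeps the composition inside that range, and the case distinction then reinstates the value
    0.\<close>
  define c where "c u = max 0 (min T (u - h))" for u
  have [measurable]: "c \<in> borel_measurable borel" unfolding c_def[abs_def] by measurable
  have "c \<in> borel \<rightarrow>\<^sub>M restrict_space lborel {0..T}"
    by (rule measurable_restrict_space2) (use T_pos in \<open>simp_all add: c_def\<close>)
  then have "(\<lambda>p. (c (fst p), snd p)) \<in> borel \<Otimes>\<^sub>M M \<rightarrow>\<^sub>M restrict_space lborel {0..T} \<Otimes>\<^sub>M M"
    by measurable
  from measurable_compose[OF this, of "\<lambda>(t, \<omega>). U t \<omega>" borel]
  have [measurable]: "(\<lambda>p. U (c (fst p)) (snd p)) \<in> borel_measurable (borel \<Otimes>\<^sub>M M)"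
    using U by (simp add: L2_adapted_def)
  have "(\<lambda>p. if fst p - h \<in> {0..T} then U (c (fst p)) (snd p) else 0) \<in> borel_measurable (borel \<Otimes>\<^sub>M M)"
    by measurable
  moreover have "(\<lambda>p. if fst p - h \<in> {0..T} then U (c (fst p)) (snd p) else 0) = (\<lambda>(u, \<omega>). V u \<omega>)"
    by (auto simp: V_def c_def fun_eq_iff)
  ultimately show ?thesis by (simp only:)
qed

lemma V_jointly_measurable_on: "(\<lambda>(u, \<omega>). V u \<omega>) \<in> borel_measurable (lebesgue_on {lo..hi} \<Otimes>\<^sub>M M)"
proof -
  have [measurable]: "(\<lambda>x. x) \<in> borel_measurable (lebesgue_on {lo..hi})"
    by (rule measurable_restrict_space1) (simp add: measurable_completion)
  have "(\<lambda>p. (fst p, snd p)) \<in> lebesgue_on {lo..hi} \<Otimes>\<^sub>M M \<rightarrow>\<^sub>M borel \<Otimes>\<^sub>M M" by measurable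
  from measurable_compose[OF this V_jointly_measurable] show ?thesis by (simp add: split_def)
qed

text \<open>This is where the delay enters: a control acting at time u \<le> s + h was chosen at
  time u - h \<le> s.\<close>

lemma V_adapted:
  assumes "0 \<le> s" "s \<le> T" "u - h \<le> s"
  shows "V u \<in> borel_measurable (F s)"
proof (cases "u - h \<in> {0..T}")
  case True
  then have "U (u - h) \<in> borel_measurable (F (u - h))" using U by (simp add: L2_adapted_def)
  then have "U (u - h) \<in> borel_measurable (F s)" by (rule measurable_F_mono[rotated 2]) (use True assms in auto)
  then show ?thesis using True by (simp add: V_def[abs_def])
next
  case False
  then have "V u = (\<lambda>\<omega>. 0)" by (auto simp: V_def fun_eq_iff)
  then show ?thesis by simp
qed

text \<open>Fubini gives finite second moments of U for almost every time; the exceptional null set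
  is completed and translated by \<open>h\<close>.\<close>

lemma V_L2:
  shows "AE u in lebesgue_on {lo..hi}. integrable M (\<lambda>\<omega>. (norm (V u \<omega>))\<^sup>2)"
    and "integrable (lebesgue_on {lo..hi}) (\<lambda>u. \<integral>\<omega>. (norm (V u \<omega>))\<^sup>2 \<partial>M)"
proof -
  let ?P = "restrict_space lborel {0..T}"
  have "finite_measure ?P"
    by (rule finite_measureI) (use T_pos in \<open>simp add: emeasure_restrict_space\<close>)
  interpret P: finite_measure ?P by fact
  interpret pair_sigma_finite ?P M ..
  have i: "integrable (?P \<Otimes>\<^sub>M M) (\<lambda>(t, \<omega>). (norm (U t \<omega>))\<^sup>2)"
    using U by (simp add: L2_adapted_def)
  have "AE s in lborel. s \<in> {0..T} \<longrightarrow> integrable M (\<lambda>\<omega>. (norm (U s \<omega>))\<^sup>2)"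
    using AE_integrable_fst'[OF i] by (simp add: AE_restrict_space_iff)
  then have "AE s in lebesgue. s \<in> {0..T} \<longrightarrow> integrable M (\<lambda>\<omega>. (norm (U s \<omega>))\<^sup>2)"
    by (rule AE_completion)
  from AE_lebesgue_shift[OF this, of h]
  have "AE u in lebesgue. integrable M (\<lambda>\<omega>. (norm (V u \<omega>))\<^sup>2)"
  proof eventually_elim
    case (elim u)
    then show ?case by (cases "u - h \<in> {0..T}") (simp_all add: V_def del: atLeastAtMost_iff)
  qed
  then show "AE u in lebesgue_on {lo..hi}. integrable M (\<lambda>\<omega>. (norm (V u \<omega>))\<^sup>2)"
    by (auto simp: AE_restrict_space_iff elim: eventually_mono)
  define g where "g s = indicator {0..T} s *\<^sub>R (\<integral>\<omega>. (norm (U s \<omega>))\<^sup>2 \<partial>M)" for s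
  have "integrable lborel g"
    using integrable_fst'[OF i] by (simp add: integrable_restrict_space g_def[abs_def])
  then have "integrable lebesgue g" by (simp add: integrable_completion borel_measurable_integrable)
  then have "integrable lebesgue (\<lambda>u. g (- h + 1 * u))"
    by (subst (asm) lebesgue_integrable_real_affine_iff[of 1 g "- h", symmetric]) auto
  then have "integrable lebesgue (\<lambda>u. indicator {lo..hi} u *\<^sub>R g (- h + 1 * u))"
    by (intro integrable_mult_indicator) auto
  moreover have "g (- h + 1 * u) = (\<integral>\<omega>. (norm (V u \<omega>))\<^sup>2 \<partial>M)" for u
    by (cases "u - h \<in> {0..T}") (simp_all add: g_def V_def del: atLeastAtMost_iff)
  ultimately show "integrable (lebesgue_on {lo..hi}) (\<lambda>u. \<integral>\<omega>. (norm (V u \<omega>))\<^sup>2 \<partial>M)"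
    using integrable_restrict_space[of "{lo..hi}" lebesgue "\<lambda>u. \<integral>\<omega>. (norm (V u \<omega>))\<^sup>2 \<partial>M"] by simp
qed

section \<open>Time integrals of the delayed control against a bounded kernel\<close>

context
  fixes lo hi C :: real and K :: "real \<Rightarrow> real^'m^'k"
  assumes K: "K \<in> borel_measurable (lebesgue_on {lo..hi})"
    and KC: "AE u in lebesgue_on {lo..hi}. \<forall>x. norm (K u *v x) \<le> C * norm x"
begin

lemma V_process: "L2_process (lebesgue_on {lo..hi}) M (\<lambda>u \<omega>. (K u *v V u \<omega>) $ i)"
  by (rule L2_process_matrix_mult[OF finite_measure_lebesgue_on_Icc finite_measure_axioms
        V_jointly_measurable_on K KC V_L2])

lemma control_integrable: "AE \<omega> in M. integrable (lebesgue_on {lo..hi}) (\<lambda>u. K u *v V u \<omega>)"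
proof -
  have "AE \<omega> in M. \<forall>i\<in>UNIV. square_integrable (lebesgue_on {lo..hi}) (\<lambda>u. (K u *v V u \<omega>) $ i)"
    by (intro AE_finite_allI finite L2_process.AE_square_integrable[OF V_process])
  then show ?thesis
    by eventually_elim
       (intro integrable_vec_componentwise finite_measure.square_integrable_integrable
          finite_measure_lebesgue_on_Icc, simp)
qed

text \<open>Off the event where the vector integrand is integrable, the vector integral defaults to
  0 while a single component may still have a nonzero integral; hence only an almost sure
  identity.\<close>

lemma control_component:
  "AE \<omega> in M. (\<integral>u. (K u *v V u \<omega>) $ i \<partial>lebesgue_on {lo..hi}) = (\<integral>u. K u *v V u \<omega> \<partial>lebesgue_on {lo..hi}) $ i"
  using control_integrable by eventually_elim (simp add: integral_vec_nth)

lemma control_measurable: "(\<lambda>\<omega>. \<integral>u. K u *v V u \<omega> \<partial>lebesgue_on {lo..hi}) \<in> borel_measurable M"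
proof -
  interpret L: finite_measure "lebesgue_on {lo..hi}" by (rule finite_measure_lebesgue_on_Icc)
  have [measurable]: "(\<lambda>p. V (fst p) (snd p)) \<in> borel_measurable (lebesgue_on {lo..hi} \<Otimes>\<^sub>M M)"
    using V_jointly_measurable_on by (simp add: split_def)
  have "(\<lambda>p. (snd p, fst p)) \<in> M \<Otimes>\<^sub>M lebesgue_on {lo..hi} \<rightarrow>\<^sub>M lebesgue_on {lo..hi} \<Otimes>\<^sub>M M" by measurable
  from measurable_compose[OF this, of "\<lambda>p. V (fst p) (snd p)" borel]
  have [measurable]: "(\<lambda>p. V (snd p) (fst p)) \<in> borel_measurable (M \<Otimes>\<^sub>M lebesgue_on {lo..hi})"
    by simp
  note K[measurable]
  have "(\<lambda>(\<omega>, u). K u *v V u \<omega>) \<in> borel_measurable (M \<Otimes>\<^sub>M lebesgue_on {lo..hi})"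
    unfolding split_def by measurable
  then show ?thesis by (rule L.borel_measurable_lebesgue_integral)
qed

lemma control_square_integrable:
  "square_integrable M (\<lambda>\<omega>. (\<integral>u. K u *v V u \<omega> \<partial>lebesgue_on {lo..hi}) $ i)"
  by (rule square_integrable_cong_AE[OF L2_process.square_integrable_integral[OF V_process] _ control_component])
     (rule borel_measurable_vec_component[OF control_measurable])

lemma control_orthogonal:
  assumes s: "0 \<le> s" "s \<le> T" "hi - h \<le> s" and \<psi>: "square_integrable M \<psi>"
    and orth: "\<And>\<xi>. \<xi> \<in> borel_measurable (F s) \<Longrightarrow> square_integrable M \<xi> \<Longrightarrow> expectation (\<lambda>\<omega>. \<psi> \<omega> * \<xi> \<omega>) = 0"
  shows "expectation (\<lambda>\<omega>. \<psi> \<omega> * (\<integral>u. K u *v V u \<omega> \<partial>lebesgue_on {lo..hi}) $ i) = 0"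
proof -
  have \<psi>m[measurable]: "\<psi> \<in> borel_measurable M" using \<psi> by (rule square_integrable_measurable)
  have "expectation (\<lambda>\<omega>. \<psi> \<omega> * (\<integral>u. K u *v V u \<omega> \<partial>lebesgue_on {lo..hi}) $ i)
      = expectation (\<lambda>\<omega>. (\<integral>u. (K u *v V u \<omega>) $ i \<partial>lebesgue_on {lo..hi}) * \<psi> \<omega>)"
  proof (rule integral_cong_AE)
    show "(\<lambda>\<omega>. \<psi> \<omega> * (\<integral>u. K u *v V u \<omega> \<partial>lebesgue_on {lo..hi}) $ i) \<in> borel_measurable M"
      using control_measurable by measurable
    show "(\<lambda>\<omega>. (\<integral>u. (K u *v V u \<omega>) $ i \<partial>lebesgue_on {lo..hi}) * \<psi> \<omega>) \<in> borel_measurable M"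
      using L2_process.integral_measurable[OF V_process, of i] by measurable
    show "AE \<omega> in M. \<psi> \<omega> * (\<integral>u. K u *v V u \<omega> \<partial>lebesgue_on {lo..hi}) $ i
        = (\<integral>u. (K u *v V u \<omega>) $ i \<partial>lebesgue_on {lo..hi}) * \<psi> \<omega>"
      using control_component[of i] by eventually_elim simp
  qed
  also have "\<dots> = (\<integral>u. (\<integral>\<omega>. (K u *v V u \<omega>) $ i * \<psi> \<omega> \<partial>M) \<partial>lebesgue_on {lo..hi})"
    by (rule L2_process.expectation_integral_mult[OF V_process \<psi>])
  also have "\<dots> = 0"
  proof (rule integral_eq_zero_AE)
    show "AE u in lebesgue_on {lo..hi}. (\<integral>\<omega>. (K u *v V u \<omega>) $ i * \<psi> \<omega> \<partial>M) = 0"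
      using L2_process.AE_section_square_integrable[OF V_process, of i] AE_space
    proof eventually_elim
      case (elim u)
      then have Vu: "V u \<in> borel_measurable (F s)" using s by (intro V_adapted) auto
      have "(\<lambda>\<omega>. (K u *v V u \<omega>) $ i) \<in> borel_measurable (F s)"
        using Vu by measurable
      from orth[OF this elim(1)] show ?case by (simp add: mult.commute)
    qed
  qed
  finally show ?thesis .
qed

end

end

section \<open>Covariance of the state in terms of its Artstein transform\<close>

theorem lemma4:
  fixes M :: "'a measure" and F :: "real \<Rightarrow> 'a measure" and W :: "real \<Rightarrow> 'a \<Rightarrow> real"
    and T h :: real
    and A :: "real \<Rightarrow> real^'n^'n" and B :: "real \<Rightarrow> real^'m^'n"
    and \<sigma> r :: "real \<Rightarrow> real^'n" and \<Phi> :: "real \<Rightarrow> real \<Rightarrow> real^'n^'n"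
    and U :: "real \<Rightarrow> 'a \<Rightarrow> real^'m" and X Y :: "real \<Rightarrow> 'a \<Rightarrow> real^'n"
  assumes "0 < T" and "0 < h" and "h < T"
    and "filtered_prob_space M F" and "wiener_process M F W"
    and "Linfty_on {0..T + h} A" and "Linfty_on {0..T + h} B"
    and "Linfty_on {0..T} \<sigma>" and "Linfty_on {0..T} r"
    and "fundamental_matrix_on 0 (T + h) A \<Phi>"
    and "\<And>\<tau>. 0 < \<tau> \<Longrightarrow> \<tau> < T + h \<Longrightarrow> invertible (gramian \<Phi> B \<tau> (T + h))"
    and "L2_adapted M F T U"
    and "\<And>s \<omega>. s \<in> {-h..<0} \<Longrightarrow> \<omega> \<in> space M \<Longrightarrow> U s \<omega> = 0"
    and "sde_solution M F W T (\<lambda>t \<omega> x. A t *v x + B t *v U (t - h) \<omega> + r t) \<sigma> 0 X"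
    and "\<And>t \<omega>. t \<in> {0..T} \<Longrightarrow> \<omega> \<in> space M \<Longrightarrow> Y t \<omega> = artstein_transform \<Phi> B h U X t \<omega>"
  shows "\<forall>t\<in>{h..T}. covariance_matrix M (X t) =
           \<Phi> t (t - h) ** covariance_matrix M (Y (t - h)) ** transpose (\<Phi> t (t - h))
           + Sigma_min \<Phi> \<sigma> h t"
proof
  fix t assume t: "t \<in> {h..T}"
  define \<tau> where "\<tau> = t - h"
  define f where "f u \<omega> = B u *v U (u - h) \<omega> + r u" for u \<omega>
  interpret C: delayed_control M F W T h U
  proof (intro delayed_control.intro wiener.intro wiener_axioms.intro delayed_control_axioms.intro)
    show "prob_space M" using assms(4) by (simp add: filtered_prob_space_def)
  qed (use assms in auto)
  have pt: "0 \<le> \<tau>" "\<tau> \<le> t" "t \<le> T" "\<tau> \<le> T" "t \<le> T + h" using t assms(1-3) by (auto simp: \<tau>_def)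
  interpret A: linear_system "T + h" A \<Phi>
    by (rule linear_system.intro) (use assms in simp_all)
  \<comment> \<open>For u < h the shifted time lies in [-h,0), where \<open>U\<close> vanishes by
    its extension, in agreement with the value 0 of \<open>V\<close>.\<close>
  have Vf: "B u *v C.V u \<omega> = B u *v U (u - h) \<omega>" if "u \<in> {0..T}" "\<omega> \<in> space M" for u \<omega>
    using assms(13)[of "u - h" \<omega>] that assms(2) by (auto simp: C.V_def)
  have Bm: "B \<in> borel_measurable (lebesgue_on {0..T + h})"
    using assms(7) by (simp add: Linfty_on_def)
  obtain CB where CB: "AE u in lebesgue_on {0..T + h}. \<forall>x. norm (B u *v x) \<le> CB * norm x"
    using Linfty_on_matrix_bound[OF assms(7)] by blast
  have Bm': "B \<in> borel_measurable (lebesgue_on {lo..hi})"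
    and CB': "AE u in lebesgue_on {lo..hi}. \<forall>x. norm (B u *v x) \<le> CB * norm x"
    if "0 \<le> lo" "hi \<le> T + h" for lo hi
    using measurable_lebesgue_on_subinterval[OF Bm that] AE_lebesgue_on_subinterval[OF CB that] by auto
  have ri: "integrable (lebesgue_on {0..T}) r"
  proof -
    obtain c where "AE u in lebesgue_on {0..T}. norm (r u) \<le> c" and "r \<in> borel_measurable (lebesgue_on {0..T})"
      using assms(9) by (auto simp: Linfty_on_def)
    then show ?thesis
      by (intro finite_measure.integrable_const_bound[OF finite_measure_lebesgue_on_Icc])
  qed
  have BVi: "AE \<omega> in M. integrable (lebesgue_on {0..T}) (\<lambda>u. B u *v C.V u \<omega>)"
    by (rule C.control_integrable[OF Bm' CB']) (use assms(2) in auto)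
  have fi: "AE \<omega> in M. integrable (lebesgue_on {0..T}) (\<lambda>u. f u \<omega>)"
    using BVi AE_space
  proof eventually_elim
    case (elim \<omega>)
    have "integrable (lebesgue_on {0..T}) (\<lambda>u. B u *v U (u - h) \<omega>)
        \<longleftrightarrow> integrable (lebesgue_on {0..T}) (\<lambda>u. B u *v C.V u \<omega>)"
      by (intro Bochner_Integration.integrable_cong refl) (use Vf elim(2) in auto)
    then show ?case unfolding f_def using elim(1) ri by simp
  qed
  have "(\<lambda>t \<omega> x. A t *v x + B t *v U (t - h) \<omega> + r t) = (\<lambda>t \<omega> x. A t *v x + f t \<omega>)"
    by (simp add: f_def fun_eq_iff add.assoc)
  with assms(14) have sde: "sde_solution M F W T (\<lambda>t \<omega> x. A t *v x + f t \<omega>) \<sigma> 0 X" by simp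
  interpret S: linear_sde M F W "T + h" A \<Phi> T \<sigma> f X
    by (intro linear_sde.intro linear_sde_axioms.intro C.wiener_axioms A.linear_system_axioms sde fi)
       (use assms in simp_all)

  define K where "K b u = \<Phi> b u ** B u" for b u
  \<comment> \<open>The controls acting on [lo,hi], transported to time \<open>b\<close>. With
    \<open>b = \<tau>\<close> on [\<tau>,t] this is the integral in the Artstein transform, where
    \<Phi> runs backward in time; with \<open>b = t\<close> it is their contribution to X_t.\<close>
  define ctrl where "ctrl b lo hi \<omega> = (\<integral>u. K b u *v C.V u \<omega> \<partial>lebesgue_on {lo..hi})" for b lo hi \<omega>
  have Pc: "continuous_on {lo..hi} (\<Phi> b)" if "b \<in> {0..T + h}" "0 \<le> lo" "hi \<le> T + h" for b lo hi
    by (rule continuous_on_subset[OF A.continuous_on_fundamental_right[OF that(1)]]) (use that in auto)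
  have Km: "K b \<in> borel_measurable (lebesgue_on {lo..hi})"
    and KC: "\<exists>C. AE u in lebesgue_on {lo..hi}. \<forall>x. norm (K b u *v x) \<le> C * norm x"
    if "b \<in> {0..T + h}" "0 \<le> lo" "hi \<le> T + h" for b lo hi
  proof -
    note L = continuous_matrix_Linfty[OF Pc[OF that]]
    have "\<Phi> b \<in> borel_measurable (lebesgue_on {lo..hi})" using L by (simp add: Linfty_on_def)
    then show "K b \<in> borel_measurable (lebesgue_on {lo..hi})"
      unfolding K_def[abs_def] using Bm'[OF that(2,3)] by measurable
    obtain C1 where C1: "AE u in lebesgue_on {lo..hi}. \<forall>x. norm (\<Phi> b u *v x) \<le> C1 * norm x"
      using Linfty_on_matrix_bound[OF L] by blast
    have "AE u in lebesgue_on {lo..hi}. \<forall>x. norm (K b u *v x) \<le> (\<bar>C1\<bar> * CB) * norm x"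
      using C1 CB'[OF that(2,3)]
    proof eventually_elim
      case (elim u)
      show ?case
      proof
        fix x
        have "norm (K b u *v x) \<le> C1 * norm (B u *v x)"
          using elim(1) by (simp add: K_def flip: matrix_vector_mul_assoc)
        also have "\<dots> \<le> \<bar>C1\<bar> * norm (B u *v x)" by (intro mult_right_mono) auto
        also have "\<dots> \<le> \<bar>C1\<bar> * (CB * norm x)" using elim(2) by (intro mult_left_mono) auto
        finally show "norm (K b u *v x) \<le> (\<bar>C1\<bar> * CB) * norm x" by simp
      qed
    qed
    then show "\<exists>C. AE u in lebesgue_on {lo..hi}. \<forall>x. norm (K b u *v x) \<le> C * norm x" by blast
  qed
  have ctrl_int: "AE \<omega> in M. integrable (lebesgue_on {lo..hi}) (\<lambda>u. K b u *v C.V u \<omega>)"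
    and ctrl_sq: "\<And>i. square_integrable M (\<lambda>\<omega>. ctrl b lo hi \<omega> $ i)"
    and ctrl_m: "ctrl b lo hi \<in> borel_measurable M"
    if bl: "b \<in> {0..T + h}" "0 \<le> lo" "hi \<le> T + h" for b lo hi
  proof -
    obtain D where D: "AE u in lebesgue_on {lo..hi}. \<forall>x. norm (K b u *v x) \<le> D * norm x"
      using KC[OF bl] by blast
    show "AE \<omega> in M. integrable (lebesgue_on {lo..hi}) (\<lambda>u. K b u *v C.V u \<omega>)"
      by (rule C.control_integrable[OF Km[OF bl] D])
    show "\<And>i. square_integrable M (\<lambda>\<omega>. ctrl b lo hi \<omega> $ i)"
      unfolding ctrl_def by (rule C.control_square_integrable[OF Km[OF bl] D])
    show "ctrl b lo hi \<in> borel_measurable M"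
      unfolding ctrl_def by (rule C.control_measurable[OF Km[OF bl] D])
  qed
  have forced: "AE \<omega> in M. (\<integral>u. \<Phi> b u *v f u \<omega> \<partial>lebesgue_on {a..b})
      = ctrl b a b \<omega> + (\<integral>u. \<Phi> b u *v r u \<partial>lebesgue_on {a..b})"
    if ab: "0 \<le> a" "a \<le> b" "b \<le> T" for a b
  proof -
    have b: "b \<in> {0..T + h}" "b \<le> T + h" using ab assms(2) by auto
    show ?thesis
      using ctrl_int[OF b(1) ab(1) b(2)] AE_space
    proof eventually_elim
      case (elim \<omega>)
      have "integrable (lebesgue_on {a..b}) (\<lambda>u. \<Phi> b u *v r u)"
        by (rule integrable_continuous_matrix_vector[OF Pc[OF b(1) ab(1) b(2)]
              integrable_lebesgue_on_subinterval[OF ri ab(1,3)]])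
      moreover have "(\<integral>u. \<Phi> b u *v f u \<omega> \<partial>lebesgue_on {a..b})
          = (\<integral>u. K b u *v C.V u \<omega> + \<Phi> b u *v r u \<partial>lebesgue_on {a..b})"
        by (intro Bochner_Integration.integral_cong refl)
           (use Vf elim(2) ab in \<open>auto simp: f_def K_def matrix_vector_right_distrib simp flip: matrix_vector_mul_assoc\<close>)
      ultimately show ?case using elim(1) by (simp add: ctrl_def)
    qed
  qed

  have tR: "t \<in> {0..T + h}" "\<tau> \<in> {0..T + h}" using pt assms(2) by auto
  have X_F: "X s \<in> borel_measurable (F s)" if "s \<in> {0..T}" for s
    using sde that by (simp add: sde_solution_def)
  have X_m: "X s \<in> borel_measurable M" if "s \<in> {0..T}" for s
    by (rule C.measurable_F_M[OF _ X_F[OF that]]) (use that in auto)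

  \<comment> \<open>The decomposition on [0,\<tau>] expresses X_\<tau> by square-integrable terms,
    since X_0 = 0.\<close>
  have X\<tau>_sq: "square_integrable M (\<lambda>\<omega>. X \<tau> \<omega> $ i)" for i
  proof -
    obtain J0 :: "'a \<Rightarrow> real^'n" where J0: "\<And>i. square_integrable M (\<lambda>\<omega>. J0 \<omega> $ i)"
      "AE \<omega> in M. X \<tau> \<omega> = \<Phi> \<tau> 0 *v X 0 \<omega> + (\<integral>u. \<Phi> \<tau> u *v f u \<omega> \<partial>lebesgue_on {0..\<tau>}) + J0 \<omega>"
      by (rule S.decomposition[of 0 \<tau>]) (use pt in auto)
    have X0: "AE \<omega> in M. X 0 \<omega> = 0" using sde by (simp add: sde_solution_def)
    define c where "c = (\<integral>u. \<Phi> \<tau> u *v r u \<partial>lebesgue_on {0..\<tau>})"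
    show ?thesis
    proof (rule square_integrable_cong_AE)
      show "square_integrable M (\<lambda>\<omega>. ctrl \<tau> 0 \<tau> \<omega> $ i + c $ i + J0 \<omega> $ i)"
        by (intro square_integrable_add J0(1) C.square_integrable_const ctrl_sq) (use tR in auto)
      show "(\<lambda>\<omega>. X \<tau> \<omega> $ i) \<in> borel_measurable M"
        by (rule borel_measurable_vec_component[OF X_m]) (use pt in auto)
      show "AE \<omega> in M. ctrl \<tau> 0 \<tau> \<omega> $ i + c $ i + J0 \<omega> $ i = X \<tau> \<omega> $ i"
        using J0(2) X0 forced[OF order_refl pt(1,4)] by eventually_elim (simp add: c_def)
    qed
  qed

  obtain J :: "'a \<Rightarrow> real^'n" where J: "\<And>i. square_integrable M (\<lambda>\<omega>. J \<omega> $ i)"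
    "AE \<omega> in M. X t \<omega> = \<Phi> t \<tau> *v X \<tau> \<omega> + (\<integral>u. \<Phi> t u *v f u \<omega> \<partial>lebesgue_on {\<tau>..t}) + J \<omega>"
    "\<And>\<xi> i. \<xi> \<in> borel_measurable (F \<tau>) \<Longrightarrow> square_integrable M \<xi> \<Longrightarrow> C.expectation (\<lambda>\<omega>. J \<omega> $ i * \<xi> \<omega>) = 0"
    "\<And>i j. C.expectation (\<lambda>\<omega>. J \<omega> $ i * J \<omega> $ j)
       = (\<integral>v. (\<Phi> t v *v \<sigma> v) $ i * (\<Phi> t v *v \<sigma> v) $ j \<partial>lebesgue_on {\<tau>..t})"
    "\<And>i j. integrable (lebesgue_on {\<tau>..t}) (\<lambda>v. (\<Phi> t v *v \<sigma> v) $ i * (\<Phi> t v *v \<sigma> v) $ j)"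
    using S.decomposition[OF pt(1-3)] by blast

  text \<open>After substituting u = s + h, the integral in the Artstein transform at time t - h runs
    over the controls that act on X during [t - h, t].\<close>
  have Y_eq: "Y \<tau> \<omega> = X \<tau> \<omega> + ctrl \<tau> \<tau> t \<omega>" if \<omega>: "\<omega> \<in> space M" for \<omega>
  proof -
    have "Y \<tau> \<omega> = X \<tau> \<omega> + (\<integral>s. (\<Phi> \<tau> (s + h) ** B (s + h)) *v U s \<omega> \<partial>lebesgue_on {\<tau> - h..\<tau>})"
      using assms(15)[of \<tau> \<omega>] pt \<omega> by (simp add: artstein_transform_def LINT_lebesgue_on)
    also have "{\<tau> - h..\<tau>} = {\<tau> - h..t - h}" by (simp add: \<tau>_def)
    also have "(\<integral>s. (\<Phi> \<tau> (s + h) ** B (s + h)) *v U s \<omega> \<partial>lebesgue_on {\<tau> - h..t - h})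
        = (\<integral>u. (\<Phi> \<tau> u ** B u) *v U (u - h) \<omega> \<partial>lebesgue_on {\<tau>..t})"
      using lebesgue_on_shift(1)[of \<tau> t "\<lambda>s. (\<Phi> \<tau> (s + h) ** B (s + h)) *v U s \<omega>" h] by simp
    also have "\<dots> = ctrl \<tau> \<tau> t \<omega>"
      unfolding ctrl_def
      by (intro Bochner_Integration.integral_cong refl)
         (use Vf \<omega> pt in \<open>auto simp: K_def simp flip: matrix_vector_mul_assoc\<close>)
    finally show ?thesis .
  qed
  \<comment> \<open>By the cocycle identity \<Phi>(t,\<tau>) carries the integral of the Artstein
    transform to the control contribution in X_t, whenever the integral exists and the matrix may be
    moved inside.\<close>
  have ctrl_transport: "AE \<omega> in M. \<Phi> t \<tau> *v ctrl \<tau> \<tau> t \<omega> = ctrl t \<tau> t \<omega>"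
    using ctrl_int[OF tR(2) pt(1,5)]
  proof eventually_elim
    case (elim \<omega>)
    have "\<Phi> t \<tau> *v ctrl \<tau> \<tau> t \<omega> = (\<integral>u. \<Phi> t \<tau> *v (K \<tau> u *v C.V u \<omega>) \<partial>lebesgue_on {\<tau>..t})"
      unfolding ctrl_def
      by (rule integral_bounded_linear[OF bounded_linear_matrix_vector_right elim, symmetric])
    also have "\<dots> = ctrl t \<tau> t \<omega>"
      unfolding ctrl_def
    proof (intro Bochner_Integration.integral_cong refl)
      fix u assume "u \<in> space (lebesgue_on {\<tau>..t})"
      then have "u \<in> {0..T + h}" using pt by auto
      then show "\<Phi> t \<tau> *v (K \<tau> u *v C.V u \<omega>) = K t u *v C.V u \<omega>"
        using A.fundamental_cocycle[OF tR, of u]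
        by (simp add: K_def matrix_vector_mul_assoc matrix_mul_assoc)
    qed
    finally show ?case .
  qed
  \<comment> \<open>\<open>Y \<tau>\<close> is prescribed only on \<open>space M\<close>; its
    covariance sees nothing else and can be computed from this explicit representative.\<close>
  define Y' where "Y' \<omega> = X \<tau> \<omega> + ctrl \<tau> \<tau> t \<omega>" for \<omega>
  have Y'_sq: "square_integrable M (\<lambda>\<omega>. Y' \<omega> $ i)" for i
    unfolding Y'_def using X\<tau>_sq ctrl_sq[OF tR(2) pt(1,5)] by (simp add: square_integrable_add)
  have cov_Y: "covariance_matrix M (Y \<tau>) = covariance_matrix M Y'"
  proof -
    have "integral\<^sup>L M (Y \<tau>) = integral\<^sup>L M Y'"
      by (intro Bochner_Integration.integral_cong refl) (simp add: Y_eq Y'_def)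
    then show ?thesis
      unfolding covariance_matrix_def
      by (intro Bochner_Integration.integral_cong refl) (simp add: Y_eq Y'_def)
  qed
  \<comment> \<open>The constant 1 is an admissible test variable.\<close>
  have mean: "C.expectation (\<lambda>\<omega>. J \<omega> $ i) = 0" for i
    using J(3)[of "\<lambda>_. 1" i] C.square_integrable_const by simp
  have orth: "C.expectation (\<lambda>\<omega>. J \<omega> $ i * Y' \<omega> $ k) = 0" for i k
  proof -
    have "C.expectation (\<lambda>\<omega>. J \<omega> $ i * X \<tau> \<omega> $ k) = 0"
      by (rule J(3)[OF borel_measurable_vec_component[OF X_F] X\<tau>_sq]) (use pt in auto)
    \<comment> \<open>The last control involved acts at \<open>t\<close> and was chosen at exactly t
      - h = \<tau>, so the bound \<open>hi - h \<le> s\<close> holds with equality.\<close>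
    moreover have "C.expectation (\<lambda>\<omega>. J \<omega> $ i * ctrl \<tau> \<tau> t \<omega> $ k) = 0"
    proof -
      obtain D where D: "AE u in lebesgue_on {\<tau>..t}. \<forall>x. norm (K \<tau> u *v x) \<le> D * norm x"
        using KC[OF tR(2) pt(1,5)] by blast
      show ?thesis
        unfolding ctrl_def
        by (rule C.control_orthogonal[OF Km[OF tR(2) pt(1,5)] D pt(1,4) _ J(1) J(3)]) (simp_all add: \<tau>_def)
    qed
    ultimately show ?thesis
      using square_integrable_mult[OF J(1) X\<tau>_sq, of i k] square_integrable_mult[OF J(1) ctrl_sq[OF tR(2) pt(1,5)], of i k]
      by (simp add: Y'_def distrib_left)
  qed
  have X_eq: "AE \<omega> in M. X t \<omega> = \<Phi> t \<tau> *v Y' \<omega> + (\<integral>u. \<Phi> t u *v r u \<partial>lebesgue_on {\<tau>..t}) + J \<omega>"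
    using J(2) forced[OF pt(1-3)] ctrl_transport
    by eventually_elim (simp add: Y'_def matrix_vector_right_distrib)
  have min: "Sigma_min \<Phi> \<sigma> h t $ i $ j = C.expectation (\<lambda>\<omega>. J \<omega> $ i * J \<omega> $ j)" for i j
  proof -
    \<comment> \<open>P x x^T P^T is the outer square of P x, which matches the integrand in the
      second moments of \<open>J\<close>.\<close>
    have entry: "(P ** outer_square x ** transpose P) $ i $ j = (P *v x) $ i * (P *v x) $ j"
      for P :: "real^'n^'n" and x i j
    proof -
      have "(P ** outer_square x ** transpose P) $ i $ j
          = (\<Sum>l\<in>UNIV. (\<Sum>k\<in>UNIV. P $ i $ k * (x $ k * x $ l)) * P $ j $ l)"
        by (simp add: matrix_matrix_mult_def transpose_def outer_square_nth)
      also have "\<dots> = (\<Sum>l\<in>UNIV. (\<Sum>k\<in>UNIV. P $ i $ k * x $ k) * (P $ j $ l * x $ l))"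
        by (intro sum.cong refl) (simp add: sum_distrib_right sum_distrib_left ac_simps)
      finally show ?thesis by (simp add: matrix_vector_mult_def sum_distrib_left)
    qed
    show ?thesis
      unfolding Sigma_min_def LINT_lebesgue_on \<tau>_def[symmetric] J(4)
      by (subst integral_matrix_nth) (simp_all add: entry J(5))
  qed
  show "covariance_matrix M (X t) =
      \<Phi> t (t - h) ** covariance_matrix M (Y (t - h)) ** transpose (\<Phi> t (t - h)) + Sigma_min \<Phi> \<sigma> h t"
    unfolding vec_eq_iff \<tau>_def[symmetric] cov_Y
    using C.covariance_matrix_affine_orthogonal[OF X_m Y'_sq J(1) X_eq mean orth] pt
    by (simp add: min)
qed

end
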